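(* Let $\ell\in2\mathbb N_0$. The matrix functions $\widetilde P_w=\Psi^{-1}P_w$, $w\ge0$, form a sequence of orthogonal polynomials with respect to $W$ on $[-1,1]$: each $\widetilde P_w$ is a matrix polynomial of degree $w$ with nonsingular leading coefficient, and $\int_{-1}^1\widetilde P_w(u)^*W(u)\widetilde P_{w'}(u)\,du=0$ whenever $w\ne w'$. They are eigenfunctions of the differential operators $\widetilde D$ and $\widetilde E$, which are symmetric with respect to $W$; moreover $$\widetilde D\widetilde P_w=\widetilde P_w\Lambda_w\qquad\text{and}\qquad\widetilde E\widetilde P_w=\widetilde P_wM_w,$$ where $\Lambda_w=\sum_{k=0}^\ell\lambda_w(k)E_{kk}$ and $M_w=\sum_{k=0}^\ell\mu_w(k)E_{kk}$, with $$\lambda_w(k)=-(w+k)(w+k+2),\qquad\mu_w(k)=w(\tfrac\ell2-k)-k(\tfrac\ell2+1).$$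
   Context: Matrices have size $\ell+1$ with indices $0,\dots,\ell$ and $E_{jk}$ are the matrix units. $P_w$: for $w\in\mathbb N_0$, $[P_w(u)]_{jk}=a_j^{w,k}\,{}_2F_1\!\left(-w-k+j,w+k+j+2;j+\tfrac32;\tfrac{1-u}2\right)$, where $a_0^{w,k}=1$ and, for $0\le j\le\ell-1$ (with $a_{-1}^{w,k}=0$), $$i\tfrac{j(\ell-j+1)(w+k-j+1)(w+k+j+1)}{2(2j-1)(2j+1)}a_{j-1}^{w,k}-\tfrac{j(j+1)}2a_j^{w,k}-i\tfrac{(j+1)(\ell+j+2)}2a_{j+1}^{w,k}=\left(w(\tfrac\ell2-k)-k(\tfrac\ell2+1)\right)a_j^{w,k}.$$ ($P_w$ is a matrix polynomial; $a_j^{w,k}=0$ if $j>w+k$. Its $k$-th column is the vector polynomial associated to the irreducible spherical function of $(\mathrm{SO}(4),\mathrm{SO}(3))$ of $\mathrm{SO}(3)$-type $\pi_\ell$ coming from the representation of $\mathrm{SO}(4)$ of highest weight $(w+\ell/2,-k+\ell/2)$.) $\Psi=P_0$: upper triangular with $\Psi_{jk}(u)=\frac{(2j+1)(-2i)^jk!j!}{(k+j+1)!}C_{k-j}^{j+1}(u)$ for $0\le j\le k\le\ell$, $C_n^\lambda$ the Gegenbauer polynomials; its diagonal entries are nonzero constants, so $\Psi(u)^{-1}$ is a matrix polynomial. $W(u)=\frac2\pi\sqrt{1-u^2}\,\Psi(u)^*T(u)^*U^*U\,T(u)\Psi(u)$, $u\in[-1,1]$, where $T(u)=\sum_{j=0}^\ell(1-u^2)^{j/2}E_{jj}$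 and $U_{jk}={}_3F_2(-k,-j,k+1;1,-\ell;1)$. $\widetilde DF=(1-u^2)F''+(-uC+S_1)F'+\Lambda_0F$ and $\widetilde EF=(uR_2+R_1)F'+M_0F$, with $C=\sum_{j=0}^\ell(2j+3)E_{jj}$, $S_1=\sum_{j=0}^{\ell-1}2(j+1)E_{j,j+1}$, $R_1=\sum_{j=0}^{\ell-1}\frac{j+1}2E_{j,j+1}-\sum_{j=0}^{\ell-1}\frac{\ell-j}2E_{j+1,j}$, $R_2=\sum_{j=0}^\ell(\frac\ell2-j)E_{jj}$, $\Lambda_0=-\sum_{j=0}^\ell j(j+2)E_{jj}$, $M_0=-\sum_{j=0}^\ell j(\frac\ell2+1)E_{jj}$ (acting on matrix valued functions column by column). An operator $\mathcal D$ is symmetric with respect to $W$ if $\langle\mathcal DP,Q\rangle=\langle P,\mathcal DQ\rangle$ for all matrix polynomials $P,Q$, where $\langle P,Q\rangle=\int_{-1}^1P(u)^*W(u)Q(u)\,du$. *)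

theory Defs
  imports
    "HOL-Analysis.Analysis"
    "Jordan_Normal_Form.Gauss_Jordan_Elimination"
    "Jordan_Normal_Form.Schur_Decomposition"
begin

(* Throughout, l is the parameter of the SO(3)-type; all matrices are complex,
   have size l + 1 and are indexed by 0, ..., l.  Matrix valued functions and
   matrix polynomials are functions of a real variable. *)

definition hypergeometric :: "complex list \<Rightarrow> complex list \<Rightarrow> complex \<Rightarrow> complex" where
  "hypergeometric as bs z = eval_fps (fps_hypergeo as bs 1) z"

(* mu l w k is \<mu>_w(k), the number on the right hand side of the recursion for
   a_j^{w,k} and the eigenvalue in E P_w = P_w M_w. *)

definition mu :: "nat \<Rightarrow> nat \<Rightarrow> nat \<Rightarrow> complex" where
  "mu l w k = of_nat w * (of_nat l / 2 - of_nat k) - of_nat k * (of_nat l / 2 + 1)"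

definition lambda :: "nat \<Rightarrow> nat \<Rightarrow> complex" where
  "lambda w k = - of_nat ((w + k) * (w + k + 2))"

(* acoef l w k j is a_j^{w,k}: the three term recursion solved for its term of
   highest index.  The original form is lemma acoef_recursion. *)

fun acoef :: "nat \<Rightarrow> nat \<Rightarrow> nat \<Rightarrow> nat \<Rightarrow> complex" where
  "acoef l w k 0 = 1"
| "acoef l w k (Suc j) =
    (\<i> * (of_nat j * (of_nat l - of_nat j + 1) * (of_nat w + of_nat k - of_nat j + 1)
            * (of_nat w + of_nat k + of_nat j + 1))
        / (2 * (2 * of_nat j - 1) * (2 * of_nat j + 1))
        * (case j of 0 \<Rightarrow> 0 | Suc i \<Rightarrow> acoef l w k i)
      - of_nat j * (of_nat j + 1) / 2 * acoef l w k j
      - mu l w k * acoef l w k j)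
    / (\<i> * ((of_nat j + 1) * (of_nat l + of_nat j + 2)) / 2)"

lemma acoef_recursion:
  "\<i> * (of_nat j * (of_nat l - of_nat j + 1) * (of_nat w + of_nat k - of_nat j + 1)
          * (of_nat w + of_nat k + of_nat j + 1))
      / (2 * (2 * of_nat j - 1) * (2 * of_nat j + 1))
      * (if j = 0 then 0 else acoef l w k (j - 1))
    - of_nat j * (of_nat j + 1) / 2 * acoef l w k j
    - \<i> * ((of_nat j + 1) * (of_nat l + of_nat j + 2)) / 2 * acoef l w k (j + 1)
   = mu l w k * acoef l w k j"
proof -
  have nz: "(of_nat j + 1 :: complex) \<noteq> 0" "(of_nat l + of_nat j + 2 :: complex) \<noteq> 0"
    using of_nat_neq_0[of j, where 'a = complex] of_nat_neq_0[of "l + j + 1", where 'a = complex]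
    by (simp_all add: algebra_simps)
  have c: "(case j of 0 \<Rightarrow> 0 | Suc i \<Rightarrow> acoef l w k i) = (if j = 0 then 0 else acoef l w k (j - 1))"
    by (cases j) auto
  have b: "\<i> * ((of_nat j + 1) * (of_nat l + of_nat j + 2)) / 2 \<noteq> (0 :: complex)"
    using nz by simp
  have solve: "x - y - b * ((x - y - m) / b) = m" if "b \<noteq> 0" for x y b m :: complex
    using that by simp
  show ?thesis
    unfolding Suc_eq_plus1[symmetric] acoef.simps(2) c by (rule solve) (rule b)
qed

(* If j > w + k the series does not terminate, but then a_j^{w,k} = 0. *)

definition Pw :: "nat \<Rightarrow> nat \<Rightarrow> real \<Rightarrow> complex mat" where
  "Pw l w u = mat (l + 1) (l + 1) (\<lambda>(j, k). acoef l w k j *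
     hypergeometric [of_nat j - of_nat w - of_nat k, of_nat w + of_nat k + of_nat j + 2]
       [of_nat j + 3 / 2] (of_real ((1 - u) / 2)))"

definition Psi :: "nat \<Rightarrow> real \<Rightarrow> complex mat" where
  "Psi l = Pw l 0"

definition Ptilde :: "nat \<Rightarrow> nat \<Rightarrow> real \<Rightarrow> complex mat" where
  "Ptilde l w u = the (mat_inverse (Psi l u)) * Pw l w u"

(* In the series for U_{jk} the terms with index n > min j k vanish because of their
   numerators; this includes all n > l, where the denominator (-l)_n is zero. *)

definition Umat :: "nat \<Rightarrow> complex mat" where
  "Umat l = mat (l + 1) (l + 1) (\<lambda>(j, k).
     hypergeometric [- of_nat k, - of_nat j, of_nat k + 1] [1, - of_nat l] 1)"

(* (1 - u^2)^{j/2} is written as a natural power of the square root: powr would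
   give 0 instead of 1 for j = 0 and u = 1 or u = -1. *)

definition Tmat :: "nat \<Rightarrow> real \<Rightarrow> complex mat" where
  "Tmat l u = mat (l + 1) (l + 1)
     (\<lambda>(j, k). if j = k then of_real (sqrt (1 - u\<^sup>2) ^ j) else 0)"

definition Wmat :: "nat \<Rightarrow> real \<Rightarrow> complex mat" where
  "Wmat l u = of_real (2 / pi * sqrt (1 - u\<^sup>2)) \<cdot>\<^sub>m
     (mat_adjoint (Psi l u) * mat_adjoint (Tmat l u) * mat_adjoint (Umat l) * Umat l
        * Tmat l u * Psi l u)"

definition matrix_polynomial_with_coeffs ::
    "nat \<Rightarrow> nat \<Rightarrow> (nat \<Rightarrow> complex mat) \<Rightarrow> (real \<Rightarrow> complex mat) \<Rightarrow> bool" where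
  "matrix_polynomial_with_coeffs l d A F \<longleftrightarrow>
     (\<forall>n. A n \<in> carrier_mat (l + 1) (l + 1)) \<and>
     (\<forall>u. F u = mat (l + 1) (l + 1) (\<lambda>(j, k). \<Sum>n\<le>d. of_real u ^ n * A n $$ (j, k)))"

definition matrix_polynomial :: "nat \<Rightarrow> (real \<Rightarrow> complex mat) \<Rightarrow> bool" where
  "matrix_polynomial l F \<longleftrightarrow> (\<exists>d A. matrix_polynomial_with_coeffs l d A F)"

definition degree_nonsingular_lead :: "nat \<Rightarrow> nat \<Rightarrow> (real \<Rightarrow> complex mat) \<Rightarrow> bool" where
  "degree_nonsingular_lead l d F \<longleftrightarrow>
     (\<exists>A. matrix_polynomial_with_coeffs l d A F \<and> invertible_mat (A d))"

definition W_inner ::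
    "nat \<Rightarrow> (real \<Rightarrow> complex mat) \<Rightarrow> (real \<Rightarrow> complex mat) \<Rightarrow> complex mat" where
  "W_inner l P Q = mat (l + 1) (l + 1) (\<lambda>(j, k).
     integral {-1..1} (\<lambda>u. (mat_adjoint (P u) * Wmat l u * Q u) $$ (j, k)))"

definition mat_deriv :: "nat \<Rightarrow> (real \<Rightarrow> complex mat) \<Rightarrow> real \<Rightarrow> complex mat" where
  "mat_deriv l F u = mat (l + 1) (l + 1) (\<lambda>(j, k).
     vector_derivative (\<lambda>t. F t $$ (j, k)) (at u))"

definition diagonal :: "nat \<Rightarrow> (nat \<Rightarrow> complex) \<Rightarrow> complex mat" where
  "diagonal l d = mat (l + 1) (l + 1) (\<lambda>(j, k). if j = k then d j else 0)"

definition Cmat :: "nat \<Rightarrow> complex mat" where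
  "Cmat l = diagonal l (\<lambda>j. 2 * of_nat j + 3)"

definition S1 :: "nat \<Rightarrow> complex mat" where
  "S1 l = mat (l + 1) (l + 1) (\<lambda>(j, k). if k = j + 1 then 2 * (of_nat j + 1) else 0)"

definition R1 :: "nat \<Rightarrow> complex mat" where
  "R1 l = mat (l + 1) (l + 1) (\<lambda>(j, k).
     if k = j + 1 then (of_nat j + 1) / 2
     else if j = k + 1 then - ((of_nat l - of_nat k) / 2) else 0)"

definition R2 :: "nat \<Rightarrow> complex mat" where
  "R2 l = diagonal l (\<lambda>j. of_nat l / 2 - of_nat j)"

definition Lambda :: "nat \<Rightarrow> nat \<Rightarrow> complex mat" where
  "Lambda l w = diagonal l (lambda w)"

definition M :: "nat \<Rightarrow> nat \<Rightarrow> complex mat" where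
  "M l w = diagonal l (mu l w)"

(* For w = 0 the matrices Lambda l w and M l w are the coefficients
   \<Lambda>_0 and M_0 of the operators. *)

definition Dop :: "nat \<Rightarrow> (real \<Rightarrow> complex mat) \<Rightarrow> real \<Rightarrow> complex mat" where
  "Dop l F u =
     of_real (1 - u\<^sup>2) \<cdot>\<^sub>m mat_deriv l (mat_deriv l F) u
     + (- (of_real u \<cdot>\<^sub>m Cmat l) + S1 l) * mat_deriv l F u
     + Lambda l 0 * F u"

definition Eop :: "nat \<Rightarrow> (real \<Rightarrow> complex mat) \<Rightarrow> real \<Rightarrow> complex mat" where
  "Eop l F u = (of_real u \<cdot>\<^sub>m R2 l + R1 l) * mat_deriv l F u + M l 0 * F u"

definition symmetric_wrt_W ::
    "nat \<Rightarrow> ((real \<Rightarrow> complex mat) \<Rightarrow> real \<Rightarrow> complex mat) \<Rightarrow> bool" where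
  "symmetric_wrt_W l Op \<longleftrightarrow>
     (\<forall>P Q. matrix_polynomial l P \<and> matrix_polynomial l Q \<longrightarrow>
        W_inner l (Op P) Q = W_inner l P (Op Q))"

end

theory Submission
  imports Defs
begin

text \<open>
  The proof moves everything to the spherical picture, that is, to the vectors \<open>H = \<Psi> F\<close>, where the
  three objects of the theorem become transparent.

  \<^item> The weight becomes diagonal. The entries of \<open>U\<close> are the discrete Chebyshev polynomials (Hahn
    polynomials with both parameters 0), which are orthogonal for the uniform weight on \<open>{0..l}\<close>.
    Hence \<open>U\<^sup>* U\<close> is a diagonal matrix with entries \<open>d\<^sub>j\<close>. Up to the factor \<open>2 / \<pi>\<close>, each entry of
    \<open>\<langle>P, Q\<rangle>\<close> is the sum over \<open>j\<close> of \<open>d\<^sub>j\<close> times the integral of \<open>cnj H\<^sub>j \<cdot> K\<^sub>j\<close> against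
    \<open>(1 - u\<^sup>2)\<^sup>j\<^sup>+\<^sup>1\<^sup>/\<^sup>2\<close>, where \<open>H\<close> and \<open>K\<close> are columns of \<open>\<Psi> P\<close> and \<open>\<Psi> Q\<close>.

  \<^item> The operator \<open>D\<close> becomes a decoupled system of Gegenbauer operators, one for each \<open>j\<close>, symmetric
    for \<open>(1 - u\<^sup>2)\<^sup>j\<^sup>+\<^sup>1\<^sup>/\<^sup>2\<close>. The operator \<open>E\<close> becomes tridiagonal: besides a constant in each
    row, it maps \<open>H\<^sub>j\<^sub>-\<^sub>1\<close> into row \<open>j\<close> by differentiation and \<open>H\<^sub>j\<^sub>+\<^sub>1\<close> by the adjoint
    \<open>(1 - u\<^sup>2) d/du - (2j + 3) u\<close>. Its symmetry therefore needs only the right value of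
    \<open>d\<^sub>j\<^sub>+\<^sub>1 / d\<^sub>j\<close> (lemma \<open>hahn_norm_Suc\<close>).

  \<^item> The columns of \<open>P\<^sub>w\<close> are joint eigenvectors. For \<open>D\<close> this is the hypergeometric equation. For \<open>E\<close>,
    differentiation and its adjoint shift \<open>j\<close> in the Gegenbauer functions, so that the eigenvalue
    equation is exactly the three term recursion of the \<open>a\<^sub>j\<close>, provided that the recursion
    stops: \<open>a\<^sub>j = 0\<close> for \<open>j > min l (w + k)\<close>. This is not visible from the recursion; it
    holds because \<open>a\<^sub>j\<close> is a Racah polynomial times a constant which vanishes for such \<open>j\<close>
    (lemmas \<open>acoef_racah\<close> and \<open>acoef_eq_0\<close>).

  The lemmas \<open>Dbar_psi_apply\<close> and \<open>Ebar_psi_apply\<close> conjugate the two operators by \<open>\<Psi> = P\<^sub>0\<close>: the terms without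
  derivatives of \<open>F\<close> match because the columns of \<open>\<Psi>\<close> are themselves eigenvectors, and the first order
  terms match by two identities for Gegenbauer polynomials (\<open>psi_derivative\<close> and \<open>psi_E_symbol\<close>).
  As \<open>\<Psi>\<close> is triangular with constant nonzero diagonal, it is invertible over polynomials.

  Finally, the pair of eigenvalues \<open>\<lambda>\<^sub>w(k)\<close>, \<open>\<mu>\<^sub>w(k)\<close> determines \<open>(w, k)\<close>. Together with
  symmetry this gives orthogonality. It also gives the degree: comparing highest coefficients in both
  eigenvalue equations shows that the \<open>k\<close>-th column of \<open>\<Psi>\<^sup>-\<^sup>1 P\<^sub>w\<close> has degree \<open>w\<close> and
  that its leading coefficient is a nonzero multiple of the \<open>k\<close>-th unit vector.
\<close>

hide_const (open) Module.smult

section \<open>Hypergeometric contiguity and the Gegenbauer ladder\<close>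

definition hyp_coeff :: "complex \<Rightarrow> complex \<Rightarrow> complex \<Rightarrow> nat \<Rightarrow> complex" where
  "hyp_coeff a b c m = pochhammer a m * pochhammer b m / (pochhammer c m * fact m)"

text \<open>
  Coefficientwise form of a contiguity relation that moves \<open>(a, b)\<close> to \<open>(a + 1, b - 1)\<close> when
  \<open>2 c = a + b + 1\<close>, the case of Gegenbauer functions. All coefficients involved are polynomial multiples of
  the number \<open>z\<close> of the proof; the factor \<open>a\<close> on the right hand side avoids a division when \<open>a = 0\<close>.
\<close>

lemma hyp_coeff_contiguous:
  fixes a b c :: complex
  assumes c: "2 * c = a + b + 1" "\<And>m. c + of_nat m \<noteq> 0"
  shows "2 * (of_nat (Suc m) * hyp_coeff a b c (Suc m) - of_nat m * hyp_coeff a b c m)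
     + a * (hyp_coeff a b c (Suc m) - 2 * hyp_coeff a b c m)
     = a * hyp_coeff (a + 1) (b - 1) c (Suc m)"
proof -
  have pc: "pochhammer c m \<noteq> 0" for m
  proof
    assume "pochhammer c m = 0"
    then obtain k where "c = - of_nat k" by (auto simp: pochhammer_eq_0_iff)
    then show False using c(2)[of k] by simp
  qed
  define z where "z = pochhammer a m * pochhammer b m / (pochhammer c (Suc m) * fact (Suc m))"
  have cm: "c + of_nat m \<noteq> 0" and sm: "1 + of_nat m \<noteq> (0::complex)"
    using c(2)[of m] by (auto simp: of_nat_eq_0_iff simp flip: of_nat_Suc)
  have 0: "hyp_coeff a b c m = (c + of_nat m) * (1 + of_nat m) * z"
    using cm sm pc[of m] by (simp add: hyp_coeff_def z_def pochhammer_Suc divide_simps)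
  have 1: "hyp_coeff a b c (Suc m) = (a + of_nat m) * (b + of_nat m) * z"
    by (simp add: hyp_coeff_def z_def pochhammer_Suc[of a] pochhammer_Suc[of b])
  have "a * pochhammer (a + 1) (Suc m) = pochhammer a (Suc (Suc m))"
    by (simp only: pochhammer_rec)
  also have "\<dots> = pochhammer a m * (a + of_nat m) * (a + of_nat m + 1)"
    by (simp add: pochhammer_Suc algebra_simps)
  finally have a: "a * pochhammer (a + 1) (Suc m) = pochhammer a m * (a + of_nat m) * (a + of_nat m + 1)" .
  have b: "pochhammer (b - 1) (Suc m) = (b - 1) * pochhammer b m"
    by (simp add: pochhammer_rec)
  have "a * hyp_coeff (a + 1) (b - 1) c (Suc m)
      = (a * pochhammer (a + 1) (Suc m)) * pochhammer (b - 1) (Suc m) / (pochhammer c (Suc m) * fact (Suc m))"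
    by (simp add: hyp_coeff_def)
  also have "\<dots> = (a + of_nat m) * (a + of_nat m + 1) * (b - 1) * z"
    unfolding a b by (simp add: z_def)
  finally have 2: "a * hyp_coeff (a + 1) (b - 1) c (Suc m) = (a + of_nat m) * (a + of_nat m + 1) * (b - 1) * z" .
  have b': "b = 2 * c - a - 1" using c(1) by (simp add: algebra_simps)
  have "2 * ((1 + M) * ((a + M) * (b + M) * z) - M * ((c + M) * (1 + M) * z))
     + a * ((a + M) * (b + M) * z - 2 * ((c + M) * (1 + M) * z)) = (a + M) * (a + M + 1) * (b - 1) * z" for M
    unfolding b' by (simp add: algebra_simps)
  from this[of "of_nat m"] show ?thesis unfolding 2 0 1 by simp
qed

text \<open>
  The derivative of a hypergeometric series raises all three parameters.
\<close>

lemma hyp_coeff_raise: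
  fixes a b c :: complex
  assumes c: "\<And>m. c + of_nat m \<noteq> 0"
  shows "of_nat (Suc m) * hyp_coeff a b c (Suc m) = a * b / c * hyp_coeff (a + 1) (b + 1) (c + 1) m"
proof -
  have 1: "1 + of_nat m \<noteq> (0::complex)" by (simp add: of_nat_eq_0_iff flip: of_nat_Suc)
  have 2: "c \<noteq> 0" using c[of 0] by simp
  show ?thesis using 1 2 by (simp add: hyp_coeff_def pochhammer_rec divide_simps)
qed

text \<open>
  The first order operator adjoint to differentiation undoes the shift of \<open>hyp_coeff_raise\<close>.
\<close>

lemma hyp_coeff_lower:
  fixes a b c :: complex
  assumes c: "2 * c = a + b + 1" "\<And>m. c + of_nat m \<noteq> 0"
  shows "of_nat (Suc m) * hyp_coeff (a + 1) (b + 1) (c + 1) (Suc m) - of_nat m * hyp_coeff (a + 1) (b + 1) (c + 1) m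
     + c * (hyp_coeff (a + 1) (b + 1) (c + 1) (Suc m) - 2 * hyp_coeff (a + 1) (b + 1) (c + 1) m)
     = c * hyp_coeff a b c (Suc m)"
proof -
  let ?f = "hyp_coeff (a + 1) (b + 1) (c + 1) m"
  have c1: "c + 1 + of_nat m \<noteq> 0" and c0: "c \<noteq> 0" and sm: "1 + of_nat m \<noteq> (0::complex)"
    using c(2)[of "Suc m"] c(2)[of 0] of_nat_neq_0[of m, where 'a = complex] by (simp_all add: add_ac)
  have 1: "hyp_coeff (a + 1) (b + 1) (c + 1) (Suc m) =
      (a + 1 + of_nat m) * (b + 1 + of_nat m) / ((c + 1 + of_nat m) * (1 + of_nat m)) * ?f"
    by (simp add: hyp_coeff_def pochhammer_Suc field_simps)
  have 2: "hyp_coeff a b c (Suc m) = a * b / (c * (1 + of_nat m)) * ?f"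
    using hyp_coeff_raise[OF c(2), of m a b] sm c0 by (simp add: divide_simps) (simp add: algebra_simps)
  have b': "b = 2 * c - a - 1" using c(1) by (simp add: algebra_simps)
  have "(1 + M) * (X * Y / ((c + 1 + M) * (1 + M)) * f) - M * f + c * (X * Y / ((c + 1 + M) * (1 + M)) * f - 2 * f)
        = c * (a * b / (c * (1 + M)) * f)"
     if "X = a + 1 + M" "Y = b + 1 + M" "c + 1 + M \<noteq> 0" "1 + M \<noteq> 0" for X Y M f :: complex
    using that c0 unfolding b' by (simp add: divide_simps) (simp add: algebra_simps)
  from this[OF refl refl c1 sm] show ?thesis unfolding 1 2 by simp
qed

text \<open>
  The hypergeometric function in \<open>P\<^sub>w\<close>, with \<open>n = w + k\<close>, is a polynomial for \<open>j \<le> n\<close>: up to normalization,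
  the Gegenbauer polynomial of degree \<open>n - j\<close> and parameter \<open>j + 1\<close>. First in the variable \<open>x = (1 - u) / 2\<close>,
  then in \<open>u\<close>.
\<close>

definition gegen_series :: "nat \<Rightarrow> nat \<Rightarrow> complex poly" where
  "gegen_series n j = (\<Sum>m\<le>n - j. monom
     (hyp_coeff (of_nat j - of_nat n) (of_nat n + of_nat j + 2) (of_nat j + 3 / 2) m) m)"

definition gegen :: "nat \<Rightarrow> nat \<Rightarrow> complex poly" where
  "gegen n j = pcompose (gegen_series n j) [:1 / 2, - 1 / 2:]"

lemma hyp_coeff_eq_0:
  "j \<le> n \<Longrightarrow> n - j < m \<Longrightarrow> hyp_coeff (of_nat j - of_nat n) b c m = 0"
  using pochhammer_of_nat_eq_0_lemma[of "n - j" m, where 'a = complex]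
  by (simp add: hyp_coeff_def of_nat_diff)

lemma coeff_gegen_series:
  assumes "j \<le> n"
  shows "coeff (gegen_series n j) m
    = hyp_coeff (of_nat j - of_nat n) (of_nat n + of_nat j + 2) (of_nat j + 3 / 2) m"
  using hyp_coeff_eq_0[OF assms] by (auto simp: gegen_series_def coeff_sum coeff_monom not_le)

lemma half_integer_nonzero: "of_nat j + 3 / 2 + of_nat m \<noteq> (0::complex)"
proof -
  have "of_nat (2 * j + 2 * m + 3) \<noteq> (0::complex)" by (simp only: of_nat_eq_0_iff)
  moreover have "of_nat (2 * j + 2 * m + 3) = 2 * (of_nat j + 3 / 2 + of_nat m :: complex)"
    by (simp add: algebra_simps)
  ultimately show ?thesis by (metis mult_zero_right)
qed

lemma poly_gegen_1:
  "poly (gegen n j) 1 = 1"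
  by (simp add: gegen_def poly_pcompose gegen_series_def poly_0_coeff_0 coeff_sum coeff_monom hyp_coeff_def)

lemma pderiv_gegen:
  assumes "j \<le> n"
  shows "pderiv (gegen n j)
    = smult ((of_nat n - of_nat j) * (of_nat n + of_nat j + 2) / (2 * of_nat j + 3)) (gegen n (Suc j))"
proof -
  let ?c = "(of_nat n - of_nat j) * (of_nat n + of_nat j + 2) / (2 * of_nat j + 3) :: complex"
  have *: "pderiv (gegen_series n j) = smult (- 2 * ?c) (gegen_series n (Suc j))"
  proof (cases "n = j")
    case True
    then show ?thesis by (simp add: gegen_series_def pderiv_monom)
  next
    case False
    then have "Suc j \<le> n" using assms by simp
    have c: "of_nat j + 3 / 2 \<noteq> (0::complex)" "2 * of_nat j + 3 \<noteq> (0::complex)"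
      using half_integer_nonzero[of j 0] by (auto simp: field_simps)
    show ?thesis
    proof (rule poly_eqI)
      fix m
      have "coeff (pderiv (gegen_series n j)) m = of_nat (Suc m) *
         hyp_coeff (of_nat j - of_nat n) (of_nat n + of_nat j + 2) (of_nat j + 3 / 2) (Suc m)"
        by (simp add: coeff_pderiv coeff_gegen_series[OF assms])
      also have "\<dots> = (of_nat j - of_nat n) * (of_nat n + of_nat j + 2) / (of_nat j + 3 / 2)
         * coeff (gegen_series n (Suc j)) m"
        unfolding hyp_coeff_raise[OF half_integer_nonzero] coeff_gegen_series[OF \<open>Suc j \<le> n\<close>]
        by (simp add: algebra_simps)
      also have "(of_nat j - of_nat n) * (of_nat n + of_nat j + 2) / (of_nat j + 3 / 2) = - 2 * ?c"
        using c by (simp add: divide_simps) (simp add: algebra_simps)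
      finally show "coeff (pderiv (gegen_series n j)) m = coeff (smult (- 2 * ?c) (gegen_series n (Suc j))) m"
        by simp
    qed
  qed
  show ?thesis
    by (simp add: gegen_def pderiv_pcompose * pderiv_pCons pcompose_smult pcompose_uminus)
qed

text \<open>
  Differentiation leads from \<open>j\<close> to \<open>j + 1\<close>, and this operator leads back. Both are used for \<open>E\<close>.
\<close>

lemma gegen_lower:
  assumes "j < n"
  shows "(1 - z\<^sup>2) * poly (pderiv (gegen n (Suc j))) z - (2 * of_nat j + 3) * z * poly (gegen n (Suc j)) z
    = - (2 * of_nat j + 3) * poly (gegen n j) z"
proof -
  let ?F = "gegen_series n (Suc j)" and ?c = "of_nat j + 3 / 2 :: complex"
  have *: "[:0, 1, - 1:] * pderiv ?F + smult ?c ([:1, - 2:] * ?F) = smult ?c (gegen_series n j)"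
  proof (rule poly_eqI)
    fix m
    show "coeff ([:0, 1, - 1:] * pderiv ?F + smult ?c ([:1, - 2:] * ?F)) m = coeff (smult ?c (gegen_series n j)) m"
    proof (cases m)
      case 0
      then show ?thesis using assms by (simp add: coeff_gegen_series hyp_coeff_def)
    next
      case (Suc i)
      have "of_nat i * hyp_coeff a b c i = (case i of 0 \<Rightarrow> 0 | Suc i' \<Rightarrow> of_nat (Suc i') * hyp_coeff a b c (Suc i'))" for a b c
        by (cases i) auto
      with hyp_coeff_lower[OF _ half_integer_nonzero, of j "of_nat j - of_nat n" "of_nat n + of_nat j + 2" i] Suc assms
      show ?thesis
        by (auto simp: coeff_gegen_series coeff_pCons coeff_pderiv algebra_simps split: nat.splits)
    qed
  qed
  have e: "x * (1 - x) * poly (pderiv ?F) x + ?c * ((1 - 2 * x) * poly ?F x) = ?c * poly (gegen_series n j) x" for x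
    using arg_cong[OF *, of "\<lambda>p. poly p x"] by (simp add: algebra_simps)
  define x where "x = (1 - z) / 2"
  have x: "x * (1 - x) = (1 - z\<^sup>2) / 4" "1 - 2 * x = z" "poly [:1 / 2, - 1 / 2:] z = x"
    by (simp_all add: x_def field_simps power2_eq_square)
  have H: "poly (gegen n (Suc j)) z = poly ?F x" "poly (gegen n j) z = poly (gegen_series n j) x"
    "poly (pderiv (gegen n (Suc j))) z = - poly (pderiv ?F) x / 2"
    using x(3) by (simp_all add: gegen_def pderiv_pcompose pderiv_pCons poly_pcompose)
  have R: "w * (- P / 2) - d * z * B = - d * C" if "w / 4 * P + d / 2 * (z * B) = d / 2 * C" for w P d B C
  proof -
    have "w * (- P / 2) - d * z * B + d * C = - 2 * ((w / 4 * P + d / 2 * (z * B)) - d / 2 * C)"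
      by (simp add: field_simps)
    with that show ?thesis by (simp add: add_eq_0_iff)
  qed
  have E: "(1 - z\<^sup>2) / 4 * poly (pderiv ?F) x + (2 * of_nat j + 3) / 2 * (z * poly ?F x)
      = (2 * of_nat j + 3) / 2 * poly (gegen_series n j) x"
    using e[of x] unfolding x by (simp add: add_divide_distrib)
  show ?thesis unfolding H using R[OF E] by simp
qed

text \<open>
  Evaluated form of \<open>hyp_coeff_contiguous\<close>. Exchanging the roles of \<open>a\<close> and \<open>b\<close> turns the shift that lowers
  the degree into the one that raises it, so that one lemma serves for both.
\<close>

lemma gegen_shift:
  fixes a b c :: complex
  assumes F: "\<And>m. coeff F m = hyp_coeff a b c m"
    and F': "\<And>m. a * coeff F' m = a * hyp_coeff (a + 1) (b - 1) c m"
    and c: "2 * c = a + b + 1" "\<And>m. c + of_nat m \<noteq> 0"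
  defines "r \<equiv> [:1 / 2, - 1 / 2:]"
  shows "(1 - z\<^sup>2) * poly (pderiv (pcompose F r)) z - a * z * poly (pcompose F r) z
    = - a * poly (pcompose F' r) z"
proof -
  have *: "smult 2 ([:0, 1, - 1:] * pderiv F) + smult a ([:1, - 2:] * F) = smult a F'"
  proof (rule poly_eqI)
    fix m
    show "coeff (smult 2 ([:0, 1, - 1:] * pderiv F) + smult a ([:1, - 2:] * F)) m = coeff (smult a F') m"
    proof (cases m)
      case 0
      then show ?thesis by (simp add: F F' hyp_coeff_def)
    next
      case (Suc i)
      have "of_nat i * hyp_coeff a b c i = (case i of 0 \<Rightarrow> 0 | Suc i' \<Rightarrow> of_nat (Suc i') * hyp_coeff a b c (Suc i'))"
        by (cases i) auto
      with hyp_coeff_contiguous[OF c, of i] Suc show ?thesis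
        by (auto simp: F F' coeff_pCons coeff_pderiv algebra_simps split: nat.splits)
    qed
  qed
  have e: "2 * (x * (1 - x)) * poly (pderiv F) x + a * ((1 - 2 * x) * poly F x) = a * poly F' x" for x
    using arg_cong[OF *, of "\<lambda>p. poly p x"] by (simp add: algebra_simps)
  define x where "x = (1 - z) / 2"
  have x: "x * (1 - x) = (1 - z\<^sup>2) / 4" "1 - 2 * x = z" "poly r z = x"
    by (simp_all add: x_def r_def field_simps power2_eq_square)
  have H: "poly (pcompose F r) z = poly F x" "poly (pcompose F' r) z = poly F' x"
    "poly (pderiv (pcompose F r)) z = - poly (pderiv F) x / 2"
    using x(3) by (simp_all add: r_def pderiv_pcompose pderiv_pCons poly_pcompose)
  have R: "w * (- P / 2) - a * z * B = - a * C" if "2 * (w / 4) * P + a * (z * B) = a * C" for w P B C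
  proof -
    have "w * (- P / 2) - a * z * B + a * C = - ((2 * (w / 4) * P + a * (z * B)) - a * C)"
      by (simp add: field_simps)
    with that show ?thesis by (simp add: add_eq_0_iff)
  qed
  have E: "2 * ((1 - z\<^sup>2) / 4) * poly (pderiv F) x + a * (z * poly F x) = a * poly F' x"
    using e[of x] unfolding x .
  show ?thesis unfolding H using R[OF E] by simp
qed

lemma gegen_degree_down:
  assumes "j \<le> n"
  shows "(1 - z\<^sup>2) * poly (pderiv (gegen n j)) z + (of_nat n - of_nat j) * z * poly (gegen n j) z
    = (of_nat n - of_nat j) * poly (gegen (n - 1) j) z"
proof -
  let ?a = "of_nat j - of_nat n :: complex" and ?b = "of_nat n + of_nat j + 2 :: complex"
  have "?a * coeff (gegen_series (n - 1) j) m = ?a * hyp_coeff (?a + 1) (?b - 1) (of_nat j + 3 / 2) m" for m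
  proof (cases "j = n")
    case False
    with assms have "j \<le> n - 1" and n: "of_nat (n - 1) = (of_nat n - 1 :: complex)" by auto
    have e: "?a + 1 = of_nat j - of_nat (n - 1)" "?b - 1 = of_nat (n - 1) + of_nat j + 2"
      unfolding n by simp_all
    show ?thesis unfolding e coeff_gegen_series[OF \<open>j \<le> n - 1\<close>] ..
  qed simp
  from gegen_shift[OF coeff_gegen_series[OF assms] this _ half_integer_nonzero, of z]
  show ?thesis by (simp add: gegen_def algebra_simps)
qed

lemma gegen_degree_up:
  assumes "j \<le> n"
  shows "(1 - z\<^sup>2) * poly (pderiv (gegen n j)) z - (of_nat n + of_nat j + 2) * z * poly (gegen n j) z
    = - (of_nat n + of_nat j + 2) * poly (gegen (Suc n) j) z"
proof -
  let ?a = "of_nat j - of_nat n :: complex" and ?b = "of_nat n + of_nat j + 2 :: complex"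
  have swap: "hyp_coeff a b c m = hyp_coeff b a c m" for a b c m
    by (simp add: hyp_coeff_def)
  have 1: "coeff (gegen_series n j) m = hyp_coeff ?b ?a (of_nat j + 3 / 2) m" for m
    by (simp add: coeff_gegen_series[OF assms] swap[of ?a])
  have 2: "?b * coeff (gegen_series (Suc n) j) m = ?b * hyp_coeff (?b + 1) (?a - 1) (of_nat j + 3 / 2) m" for m
  proof -
    have e: "?a - 1 = of_nat j - of_nat (Suc n)" "?b + 1 = of_nat (Suc n) + of_nat j + 2"
      by simp_all
    show ?thesis unfolding swap[of "?b + 1"] unfolding e coeff_gegen_series[OF le_SucI[OF assms]] ..
  qed
  from gegen_shift[OF 1 2 _ half_integer_nonzero, of z]
  show ?thesis by (simp add: gegen_def algebra_simps)
qed

lemma gegen_self: "gegen n n = 1"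
  by (simp add: gegen_def gegen_series_def hyp_coeff_def pcompose_pCons one_pCons flip: pCons_one)

lemma hypergeometric_gegen:
  assumes "j \<le> n"
  shows "hypergeometric [of_nat j - of_nat n, of_nat n + of_nat j + 2] [of_nat j + 3 / 2]
    (of_real ((1 - u) / 2)) = poly (gegen n j) (of_real u)"
proof -
  let ?x = "complex_of_real ((1 - u) / 2)"
  let ?g = "hyp_coeff (of_nat j - of_nat n) (of_nat n + of_nat j + 2) (of_nat j + 3 / 2)"
  have nth: "fps_nth (fps_hypergeo [of_nat j - of_nat n, of_nat n + of_nat j + 2] [of_nat j + 3 / 2] 1) m = ?g m" for m
    by (simp add: hyp_coeff_def)
  have "hypergeometric [of_nat j - of_nat n, of_nat n + of_nat j + 2] [of_nat j + 3 / 2] ?x = (\<Sum>m. ?g m * ?x ^ m)"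
    unfolding hypergeometric_def eval_fps_def nth ..
  also have "\<dots> = (\<Sum>m\<le>n - j. ?g m * ?x ^ m)"
    by (rule suminf_finite) (auto simp: hyp_coeff_eq_0[OF assms] not_le)
  also have "\<dots> = poly (gegen_series n j) ?x"
    by (simp add: gegen_series_def poly_sum poly_monom)
  finally have "hypergeometric [of_nat j - of_nat n, of_nat n + of_nat j + 2] [of_nat j + 3 / 2] ?x
      = poly (gegen_series n j) ?x" .
  moreover have "poly [:1 / 2, - 1 / 2:] (of_real u) = ?x" by (simp add: field_simps)
  ultimately show ?thesis by (simp only: gegen_def poly_pcompose)
qed

section \<open>Coefficients of the shifted Legendre polynomials\<close>

text \<open>
  The coefficient of \<open>t ^ m\<close> in the Legendre polynomial of degree \<open>j\<close> at \<open>1 - 2 t\<close>. These are the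
  common coefficients of the Hahn and Racah polynomials with \<open>\<alpha> = \<beta> = 0\<close>, which differ only in what
  replaces the powers of \<open>t\<close>.
\<close>

definition legendre_coeff :: "nat \<Rightarrow> nat \<Rightarrow> complex" where
  "legendre_coeff j m = (- 1) ^ m * of_nat (j choose m) * of_nat ((j + m) choose m)"

lemma legendre_coeff_eq_0: "j < m \<Longrightarrow> legendre_coeff j m = 0"
  by (simp add: legendre_coeff_def)

lemma legendre_coeff_0 [simp]: "legendre_coeff j 0 = 1"
  by (simp add: legendre_coeff_def)

lemma legendre_coeff_fact:
  assumes "m \<le> j"
  shows "legendre_coeff j m = (- 1) ^ m * fact (j + m) / (fact m ^ 2 * fact (j - m))"
proof -
  have "of_nat ((j + m) choose m) = (fact (j + m) / (fact m * fact j) :: complex)"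
    by (subst binomial_fact) auto
  moreover have "of_nat (j choose m) = (fact j / (fact m * fact (j - m)) :: complex)"
    using assms by (rule binomial_fact)
  ultimately show ?thesis
    by (simp add: legendre_coeff_def power2_eq_square)
qed

text \<open>
  The four coefficients that meet in a three term recursion are explicit multiples of one number. Hence
  such recursions become polynomial identities, with no case distinction at the end of the range of summation.
\<close>

lemma legendre_coeff_common_factor:
  obtains z :: complex where
    "legendre_coeff (Suc (Suc j)) (Suc m) = (of_nat j + of_nat m + 3) * (of_nat j + of_nat m + 2) * z"
    "legendre_coeff (Suc j) (Suc m) = (of_nat j + of_nat m + 2) * (of_nat j + 1 - of_nat m) * z"
    "legendre_coeff j (Suc m) = (of_nat j + 1 - of_nat m) * (of_nat j - of_nat m) * z"
    "legendre_coeff (Suc j) m = - ((of_nat m + 1)\<^sup>2 * z)"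
proof (cases "m \<le> Suc j")
  case False
  then show ?thesis using that[of 0] by (simp add: legendre_coeff_eq_0)
next
  case True
  define z :: complex where "z = (- 1) ^ Suc m * fact (j + m + 1) / (fact (Suc m) ^ 2 * fact (Suc j - m))"
  have d: "Suc (Suc j) - Suc m = Suc j - m" by simp
  have m1: "of_nat m + 1 \<noteq> (0::complex)" using of_nat_neq_0[of m, where 'a = complex] by (simp add: add.commute)
  have "legendre_coeff (Suc (Suc j)) (Suc m) = (of_nat j + of_nat m + 3) * (of_nat j + of_nat m + 2) * z"
    using True by (simp add: legendre_coeff_fact z_def algebra_simps)
  moreover have "legendre_coeff (Suc j) (Suc m) = (of_nat j + of_nat m + 2) * (of_nat j + 1 - of_nat m) * z"
  proof (cases "m = Suc j")
    case True
    then show ?thesis by (simp add: legendre_coeff_eq_0)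
  next
    case False
    with \<open>m \<le> Suc j\<close> obtain i where i: "j = m + i" by (metis le_Suc_eq le_Suc_ex)
    have i1: "of_nat i + 1 \<noteq> (0::complex)" using of_nat_neq_0[of i, where 'a = complex] by (simp add: add.commute)
    show ?thesis using i1 m1 by (simp add: legendre_coeff_fact z_def i divide_simps) (simp add: algebra_simps)
  qed
  moreover have "legendre_coeff j (Suc m) = (of_nat j + 1 - of_nat m) * (of_nat j - of_nat m) * z"
  proof (cases "j \<le> m")
    case True
    with \<open>m \<le> Suc j\<close> have "m = j \<or> m = Suc j" by auto
    then show ?thesis using True by (auto simp: legendre_coeff_eq_0)
  next
    case False
    then obtain i where i: "j = Suc m + i" by (metis not_le Suc_le_eq le_Suc_ex)
    have i1: "of_nat i + 1 \<noteq> (0::complex)" "of_nat i + 2 \<noteq> (0::complex)"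
      using of_nat_neq_0[of i, where 'a = complex] of_nat_neq_0[of "Suc i", where 'a = complex] by (simp_all add: add_ac)
    show ?thesis using i1 m1 by (simp add: legendre_coeff_fact z_def i divide_simps) (simp add: algebra_simps)
  qed
  moreover have "legendre_coeff (Suc j) m = - ((of_nat m + 1)\<^sup>2 * z)"
    using True m1 by (simp add: legendre_coeff_fact z_def divide_simps) (simp add: algebra_simps power2_eq_square)
  ultimately show ?thesis using that by blast
qed

section \<open>Integration against the Chebyshev weight\<close>

definition cheb_int :: "complex poly \<Rightarrow> complex" where
  "cheb_int p = integral {-1..1} (\<lambda>u. of_real (sqrt (1 - u\<^sup>2)) * poly p (of_real u))"

lemma cheb_int_integrable:
  "(\<lambda>u. complex_of_real (sqrt (1 - u\<^sup>2)) * poly p (of_real u)) integrable_on {-1..1::real}"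
  by (intro integrable_continuous_interval continuous_intros)

lemma cheb_int_add: "cheb_int (p + q) = cheb_int p + cheb_int q"
  unfolding cheb_int_def by (subst integral_add[symmetric]) (auto intro: cheb_int_integrable simp: ring_distribs)

lemma cheb_int_smult: "cheb_int (smult c p) = c * cheb_int p"
  unfolding cheb_int_def by (subst integral_mult_right[symmetric]) (auto simp: algebra_simps)

lemma cheb_int_sum: "cheb_int (\<Sum>i\<in>A. f i) = (\<Sum>i\<in>A. cheb_int (f i))"
proof -
  have "cheb_int 0 = 0" by (simp add: cheb_int_def)
  then show ?thesis by (induction A rule: infinite_finite_induct) (auto simp: cheb_int_add)
qed

lemma poly_of_real_has_vector_derivative:
  fixes p :: "complex poly"
  shows
  "((\<lambda>t. poly p (of_real t)) has_vector_derivative poly (pderiv p) (of_real u)) (at u within A)"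
  using has_vector_derivative_real_field[OF poly_DERIV, of p u A] by simp

text \<open>
  The integrand is the derivative of \<open>(1 - u\<^sup>2)\<^sup>3\<^sup>/\<^sup>2 p\<close>, which vanishes at both ends. This is the only analytic fact
  behind the symmetry of the two operators.
\<close>

lemma cheb_int_total_derivative: "cheb_int ([:1, 0, - 1:] * pderiv p - [:0, 3:] * p) = 0"
proof -
  let ?s = "\<lambda>u::real. sqrt (1 - u\<^sup>2)"
  let ?F = "\<lambda>u. complex_of_real ((1 - u\<^sup>2) * ?s u) * poly p (of_real u)"
  let ?f = "\<lambda>u. complex_of_real (?s u) * poly ([:1, 0, - 1:] * pderiv p - [:0, 3:] * p) (of_real u)"
  have "(?f has_integral ?F 1 - ?F (- 1)) {-1..1}"
  proof (rule fundamental_theorem_of_calculus_interior)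
    show "continuous_on {-1..1} ?F" by (intro continuous_intros)
    fix u :: real assume u: "u \<in> {-1<..<1}"
    then have u2: "1 - u\<^sup>2 > 0" by (simp add: abs_square_less_1 abs_less_iff)
    have "((\<lambda>u. 1 - u\<^sup>2) has_real_derivative - 2 * u) (at u)"
      by (auto intro!: derivative_eq_intros)
    from DERIV_mult[OF this DERIV_chain2[OF DERIV_real_sqrt[OF u2] this]]
    have "((\<lambda>u. (1 - u\<^sup>2) * ?s u) has_real_derivative
        - 2 * u * ?s u + inverse (?s u) / 2 * (- 2 * u) * (1 - u\<^sup>2)) (at u)"
      by simp
    also have "inverse (?s u) / 2 * (- 2 * u) * (1 - u\<^sup>2) = - u * ?s u"
      using u2 real_sqrt_pow2[of "1 - u\<^sup>2"] by (simp add: field_simps power2_eq_square)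
    finally have "((\<lambda>u. (1 - u\<^sup>2) * ?s u) has_real_derivative - 3 * u * ?s u) (at u)" by (simp add: algebra_simps)
    then have "((\<lambda>u. complex_of_real ((1 - u\<^sup>2) * ?s u)) has_vector_derivative of_real (- 3 * u * ?s u)) (at u)"
      by (rule has_vector_derivative_of_real)
    from has_vector_derivative_mult[OF this poly_of_real_has_vector_derivative]
    show "(?F has_vector_derivative ?f u) (at u)"
      by (simp add: algebra_simps power2_eq_square)
  qed simp
  then show ?thesis unfolding cheb_int_def by (simp add: integral_unique)
qed

section \<open>The coefficients of the spherical functions as Racah polynomials\<close>

declare acoef.simps(2) [simp del]

lemma acoef_recursion_Suc:
  "\<i> * (of_nat (Suc j) * (of_nat l - of_nat j) * (of_nat w + of_nat k - of_nat j)
          * (of_nat w + of_nat k + of_nat j + 2))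
      / (2 * (2 * of_nat j + 1) * (2 * of_nat j + 3)) * acoef l w k j
    - of_nat (Suc j) * (of_nat j + 2) / 2 * acoef l w k (Suc j)
    - \<i> * ((of_nat j + 2) * (of_nat l + of_nat j + 3)) / 2 * acoef l w k (Suc (Suc j))
   = mu l w k * acoef l w k (Suc j)"
proof -
  have *: "of_nat l - of_nat (Suc j) + 1 = (of_nat l - of_nat j :: complex)"
    "of_nat w + of_nat k - of_nat (Suc j) + 1 = (of_nat w + of_nat k - of_nat j :: complex)"
    "of_nat w + of_nat k + of_nat (Suc j) + 1 = (of_nat w + of_nat k + of_nat j + 2 :: complex)"
    "2 * of_nat (Suc j) - 1 = (2 * of_nat j + 1 :: complex)" "2 * of_nat (Suc j) + 1 = (2 * of_nat j + 3 :: complex)"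
    "of_nat (Suc j) + 1 = (of_nat j + 2 :: complex)" "of_nat l + of_nat (Suc j) + 2 = (of_nat l + of_nat j + 3 :: complex)"
    by simp_all
  show ?thesis using acoef_recursion[of "Suc j" l w k] unfolding * by simp
qed

lemma of_nat_plus_numeral_nonzero:
  "of_nat j + numeral v \<noteq> (0::complex)" "2 * of_nat j + numeral v \<noteq> (0::complex)"
  "of_nat i + of_nat j + numeral v \<noteq> (0::complex)"
proof -
  have *: "of_nat i + numeral v \<noteq> (0::complex)" for i :: nat
  proof -
    have "of_nat (i + numeral v) \<noteq> (0::complex)" by (simp only: of_nat_eq_0_iff) simp
    then show ?thesis by simp
  qed
  show "of_nat j + numeral v \<noteq> (0::complex)" by (rule *)
  show "2 * of_nat j + numeral v \<noteq> (0::complex)" using *[of "2 * j"] by simp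
  show "of_nat i + of_nat j + numeral v \<noteq> (0::complex)" using *[of "i + j"] by simp
qed

lemma of_nat_plus_1_nonzero: "of_nat j + 1 \<noteq> (0::complex)" "2 * of_nat j + 1 \<noteq> (0::complex)"
  using of_nat_neq_0[of j, where 'a = complex] of_nat_neq_0[of "2 * j", where 'a = complex]
  by (simp_all add: add.commute)

text \<open>
  For \<open>w = 0\<close> the three term recursion collapses to two terms. The induction eliminates \<open>a\<^sub>j\<close> from
  the recursion at \<open>j + 1\<close>; multiplying by \<open>k - j\<close> instead of dividing keeps \<open>j = k\<close> in reach.
\<close>

lemma acoef_0_Suc: "acoef l 0 k (Suc j) = - \<i> * (of_nat k - of_nat j) / (2 * of_nat j + 1) * acoef l 0 k j"
proof (induction j)
  case 0
  show ?case using of_nat_plus_1_nonzero(1)[of l] of_nat_plus_numeral_nonzero(1)[where j = l and v = "num.Bit0 num.One"]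
    by (simp add: mu_def acoef.simps(2) divide_simps)
next
  case (Suc j)
  let ?J = "of_nat j :: complex" and ?L = "of_nat l :: complex" and ?K = "of_nat k :: complex"
  note nz = of_nat_plus_1_nonzero[of j] of_nat_plus_numeral_nonzero[where j = j and v = "num.Bit0 num.One"]
    of_nat_plus_numeral_nonzero[where j = j and v = "num.Bit1 num.One"]
    of_nat_plus_numeral_nonzero(3)[where i = l and j = j and v = "num.Bit1 num.One"]
  have prev: "(?K - ?J) * acoef l 0 k j = \<i> * (2 * ?J + 1) * acoef l 0 k (Suc j)"
    unfolding Suc.IH using nz by simp
  \<comment> \<open>The recursion at \<open>j + 1\<close>, arranged so that \<open>a\<^sub>j\<close> occurs with the factor \<open>k - j\<close> and \<open>prev\<close> applies.\<close>
  have step: "\<i> * ((?J + 1) * (?L - ?J) * (?K + ?J + 2)) / (2 * (2 * ?J + 1) * (2 * ?J + 3)) * ((?K - ?J) * acoef l 0 k j)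
     - (?J + 1) * (?J + 2) / 2 * acoef l 0 k (Suc j)
     - \<i> * ((?J + 2) * (?L + ?J + 3)) / 2 * acoef l 0 k (Suc (Suc j))
     = - ?K * (?L / 2 + 1) * acoef l 0 k (Suc j)"
    using acoef_recursion_Suc[of j l 0 k] by (simp add: mu_def algebra_simps)
  have cancel: "\<i> * X / (2 * p * q) * (\<i> * p * a) = - X / (2 * q) * a" if "p \<noteq> 0" for X p q a :: complex
    using that by (simp add: divide_simps) (simp add: algebra_simps)
  have collect: "z = (t - s - m) * a" if "t * a - s * a - z = m * a" for t s z m a :: complex
  proof -
    have "z = t * a - s * a - (t * a - s * a - z)" by simp
    then show ?thesis unfolding that by (simp add: algebra_simps)
  qed
  have "\<i> * ((?J + 2) * (?L + ?J + 3)) / 2 * acoef l 0 k (Suc (Suc j))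
     = (- ((?J + 1) * (?L - ?J) * (?K + ?J + 2)) / (2 * (2 * ?J + 3))
     - (?J + 1) * (?J + 2) / 2 - - ?K * (?L / 2 + 1)) * acoef l 0 k (Suc j)"
    by (rule collect) (rule step[unfolded prev cancel[OF nz(2)]])
  also have "- ((?J + 1) * (?L - ?J) * (?K + ?J + 2)) / (2 * (2 * ?J + 3))
     - (?J + 1) * (?J + 2) / 2 - - ?K * (?L / 2 + 1)
     = ((?J + 2) * (?L + ?J + 3)) / 2 * ((?K - ?J - 1) / (2 * ?J + 3))"
  proof -
    have "- x / (2 * q) - y / 2 - - z = w / 2 * (v / q)" if "q \<noteq> 0" "- x - q * y + 2 * q * z = w * v" for x y z w v q :: complex
    proof -
      have "w / 2 * (v / q) = (- x - q * y + 2 * q * z) / (2 * q)" using that(2) by simp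
      then show ?thesis using that(1) by (simp add: add_divide_distrib diff_divide_distrib)
    qed
    note R = this[OF nz(7), of "(?J + 1) * (?L - ?J) * (?K + ?J + 2)" "(?J + 1) * (?J + 2)" "?K * (?L / 2 + 1)"
      "(?J + 2) * (?L + ?J + 3)" "?K - ?J - 1"]
    have "- ((?J + 1) * (?L - ?J) * (?K + ?J + 2)) - (2 * ?J + 3) * ((?J + 1) * (?J + 2)) + 2 * (2 * ?J + 3) * (?K * (?L / 2 + 1))
      = (?J + 2) * (?L + ?J + 3) * (?K - ?J - 1)" by (simp add: field_simps)
    from R[OF this] show ?thesis by simp
  qed
  finally have "\<i> * ((?J + 2) * (?L + ?J + 3)) / 2 * acoef l 0 k (Suc (Suc j))
     = ((?J + 2) * (?L + ?J + 3)) / 2 * ((?K - ?J - 1) / (2 * ?J + 3)) * acoef l 0 k (Suc j)" .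
  moreover have "((?J + 2) * (?L + ?J + 3)) / 2 \<noteq> 0" using nz by simp
  moreover have "a = - \<i> * c * b" if eq: "\<i> * p / 2 * a = p / 2 * c * b" and nz: "p / 2 \<noteq> 0" for p a b c :: complex
  proof -
    have "p / 2 * (\<i> * a) = p / 2 * (c * b)" using eq by (simp add: mult_ac)
    then have "\<i> * a = c * b" using nz mult_left_cancel by blast
    then have "\<i> * (\<i> * a) = \<i> * (c * b)" by simp
    then have "- a = \<i> * (c * b)" by simp
    then show ?thesis by (metis add.inverse_inverse mult.assoc mult_minus_left)
  qed
  ultimately have "acoef l 0 k (Suc (Suc j)) = - \<i> * ((?K - ?J - 1) / (2 * ?J + 3)) * acoef l 0 k (Suc j)"
    by blast
  then show ?case by (simp add: algebra_simps)
qed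

lemma acoef_0_eq_0: "k < j \<Longrightarrow> acoef l 0 k j = 0"
proof (induction j)
  case (Suc j)
  then show ?case by (cases "j = k") (auto simp: acoef_0_Suc)
qed simp

lemma acoef_0_neq_0: "j \<le> k \<Longrightarrow> acoef l 0 k j \<noteq> 0"
proof (induction j)
  case (Suc j)
  then show ?case using of_nat_plus_1_nonzero(2)[of j] by (auto simp: acoef_0_Suc)
qed simp

lemma acoef_0_Suc_column:
  "(of_nat k + 1 - of_nat j) * acoef l 0 (Suc k) j = (of_nat k + 1) * acoef l 0 k j"
proof (induction j)
  case (Suc j)
  have "(of_nat k - of_nat j) * ((of_nat k + 1 - of_nat j) * acoef l 0 (Suc k) j)
     = (of_nat k - of_nat j) * ((of_nat k + 1) * acoef l 0 k j)"
    by (simp only: Suc.IH)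
  then show ?case using of_nat_plus_1_nonzero(2)[of j]
    by (simp add: acoef_0_Suc divide_simps) (simp add: algebra_simps)
qed simp

text \<open>
  In terms of \<open>n = w + k\<close>, \<open>\<mu>\<close> is a quadratic in \<open>k\<close>: the spectral variable of the Racah polynomials, up to a shift.
\<close>

lemma mu_eq: "mu l w k = of_nat (w + k) * of_nat l / 2 + of_nat k * (of_nat k - of_nat (w + k) - of_nat l - 1)"
  by (simp add: mu_def algebra_simps add_divide_distrib)

lemma legendre_coeff_sum_extend:
  "j \<le> N \<Longrightarrow> (\<Sum>m\<le>j. legendre_coeff j m * y m) = (\<Sum>m\<le>N. legendre_coeff j m * y m)"
  by (rule sum.mono_neutral_left) (auto simp: legendre_coeff_eq_0)

text \<open>
  Three term recursion of the Racah polynomials \<open>r j\<close>. The hypothesis on \<open>y\<close> is the two term recursion of the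
  products that replace the powers of the variable. It expresses multiplication by \<open>K (K - N - L - 1)\<close> on the
  \<open>y m\<close>, and the claim is then an identity between the coefficients of each \<open>y m\<close>.
\<close>

lemma racah_recursion:
  fixes K L N :: complex and y :: "nat \<Rightarrow> complex"
  assumes y: "\<And>m. (of_nat m - K) * (K - N - L - 1 + of_nat m) * y m = (L - of_nat m) * (N - of_nat m) * y (Suc m)"
  defines "r \<equiv> \<lambda>j. \<Sum>m\<le>j. legendre_coeff j m * y m"
  defines "A \<equiv> \<lambda>j::nat. (of_nat j + 1) * (L - of_nat j) * (N - of_nat j) / (2 * (2 * of_nat j + 1))"
  defines "C \<equiv> \<lambda>j::nat. of_nat j * (of_nat j + L + 1) * (of_nat j + N + 1) / (2 * (2 * of_nat j + 1))"
  shows "K * (K - N - L - 1) * r 0 = A 0 * (r 1 - r 0)"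
    and "K * (K - N - L - 1) * r (Suc j) = A (Suc j) * r (Suc (Suc j)) - (A (Suc j) + C (Suc j)) * r (Suc j) + C (Suc j) * r j"
proof -
  have r1: "r 1 = y 0 - 2 * y 1"
    by (simp add: r_def legendre_coeff_def)
  have r0: "r 0 = y 0"
    by (simp add: r_def)
  show "K * (K - N - L - 1) * r 0 = A 0 * (r 1 - r 0)"
    unfolding r0 r1 using y[of 0] by (simp add: A_def algebra_simps)
next
  let ?M = "Suc (Suc j)"
  have ky: "K * (K - N - L - 1) * y m = (of_nat m * (of_nat m - N - L - 1)) * y m - (L - of_nat m) * (N - of_nat m) * y (Suc m)" for m
    using y[of m] by (simp add: algebra_simps)
  let ?e = "legendre_coeff"
  \<comment> \<open>The coefficient of \<open>y m\<close> on the left hand side, after the hypothesis on \<open>y\<close> and a shift of the index.\<close>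
  define c where "c m = ?e (Suc j) m * (of_nat m * (of_nat m - N - L - 1))
     - (case m of 0 \<Rightarrow> 0 | Suc i \<Rightarrow> (L - of_nat i) * (N - of_nat i) * ?e (Suc j) i)" for m
  have "K * (K - N - L - 1) * r (Suc j) = (\<Sum>m\<le>Suc j. ?e (Suc j) m * (K * (K - N - L - 1) * y m))"
    unfolding r_def sum_distrib_left by (rule sum.cong) (simp_all add: mult_ac)
  also have "\<dots> = (\<Sum>m\<le>Suc j. ?e (Suc j) m * (of_nat m * (of_nat m - N - L - 1)) * y m)
     - (\<Sum>m\<le>Suc j. (L - of_nat m) * (N - of_nat m) * ?e (Suc j) m * y (Suc m))"
    unfolding ky sum_subtractf[symmetric] by (rule sum.cong) (simp_all add: algebra_simps)
  also have "(\<Sum>m\<le>Suc j. ?e (Suc j) m * (of_nat m * (of_nat m - N - L - 1)) * y m)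
     = (\<Sum>m\<le>?M. ?e (Suc j) m * (of_nat m * (of_nat m - N - L - 1)) * y m)"
    by (rule sum.mono_neutral_left) (auto simp: legendre_coeff_eq_0)
  also have "(\<Sum>m\<le>Suc j. (L - of_nat m) * (N - of_nat m) * ?e (Suc j) m * y (Suc m))
     = (\<Sum>m\<le>?M. (case m of 0 \<Rightarrow> 0 | Suc i \<Rightarrow> (L - of_nat i) * (N - of_nat i) * ?e (Suc j) i) * y m)"
    by (simp only: sum.atMost_Suc_shift[of _ "Suc j"]) simp
  also have "(\<Sum>m\<le>?M. ?e (Suc j) m * (of_nat m * (of_nat m - N - L - 1)) * y m)
     - (\<Sum>m\<le>?M. (case m of 0 \<Rightarrow> 0 | Suc i \<Rightarrow> (L - of_nat i) * (N - of_nat i) * ?e (Suc j) i) * y m)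
     = (\<Sum>m\<le>?M. c m * y m)"
    unfolding sum_subtractf[symmetric] c_def
    by (rule sum.cong) (simp_all only: left_diff_distrib)
  finally have lhs: "K * (K - N - L - 1) * r (Suc j) = (\<Sum>m\<le>?M. c m * y m)" .
  have c: "c m = A (Suc j) * ?e ?M m - (A (Suc j) + C (Suc j)) * ?e (Suc j) m + C (Suc j) * ?e j m" for m
  proof (cases m)
    case 0
    then show ?thesis by (simp add: c_def)
  next
    case (Suc i)
    obtain z where z: "?e ?M (Suc i) = (of_nat j + of_nat i + 3) * (of_nat j + of_nat i + 2) * z"
      "?e (Suc j) (Suc i) = (of_nat j + of_nat i + 2) * (of_nat j + 1 - of_nat i) * z"
      "?e j (Suc i) = (of_nat j + 1 - of_nat i) * (of_nat j - of_nat i) * z"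
      "?e (Suc j) i = - ((of_nat i + 1)\<^sup>2 * z)"
      by (rule legendre_coeff_common_factor)
    let ?d = "2 * (2 * of_nat (Suc j) + 1) :: complex"
    have d: "?d \<noteq> 0" by (rule no_zero_divisors[OF _ of_nat_plus_1_nonzero(2)]) simp
    have A: "A (Suc j) = (of_nat j + 2) * (L - of_nat j - 1) * (N - of_nat j - 1) / ?d"
      and C: "C (Suc j) = (of_nat j + 1) * (of_nat j + L + 2) * (of_nat j + N + 2) / ?d"
      by (simp_all add: A_def C_def algebra_simps)
    have "?d * c m = (of_nat j + 2) * (L - of_nat j - 1) * (N - of_nat j - 1) * ?e ?M m
      - ((of_nat j + 2) * (L - of_nat j - 1) * (N - of_nat j - 1) + (of_nat j + 1) * (of_nat j + L + 2) * (of_nat j + N + 2)) * ?e (Suc j) m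
      + (of_nat j + 1) * (of_nat j + L + 2) * (of_nat j + N + 2) * ?e j m"
      unfolding c_def Suc nat.case z by (simp add: algebra_simps power2_eq_square)
    then show ?thesis unfolding A C using d
      by (simp only: add_divide_distrib[symmetric] times_divide_eq_left diff_divide_distrib[symmetric] eq_divide_eq mult.commute[of "c m"]) simp
  qed
  have "(\<Sum>m\<le>?M. c m * y m) = (\<Sum>m\<le>?M. A (Suc j) * (?e ?M m * y m)
      - (A (Suc j) + C (Suc j)) * (?e (Suc j) m * y m) + C (Suc j) * (?e j m * y m))"
    unfolding c by (rule sum.cong) (simp_all only: algebra_simps)
  also have "\<dots> = A (Suc j) * r ?M - (A (Suc j) + C (Suc j)) * r (Suc j) + C (Suc j) * r j"
    unfolding r_def legendre_coeff_sum_extend[of "Suc j" ?M y, OF le_SucI[OF order_refl]]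
      legendre_coeff_sum_extend[of j ?M y, OF le_SucI[OF le_SucI[OF order_refl]]]
    by (simp only: sum.distrib sum_subtractf sum_distrib_left)
  finally show "K * (K - N - L - 1) * r (Suc j) = A (Suc j) * r ?M - (A (Suc j) + C (Suc j)) * r (Suc j) + C (Suc j) * r j"
    unfolding lhs .
qed

text \<open>
  Up to the factors \<open>\<kappa> j\<close>, the recursion of \<open>acoef\<close> is the Racah recursion with \<open>L = l\<close>,
  \<open>N = w + k\<close>, \<open>K = k\<close>. The values \<open>y m\<close> terminate at \<open>m = k\<close>, before a denominator vanishes,
  because \<open>k \<le> l\<close> and \<open>k \<le> w + k\<close>. The point is that \<open>\<kappa>\<close> picks up a factor 0 at \<open>j = l\<close> and at \<open>j = w + k\<close>.
\<close>

lemma acoef_racah: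
  assumes k: "k \<le> l"
  obtains \<kappa> r :: "nat \<Rightarrow> complex" where "\<And>j. acoef l w k j = \<kappa> j * r j"
    "\<And>j. \<kappa> (Suc j) = \<i> * (of_nat l - of_nat j) * (of_nat (w + k) - of_nat j) / ((2 * of_nat j + 1) * (of_nat l + of_nat j + 2)) * \<kappa> j"
proof -
  let ?L = "of_nat l :: complex" and ?K = "of_nat k :: complex" and ?N = "of_nat (w + k) :: complex"
  define y where "y = rec_nat (1 :: complex) (\<lambda>m v. (of_nat m - ?K) * (?K - ?N - ?L - 1 + of_nat m) / ((?L - of_nat m) * (?N - of_nat m)) * v)"
  have y0: "y 0 = 1" and y_Suc: "y (Suc m) = (of_nat m - ?K) * (?K - ?N - ?L - 1 + of_nat m) / ((?L - of_nat m) * (?N - of_nat m)) * y m" for m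
    by (simp_all add: y_def)
  have y_gt: "y m = 0" if "k < m" for m
    using that
  proof (induction m)
    case (Suc m)
    then show ?case by (cases "m = k") (auto simp: y_Suc)
  qed simp
  have y: "(of_nat m - ?K) * (?K - ?N - ?L - 1 + of_nat m) * y m = (?L - of_nat m) * (?N - of_nat m) * y (Suc m)" for m
  proof (cases "m < k")
    case True
    then have "?L - of_nat m \<noteq> 0" "?N - of_nat m \<noteq> 0" using k by (auto simp del: of_nat_add)
    then show ?thesis by (simp add: y_Suc del: of_nat_add)
  next
    case False
    then show ?thesis using y_gt[of m] y_gt[of "Suc m"] by (cases "m = k") auto
  qed
  define r where "r = (\<lambda>j. \<Sum>m\<le>j. legendre_coeff j m * y m)"
  define \<kappa> where "\<kappa> = rec_nat (1 :: complex) (\<lambda>j v. \<i> * (?L - of_nat j) * (?N - of_nat j) / ((2 * of_nat j + 1) * (?L + of_nat j + 2)) * v)"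
  have \<kappa>0: "\<kappa> 0 = 1" and \<kappa>_Suc: "\<kappa> (Suc j) = \<i> * (?L - of_nat j) * (?N - of_nat j) / ((2 * of_nat j + 1) * (?L + of_nat j + 2)) * \<kappa> j" for j
    by (simp_all add: \<kappa>_def)
  have rec: "?K * (?K - ?N - ?L - 1) * r 0 = ?L * ?N / 2 * (r 1 - r 0)"
    using racah_recursion(1)[OF y] by (simp add: r_def del: of_nat_add)
  have r0: "r 0 = 1" by (simp add: r_def y0)
  have mu: "mu l w k = ?N * ?L / 2 + ?K * (?K - ?N - ?L - 1)" by (rule mu_eq)
  have L2: "?L + 2 \<noteq> 0" by (rule of_nat_plus_numeral_nonzero)
  have "acoef l w k j = \<kappa> j * r j \<and> acoef l w k (Suc j) = \<kappa> (Suc j) * r (Suc j)" for j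
  proof (induction j)
    case 0
    have "mu l w k = ?L * ?N / 2 * r 1"
      using rec unfolding mu r0 by (simp add: algebra_simps del: of_nat_add)
    then have "acoef l w k 1 = \<kappa> 1 * r 1"
      using L2 by (simp add: acoef.simps(2) \<kappa>_Suc \<kappa>0 divide_simps del: of_nat_add)
    then show ?case by (simp add: \<kappa>0 r0)
  next
    case (Suc j)
    let ?J = "of_nat j :: complex"
    define A where "A = (?J + 2) * (?L - ?J - 1) * (?N - ?J - 1) / (2 * (2 * ?J + 3))"
    define C where "C = (?J + 1) * (?L + ?J + 2) * (?N + ?J + 2) / (2 * (2 * ?J + 3))"
    note nz = of_nat_plus_1_nonzero[of j]
      of_nat_plus_numeral_nonzero(1,2)[where j = j and v = "num.Bit0 num.One"]
      of_nat_plus_numeral_nonzero(1,2)[where j = j and v = "num.Bit1 num.One"]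
      of_nat_plus_numeral_nonzero(3)[where i = l and j = j and v = "num.Bit0 num.One"]
      of_nat_plus_numeral_nonzero(3)[where i = l and j = j and v = "num.Bit1 num.One"]
    have A': "(of_nat (Suc j) + 1) * (?L - of_nat (Suc j)) * (?N - of_nat (Suc j)) / (2 * (2 * of_nat (Suc j) + 1)) = A"
      and C': "of_nat (Suc j) * (of_nat (Suc j) + ?L + 1) * (of_nat (Suc j) + ?N + 1) / (2 * (2 * of_nat (Suc j) + 1)) = C"
      by (simp_all add: A_def C_def algebra_simps)
    \<comment> \<open>This identity absorbs the diagonal term of the recursion of \<open>acoef\<close>.\<close>
    have AC: "A + C = ?N * ?L / 2 + (?J + 1) * (?J + 2) / 2"
    proof -
      have q: "2 * (2 * ?J + 3) \<noteq> 0" by (rule no_zero_divisors[OF _ nz(6)]) simp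
      have "(?J + 2) * (?L - ?J - 1) * (?N - ?J - 1) + (?J + 1) * (?L + ?J + 2) * (?N + ?J + 2)
         = 2 * (2 * ?J + 3) * (?N * ?L / 2 + (?J + 1) * (?J + 2) / 2)"
        by (simp add: field_simps del: of_nat_add)
      then show ?thesis
        unfolding A_def C_def add_divide_distrib[symmetric] by (simp only: nonzero_mult_div_cancel_left[OF q])
    qed
    have R: "?K * (?K - ?N - ?L - 1) * r (Suc j) = A * r (Suc (Suc j)) - (A + C) * r (Suc j) + C * r j"
      using racah_recursion(2)[OF y, of j] unfolding A' C' r_def .
    have Ck: "\<i> * ((?J + 1) * (?L - ?J) * (?N - ?J) * (?N + ?J + 2)) / (2 * (2 * ?J + 1) * (2 * ?J + 3)) * \<kappa> j = C * \<kappa> (Suc j)"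
    proof -
      have "\<i> * (a * b * c * d) / (2 * p * q) * x = a * e * d / (2 * q) * (\<i> * b * c / (p * e) * x)"
        if "e \<noteq> 0" for a b c d e p q x :: complex
        using that by (simp add: mult_ac)
      from this[OF nz(7)] show ?thesis unfolding \<kappa>_Suc C_def .
    qed
    have "\<i> * ((?J + 2) * (?L + ?J + 3)) / 2 * acoef l w k (Suc (Suc j))
       = \<i> * ((?J + 1) * (?L - ?J) * (?N - ?J) * (?N + ?J + 2)) / (2 * (2 * ?J + 1) * (2 * ?J + 3)) * \<kappa> j * r j
         - ((?J + 1) * (?J + 2) / 2 + mu l w k) * (\<kappa> (Suc j) * r (Suc j))"
      using acoef_recursion_Suc[of j l w k] Suc.IH by (simp add: algebra_simps)
    also have "\<dots> = \<kappa> (Suc j) * (C * r j - (A + C) * r (Suc j) - ?K * (?K - ?N - ?L - 1) * r (Suc j))"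
      unfolding Ck mu AC by (simp add: algebra_simps del: of_nat_add)
    also have "\<dots> = - A * \<kappa> (Suc j) * r (Suc (Suc j))"
      unfolding R by (simp add: algebra_simps)
    finally have "\<i> * ((?J + 2) * (?L + ?J + 3)) / 2 * acoef l w k (Suc (Suc j)) = - A * \<kappa> (Suc j) * r (Suc (Suc j))" .
    moreover have "- A * \<kappa> (Suc j) = \<i> * ((?J + 2) * (?L + ?J + 3)) / 2 * \<kappa> (Suc (Suc j))"
    proof -
      have "\<kappa> (Suc (Suc j)) = \<i> * ((?L - ?J - 1) * (?N - ?J - 1) / ((2 * ?J + 3) * (?L + ?J + 3))) * \<kappa> (Suc j)"
        unfolding \<kappa>_Suc[of "Suc j"] by (simp add: algebra_simps del: of_nat_add)
      moreover have "A = ((?J + 2) * (?L + ?J + 3)) / 2 * ((?L - ?J - 1) * (?N - ?J - 1) / ((2 * ?J + 3) * (?L + ?J + 3)))"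
        unfolding A_def using nz by (simp add: divide_simps)
      moreover have "- (p / 2 * t) * x = \<i> * p / 2 * (\<i> * t * x)" for p t x :: complex
        by (simp add: algebra_simps)
      ultimately show ?thesis by (simp only:)
    qed
    moreover have "\<i> * ((?J + 2) * (?L + ?J + 3)) / 2 \<noteq> 0" using nz by simp
    ultimately have "acoef l w k (Suc (Suc j)) = \<kappa> (Suc (Suc j)) * r (Suc (Suc j))"
      by (metis (no_types, lifting) mult.assoc mult_left_cancel)
    with Suc.IH show ?case by simp
  qed
  with \<kappa>_Suc that show ?thesis by blast
qed

lemma acoef_eq_0:
  assumes "k \<le> l" "l < j \<or> w + k < j"
  shows "acoef l w k j = 0"
proof -
  obtain \<kappa> r :: "nat \<Rightarrow> complex" where a: "\<And>j. acoef l w k j = \<kappa> j * r j"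
    and \<kappa>: "\<And>j. \<kappa> (Suc j) = \<i> * (of_nat l - of_nat j) * (of_nat (w + k) - of_nat j) / ((2 * of_nat j + 1) * (of_nat l + of_nat j + 2)) * \<kappa> j"
    using acoef_racah[OF assms(1)] by metis
  from assms(2) have "\<kappa> j = 0"
  proof (induction j)
    case (Suc j)
    then consider "l = j" | "w + k = j" | "l < j \<or> w + k < j" by linarith
    then show ?case using Suc.IH by cases (auto simp: \<kappa>)
  qed simp
  then show ?thesis by (simp add: a)
qed

section \<open>Discrete Chebyshev polynomials and the matrix U\<close>

text \<open>
  The Hahn polynomial of degree \<open>k\<close> on \<open>{0..l}\<close> with both parameters 0, also called discrete Chebyshev
  polynomial. The Pochhammer quotient of the hypergeometric series is a quotient of binomial coefficients.
\<close>

definition hahn :: "nat \<Rightarrow> nat \<Rightarrow> nat \<Rightarrow> complex" where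
  "hahn l k x = (\<Sum>m\<le>k. legendre_coeff k m * (of_nat (x choose m) / of_nat (l choose m)))"

lemma legendre_coeff_pochhammer:
  "legendre_coeff k m = pochhammer (- of_nat k) m * pochhammer (of_nat k + 1) m / (fact m)\<^sup>2"
proof -
  have 1: "of_nat (k choose m) = (- 1) ^ m * pochhammer (- of_nat k) m / (fact m :: complex)"
    by (simp add: binomial_gbinomial gbinomial_pochhammer)
  have 2: "of_nat ((k + m) choose m) = pochhammer (of_nat k + 1) m / (fact m :: complex)"
    by (simp add: binomial_gbinomial gbinomial_pochhammer')
  show ?thesis unfolding legendre_coeff_def 1 2 by (simp add: power2_eq_square)
qed

lemma Umat_hahn:
  assumes "j \<le> l" "k \<le> l"
  shows "Umat l $$ (j, k) = hahn l k j"
proof -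
  let ?F = "fps_hypergeo [- of_nat k, - of_nat j, of_nat k + 1] [1, - of_nat l] (1::complex)"
  have "Umat l $$ (j, k) = (\<Sum>m. fps_nth ?F m)"
    using assms by (simp add: Umat_def hypergeometric_def eval_fps_def)
  also have "\<dots> = (\<Sum>m\<le>k. fps_nth ?F m)"
    by (rule suminf_finite) (auto simp: pochhammer_of_nat_eq_0_lemma not_le)
  also have "\<dots> = hahn l k j"
    unfolding hahn_def
  proof (rule sum.cong[OF refl])
    fix m assume "m \<in> {..k}"
    then have m: "m \<le> l" using assms by simp
    have 1: "of_nat (x choose m) = (- 1) ^ m * pochhammer (- of_nat x) m / (fact m :: complex)" for x
      by (simp add: binomial_gbinomial gbinomial_pochhammer)
    show "fps_nth ?F m = legendre_coeff k m * (of_nat (j choose m) / of_nat (l choose m))"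
      unfolding 1 legendre_coeff_pochhammer
      by (simp add: pochhammer_fact[symmetric] power2_eq_square mult_ac)
  qed
  finally show ?thesis .
qed

lemma of_nat_choose_Suc:
  "of_nat (Suc m) * of_nat (n choose Suc m) = (of_nat n - of_nat m) * (of_nat (n choose m) :: complex)"
proof (cases "m \<le> n")
  case True
  have "Suc m * (n choose Suc m) = (n - m) * (n choose m)"
    by (metis binomial_absorb_comp binomial_absorption)
  then have "of_nat (Suc m) * of_nat (n choose Suc m) = (of_nat (n - m) * of_nat (n choose m) :: complex)"
    by (metis of_nat_mult)
  then show ?thesis using True by (simp only: of_nat_diff)
qed (simp add: binomial_eq_0)

text \<open>
  Recursion in the degree. The proof follows that of \<open>racah_recursion\<close>: multiplication by \<open>x\<close> acts on the quotients
  \<open>y m\<close> of binomial coefficients in two terms.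
\<close>

lemma hahn_recursion:
  assumes "x \<le> l" "Suc k \<le> l"
  defines "A \<equiv> \<lambda>k::nat. (of_nat k + 1) * (of_nat l - of_nat k) / (2 * (2 * of_nat k + 1)) :: complex"
  defines "C \<equiv> \<lambda>k::nat. of_nat k * (of_nat l + of_nat k + 1) / (2 * (2 * of_nat k + 1)) :: complex"
  shows "of_nat x * hahn l 0 x = - A 0 * (hahn l 1 x - hahn l 0 x)"
    and "of_nat x * hahn l (Suc k) x = - A (Suc k) * hahn l (Suc (Suc k)) x
      + (A (Suc k) + C (Suc k)) * hahn l (Suc k) x - C (Suc k) * hahn l k x"
proof -
  let ?L = "of_nat l :: complex" and ?X = "of_nat x :: complex"
  define y where "y m = of_nat (x choose m) / (of_nat (l choose m) :: complex)" for m
  have y: "(?X - of_nat m) * y m = (?L - of_nat m) * y (Suc m)" for m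
  proof (cases "m < l")
    case True
    have nz: "(of_nat (l choose m) :: complex) \<noteq> 0" "(of_nat (l choose Suc m) :: complex) \<noteq> 0" "(of_nat (Suc m) :: complex) \<noteq> 0"
      using True by (auto simp: simp del: of_nat_Suc)
    have "(?X - of_nat m) * of_nat (x choose m) * of_nat (l choose Suc m) * (of_nat (Suc m) :: complex)
       = (?L - of_nat m) * of_nat (x choose Suc m) * of_nat (l choose m) * of_nat (Suc m)"
    proof -
      have "a * b * c * d = e * f * g * d"
        if "d * f = a * b" "d * c = e * g" for a b c d e f g :: complex
        using that by (metis mult.assoc mult.commute mult.left_commute)
      from this[OF of_nat_choose_Suc of_nat_choose_Suc] show ?thesis .
    qed
    then show ?thesis using nz by (simp add: y_def divide_simps mult_ac del: of_nat_Suc)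
  next
    case False
    then show ?thesis using assms(1) by (cases "m = x") (auto simp: y_def binomial_eq_0)
  qed
  have h: "hahn l k x = (\<Sum>m\<le>k. legendre_coeff k m * y m)" for k
    by (simp add: hahn_def y_def)
  have h0: "hahn l 0 x = y 0" and h1: "hahn l 1 x = y 0 - 2 * y 1"
    by (simp_all add: h legendre_coeff_def)
  show "?X * hahn l 0 x = - A 0 * (hahn l 1 x - hahn l 0 x)"
    unfolding h0 h1 using y[of 0] by (simp add: A_def algebra_simps)
  let ?M = "Suc (Suc k)" and ?e = legendre_coeff
  have xy: "?X * y m = of_nat m * y m + (?L - of_nat m) * y (Suc m)" for m
    using y[of m] by (simp add: algebra_simps)
  \<comment> \<open>The coefficient of \<open>y m\<close> on the left hand side, as for the Racah polynomials.\<close>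
  define c where "c m = of_nat m * ?e (Suc k) m
     + (case m of 0 \<Rightarrow> 0 | Suc i \<Rightarrow> (?L - of_nat i) * ?e (Suc k) i)" for m
  have "?X * hahn l (Suc k) x = (\<Sum>m\<le>Suc k. ?e (Suc k) m * (?X * y m))"
    unfolding h sum_distrib_left by (rule sum.cong) (simp_all add: mult_ac)
  also have "\<dots> = (\<Sum>m\<le>Suc k. of_nat m * ?e (Suc k) m * y m) + (\<Sum>m\<le>Suc k. (?L - of_nat m) * ?e (Suc k) m * y (Suc m))"
    unfolding xy sum.distrib[symmetric] by (rule sum.cong) (simp_all add: algebra_simps)
  also have "(\<Sum>m\<le>Suc k. of_nat m * ?e (Suc k) m * y m) = (\<Sum>m\<le>?M. of_nat m * ?e (Suc k) m * y m)"
    by (rule sum.mono_neutral_left) (auto simp: legendre_coeff_eq_0)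
  also have "(\<Sum>m\<le>Suc k. (?L - of_nat m) * ?e (Suc k) m * y (Suc m))
     = (\<Sum>m\<le>?M. (case m of 0 \<Rightarrow> 0 | Suc i \<Rightarrow> (?L - of_nat i) * ?e (Suc k) i) * y m)"
    by (simp only: sum.atMost_Suc_shift[of _ "Suc k"]) simp
  also have "(\<Sum>m\<le>?M. of_nat m * ?e (Suc k) m * y m)
     + (\<Sum>m\<le>?M. (case m of 0 \<Rightarrow> 0 | Suc i \<Rightarrow> (?L - of_nat i) * ?e (Suc k) i) * y m) = (\<Sum>m\<le>?M. c m * y m)"
    unfolding sum.distrib[symmetric] c_def by (rule sum.cong) (simp_all only: distrib_right)
  finally have lhs: "?X * hahn l (Suc k) x = (\<Sum>m\<le>?M. c m * y m)" .
  have c: "c m = - A (Suc k) * ?e ?M m + (A (Suc k) + C (Suc k)) * ?e (Suc k) m - C (Suc k) * ?e k m" for m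
  proof (cases m)
    case 0
    then show ?thesis by (simp add: c_def)
  next
    case (Suc i)
    obtain z where z: "?e ?M (Suc i) = (of_nat k + of_nat i + 3) * (of_nat k + of_nat i + 2) * z"
      "?e (Suc k) (Suc i) = (of_nat k + of_nat i + 2) * (of_nat k + 1 - of_nat i) * z"
      "?e k (Suc i) = (of_nat k + 1 - of_nat i) * (of_nat k - of_nat i) * z"
      "?e (Suc k) i = - ((of_nat i + 1)\<^sup>2 * z)"
      by (rule legendre_coeff_common_factor)
    let ?d = "2 * (2 * of_nat (Suc k) + 1) :: complex"
    have d: "?d \<noteq> 0" by (rule no_zero_divisors[OF _ of_nat_plus_1_nonzero(2)]) simp
    have A: "?d * A (Suc k) = (of_nat k + 2) * (?L - of_nat k - 1)"
      and C: "?d * C (Suc k) = (of_nat k + 1) * (of_nat k + ?L + 2)"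
      unfolding A_def C_def times_divide_eq_right nonzero_mult_div_cancel_left[OF d] by (simp_all add: algebra_simps)
    have "?d * c m = - ((of_nat k + 2) * (?L - of_nat k - 1)) * ?e ?M m
      + ((of_nat k + 2) * (?L - of_nat k - 1) + (of_nat k + 1) * (of_nat k + ?L + 2)) * ?e (Suc k) m
      - (of_nat k + 1) * (of_nat k + ?L + 2) * ?e k m"
      unfolding c_def Suc nat.case z by (simp add: algebra_simps power2_eq_square)
    also have "\<dots> = ?d * (- A (Suc k) * ?e ?M m + (A (Suc k) + C (Suc k)) * ?e (Suc k) m - C (Suc k) * ?e k m)"
    proof -
      have "- (d * a) * e1 + (d * a + d * c) * e2 - d * c * e3 = d * (- a * e1 + (a + c) * e2 - c * e3)"
        for d a c e1 e2 e3 :: complex by (simp add: algebra_simps)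
      then show ?thesis unfolding A[symmetric] C[symmetric] .
    qed
    finally show ?thesis using d mult_left_cancel by blast
  qed
  have "(\<Sum>m\<le>?M. c m * y m) = (\<Sum>m\<le>?M. - A (Suc k) * (?e ?M m * y m)
      + (A (Suc k) + C (Suc k)) * (?e (Suc k) m * y m) - C (Suc k) * (?e k m * y m))"
    unfolding c by (rule sum.cong) (simp_all only: algebra_simps)
  also have "\<dots> = - A (Suc k) * hahn l ?M x + (A (Suc k) + C (Suc k)) * hahn l (Suc k) x - C (Suc k) * hahn l k x"
    unfolding h legendre_coeff_sum_extend[of "Suc k" ?M y, OF le_SucI[OF order_refl]]
      legendre_coeff_sum_extend[of k ?M y, OF le_SucI[OF le_SucI[OF order_refl]]]
    by (simp only: sum.distrib sum_subtractf sum_distrib_left)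
  finally show "?X * hahn l (Suc k) x = - A (Suc k) * hahn l ?M x + (A (Suc k) + C (Suc k)) * hahn l (Suc k) x - C (Suc k) * hahn l k x"
    unfolding lhs .
qed

text \<open>
  Second order difference equation in \<open>x\<close>. In the basis of the binomial coefficients \<open>b m\<close> the difference operator
  \<open>?T\<close> has two terms, which gives a two term recursion for the coefficients \<open>q m\<close>.
\<close>

lemma hahn_difference_equation:
  assumes "k \<le> l" "x \<le> l"
  shows "of_nat (k * (k + 1)) * hahn l k x
    = (of_nat x + 1) * (of_nat x - of_nat l) * (hahn l k (Suc x) - hahn l k x)
      - of_nat x * (of_nat x - of_nat l - 1) * (hahn l k x - hahn l k (x - 1))"
proof -
  let ?L = "of_nat l :: complex" and ?X = "of_nat x :: complex"
  let ?T = "\<lambda>f. (?X + 1) * (?X - ?L) * (f (Suc x) - f x) - ?X * (?X - ?L - 1) * (f x - f (x - 1))"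
  define b where "b m = (\<lambda>x. of_nat (x choose m) :: complex)" for m
  define q where "q m = legendre_coeff k m / of_nat (l choose m)" for m
  have T0: "?T (b 0) = 0" by (simp add: b_def)
  have T: "?T (b (Suc m)) = of_nat (Suc m * (m + 2)) * b (Suc m) x - of_nat (Suc m) * (?L - of_nat m) * b m x" for m
  proof -
    have d1: "b (Suc m) (Suc x) - b (Suc m) x = b m x" by (simp add: b_def)
    have d2: "?X * (b (Suc m) x - b (Suc m) (x - 1)) = of_nat (Suc m) * b (Suc m) x"
    proof (cases x)
      case (Suc i)
      have "Suc m * (Suc i choose Suc m) = Suc i * (i choose m)"
        using binomial_absorption[of m "Suc i"] by (simp only: diff_Suc_1)
      then have "of_nat (Suc m) * of_nat (Suc i choose Suc m) = (of_nat (Suc i) * of_nat (i choose m) :: complex)"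
        by (metis of_nat_mult)
      then show ?thesis by (simp add: Suc b_def del: of_nat_Suc)
    qed (simp add: b_def)
    have d3: "(?X - of_nat m) * b m x = of_nat (Suc m) * b (Suc m) x"
      unfolding b_def by (rule of_nat_choose_Suc[symmetric])
    have "?T (b (Suc m)) = (?X - ?L) * ((?X - of_nat m) * b m x + of_nat (Suc m) * b m x)
        - (?X - ?L - 1) * (of_nat (Suc m) * b (Suc m) x)"
      unfolding d1 d2[symmetric] by (simp add: algebra_simps)
    also have "\<dots> = of_nat (Suc m) * b (Suc m) x + of_nat (Suc m) * ((?X - of_nat m) * b m x + (of_nat m - ?L) * b m x)"
      unfolding d3[symmetric] by (simp add: algebra_simps)
    also have "\<dots> = of_nat (Suc m * (m + 2)) * b (Suc m) x - of_nat (Suc m) * (?L - of_nat m) * b m x"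
      unfolding d3 by (simp add: algebra_simps)
    finally show ?thesis .
  qed
  have q: "of_nat (Suc m) * (?L - of_nat m) * q (Suc m) = (of_nat (m * (m + 1)) - of_nat (k * (k + 1))) * q m" if "m \<le> k" for m
  proof (cases "m = k")
    case True
    then show ?thesis by (simp add: q_def legendre_coeff_eq_0)
  next
    case False
    then have m: "Suc m \<le> k" using that by simp
    then obtain i where i: "k = Suc m + i" using le_Suc_ex by blast
    have i1: "of_nat i + 1 \<noteq> (0::complex)" and m1: "of_nat m + 1 \<noteq> (0::complex)"
      by (rule of_nat_plus_1_nonzero)+
    have e: "(of_nat m + 1)\<^sup>2 * legendre_coeff k (Suc m) = - ((of_nat i + 1) * (of_nat k + of_nat m + 1)) * legendre_coeff k m"
      using i1 m1 by (simp add: legendre_coeff_fact i divide_simps) (simp add: algebra_simps power2_eq_square)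
    have "of_nat (l choose Suc m) \<noteq> (0::complex)" "of_nat (l choose m) \<noteq> (0::complex)"
      using m assms(1) by auto
    then have c: "(?L - of_nat m) / of_nat (l choose Suc m) = (of_nat m + 1) / (of_nat (l choose m) :: complex)"
      using of_nat_choose_Suc[of m l] by (simp add: divide_simps add.commute mult.commute)
    have "of_nat (Suc m) * (?L - of_nat m) * q (Suc m)
       = (of_nat m + 1) * legendre_coeff k (Suc m) * ((?L - of_nat m) / of_nat (l choose Suc m))"
      by (simp add: q_def)
    also have "\<dots> = (of_nat m + 1)\<^sup>2 * legendre_coeff k (Suc m) / of_nat (l choose m)"
      unfolding c by (simp add: power2_eq_square)
    also have "\<dots> = (of_nat (m * (m + 1)) - of_nat (k * (k + 1))) * q m"
    proof -
      have "- ((of_nat i + 1) * (of_nat k + of_nat m + 1)) = (of_nat (m * (m + 1)) - of_nat (k * (k + 1)) :: complex)"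
        by (simp add: i algebra_simps)
      then show ?thesis unfolding e q_def by (simp only: times_divide_eq_right)
    qed
    finally show ?thesis .
  qed
  have h: "hahn l k x = (\<Sum>m\<le>k. q m * b m x)" for x
    by (simp add: hahn_def q_def b_def)
  have "?T (hahn l k) = (\<Sum>m\<le>k. q m * ?T (b m))"
    unfolding h by (simp add: sum_subtractf[symmetric] sum_distrib_left algebra_simps)
  also have "\<dots> = (\<Sum>m\<le>k. of_nat (m * (m + 1)) * q m * b m x) - (\<Sum>m\<le>k. case m of 0 \<Rightarrow> 0 | Suc i \<Rightarrow> of_nat (Suc i) * (?L - of_nat i) * q (Suc i) * b i x)"
    unfolding sum_subtractf[symmetric]
  proof (rule sum.cong[OF refl])
    fix m
    show "q m * ?T (b m) = of_nat (m * (m + 1)) * q m * b m x - (case m of 0 \<Rightarrow> 0 | Suc i \<Rightarrow> of_nat (Suc i) * (?L - of_nat i) * q (Suc i) * b i x)"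
      by (cases m) (simp_all only: T T0 nat.case, simp_all add: algebra_simps)
  qed
  also have "(\<Sum>m\<le>k. case m of 0 \<Rightarrow> 0 | Suc i \<Rightarrow> of_nat (Suc i) * (?L - of_nat i) * q (Suc i) * b i x)
     = (\<Sum>m\<le>Suc k. case m of 0 \<Rightarrow> 0 | Suc i \<Rightarrow> of_nat (Suc i) * (?L - of_nat i) * q (Suc i) * b i x)"
    by (simp add: q_def legendre_coeff_eq_0)
  also have "\<dots> = (\<Sum>m\<le>k. (of_nat (m * (m + 1)) - of_nat (k * (k + 1))) * q m * b m x)"
  proof -
    have "(\<Sum>m\<le>Suc k. case m of 0 \<Rightarrow> 0 | Suc i \<Rightarrow> of_nat (Suc i) * (?L - of_nat i) * q (Suc i) * b i x)
       = (\<Sum>i\<le>k. of_nat (Suc i) * (?L - of_nat i) * q (Suc i) * b i x)"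
      by (subst sum.atMost_Suc_shift) simp
    also have "\<dots> = (\<Sum>m\<le>k. (of_nat (m * (m + 1)) - of_nat (k * (k + 1))) * q m * b m x)"
      by (rule sum.cong) (simp_all only: q atMost_iff)
    finally show ?thesis .
  qed
  also have "(\<Sum>m\<le>k. of_nat (m * (m + 1)) * q m * b m x) - \<dots> = of_nat (k * (k + 1)) * hahn l k x"
    unfolding sum_subtractf[symmetric] h sum_distrib_left by (rule sum.cong) (simp_all add: algebra_simps)
  finally show ?thesis by simp
qed

definition hahn_norm :: "nat \<Rightarrow> nat \<Rightarrow> complex" where
  "hahn_norm l k = (\<Sum>x\<le>l. (hahn l k x)\<^sup>2)"

text \<open>
  The difference operator is a telescoping form, with boundary terms that vanish at \<open>x = 0\<close> and \<open>x = l + 1\<close>, so it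
  is symmetric for the uniform weight; its eigenvalues \<open>k (k + 1)\<close> are distinct.
\<close>

lemma hahn_orthogonal:
  assumes "k \<le> l" "k' \<le> l" "k \<noteq> k'"
  shows "(\<Sum>x\<le>l. hahn l k x * hahn l k' x) = 0"
proof -
  let ?f = "hahn l k" and ?g = "hahn l k'" and ?L = "of_nat l :: complex"
  \<comment> \<open>The discrete Wronskian of the two polynomials; the factor in front vanishes at \<open>x = 0\<close> and \<open>x = l + 1\<close>.\<close>
  define h where "h x = of_nat x * (of_nat x - ?L - 1) * (?f (x - 1) * ?g x - ?f x * ?g (x - 1))" for x
  have "(of_nat (k * (k + 1)) - of_nat (k' * (k' + 1))) * (?f x * ?g x) = h x - h (Suc x)" if "x \<le> l" for x
  proof -
    have "(p - q) * (f * g) = (p * f) * g - f * (q * g)" for p q f g :: complex by (simp add: algebra_simps)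
    note split = this[of "of_nat (k * (k + 1))" "of_nat (k' * (k' + 1))" "?f x" "?g x"]
    show ?thesis
      unfolding split hahn_difference_equation[OF assms(1) that] hahn_difference_equation[OF assms(2) that] h_def
      by (simp add: algebra_simps)
  qed
  then have "(of_nat (k * (k + 1)) - of_nat (k' * (k' + 1))) * (\<Sum>x\<le>l. ?f x * ?g x) = (\<Sum>x\<le>l. h x - h (Suc x))"
    unfolding sum_distrib_left by (intro sum.cong) simp_all
  also have "\<dots> = h 0 - h (Suc l)" by (rule sum_telescope)
  also have "\<dots> = 0" by (simp add: h_def)
  finally have "of_nat (k * (k + 1)) = (of_nat (k' * (k' + 1)) :: complex) \<or> (\<Sum>x\<le>l. ?f x * ?g x) = 0"
    by simp
  moreover have "k * (k + 1) \<noteq> k' * (k' + 1)"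
    using assms(3) by (metis add_less_mono1 linorder_neqE_nat mult_strict_mono' order_less_irrefl zero_le)
  ultimately show ?thesis by (simp only: of_nat_eq_iff) simp
qed

text \<open>
  Multiplication by \<open>x\<close> is symmetric, so its two off-diagonal matrix entries, computed by the three term
  recursion once in degree \<open>k\<close> and once in degree \<open>k + 1\<close>, agree.
\<close>

lemma hahn_norm_Suc:
  assumes "Suc k \<le> l"
  shows "(2 * of_nat k + 3) * (of_nat l - of_nat k) * hahn_norm l (Suc k)
    = (2 * of_nat k + 1) * (of_nat l + of_nat k + 2) * hahn_norm l k"
proof -
  define A where "A k = (of_nat k + 1) * (of_nat l - of_nat k) / (2 * (2 * of_nat k + 1) :: complex)" for k
  define C where "C k = of_nat k * (of_nat l + of_nat k + 1) / (2 * (2 * of_nat k + 1) :: complex)" for k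
  let ?S = "\<lambda>i j. \<Sum>x\<le>l. hahn l i x * hahn l j x"
  have S: "?S i j = (if i = j then hahn_norm l i else 0)" if "i \<le> l" "j \<le> l" for i j
    using hahn_orthogonal[OF that] by (simp add: hahn_norm_def power2_eq_square)
  have up: "(\<Sum>x\<le>l. of_nat x * hahn l k x * hahn l (Suc k) x) = - A k * hahn_norm l (Suc k)"
  proof (cases k)
    case 0
    have "(\<Sum>x\<le>l. of_nat x * hahn l k x * hahn l (Suc k) x) = (\<Sum>x\<le>l. - A 0 * (hahn l 1 x * hahn l 1 x) + A 0 * (hahn l 0 x * hahn l 1 x))"
      using assms unfolding 0 by (intro sum.cong refl) (simp add: hahn_recursion(1) A_def algebra_simps)
    also have "\<dots> = - A 0 * ?S 1 1 + A 0 * ?S 0 1" by (simp only: sum.distrib sum_distrib_left)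
    finally show ?thesis using S[of 1 1] S[of 0 1] assms unfolding 0 by simp
  next
    case (Suc i)
    have "(\<Sum>x\<le>l. of_nat x * hahn l k x * hahn l (Suc k) x)
      = (\<Sum>x\<le>l. - A k * (hahn l (Suc k) x * hahn l (Suc k) x) + (A k + C k) * (hahn l k x * hahn l (Suc k) x) - C k * (hahn l i x * hahn l (Suc k) x))"
    proof (rule sum.cong[OF refl])
      fix x assume "x \<in> {..l}"
      then have "of_nat x * hahn l (Suc i) x = - A (Suc i) * hahn l (Suc (Suc i)) x + (A (Suc i) + C (Suc i)) * hahn l (Suc i) x - C (Suc i) * hahn l i x"
        using hahn_recursion(2)[of x l i] assms Suc unfolding A_def C_def by simp
      then have "of_nat x * hahn l (Suc i) x * hahn l (Suc k) x = (- A (Suc i) * hahn l (Suc (Suc i)) x + (A (Suc i) + C (Suc i)) * hahn l (Suc i) x - C (Suc i) * hahn l i x) * hahn l (Suc k) x"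
        by simp
      then show "of_nat x * hahn l k x * hahn l (Suc k) x = - A k * (hahn l (Suc k) x * hahn l (Suc k) x) + (A k + C k) * (hahn l k x * hahn l (Suc k) x) - C k * (hahn l i x * hahn l (Suc k) x)"
        unfolding Suc by (simp add: algebra_simps)
    qed
    also have "\<dots> = - A k * ?S (Suc k) (Suc k) + (A k + C k) * ?S k (Suc k) - C k * ?S i (Suc k)"
      by (simp only: sum.distrib sum_subtractf sum_distrib_left)
    finally show ?thesis using S[of "Suc k" "Suc k"] S[of k "Suc k"] S[of i "Suc k"] assms Suc by simp
  qed
  have "(\<Sum>x\<le>l. of_nat x * hahn l k x * hahn l (Suc k) x)
    = (\<Sum>x\<le>l. - A (Suc k) * (hahn l (Suc (Suc k)) x * hahn l k x) + (A (Suc k) + C (Suc k)) * (hahn l (Suc k) x * hahn l k x) - C (Suc k) * (hahn l k x * hahn l k x))"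
  proof (rule sum.cong[OF refl])
    fix x assume "x \<in> {..l}"
    then have "of_nat x * hahn l (Suc k) x = - A (Suc k) * hahn l (Suc (Suc k)) x + (A (Suc k) + C (Suc k)) * hahn l (Suc k) x - C (Suc k) * hahn l k x"
      using hahn_recursion(2)[of x l k] assms unfolding A_def C_def by simp
    then have "of_nat x * hahn l (Suc k) x * hahn l k x = (- A (Suc k) * hahn l (Suc (Suc k)) x + (A (Suc k) + C (Suc k)) * hahn l (Suc k) x - C (Suc k) * hahn l k x) * hahn l k x"
      by simp
    then show "of_nat x * hahn l k x * hahn l (Suc k) x = - A (Suc k) * (hahn l (Suc (Suc k)) x * hahn l k x) + (A (Suc k) + C (Suc k)) * (hahn l (Suc k) x * hahn l k x) - C (Suc k) * (hahn l k x * hahn l k x)"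
      by (simp add: algebra_simps)
  qed
  also have "\<dots> = - A (Suc k) * ?S (Suc (Suc k)) k + (A (Suc k) + C (Suc k)) * ?S (Suc k) k - C (Suc k) * ?S k k"
    by (simp only: sum.distrib sum_subtractf sum_distrib_left)
  also have "- A (Suc k) * ?S (Suc (Suc k)) k = 0"
  proof (cases "Suc (Suc k) \<le> l")
    case True
    then show ?thesis using S[of "Suc (Suc k)" k] by simp
  next
    case False
    then have "l = Suc k" using assms by simp
    then show ?thesis by (simp add: A_def)
  qed
  finally have "A k * hahn_norm l (Suc k) = C (Suc k) * hahn_norm l k"
    using up S[of "Suc k" k] S[of k k] assms by simp
  moreover have "a / p * x = b / q * y \<Longrightarrow> p \<noteq> 0 \<Longrightarrow> q \<noteq> 0 \<Longrightarrow> q * a * x = p * b * y" for a b p q x y :: complex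
    by (simp add: field_simps)
  ultimately have "(2 * (2 * of_nat (Suc k) + 1)) * ((of_nat k + 1) * (of_nat l - of_nat k)) * hahn_norm l (Suc k)
    = (2 * (2 * of_nat k + 1)) * (of_nat (Suc k) * (of_nat l + of_nat (Suc k) + 1)) * hahn_norm l k"
    unfolding A_def C_def using of_nat_plus_1_nonzero(2)[of k] of_nat_plus_1_nonzero(2)[of "Suc k"] by (metis mult_eq_0_iff zero_neq_numeral)
  then have "(2 * (of_nat k + 1)) * ((2 * of_nat k + 3) * (of_nat l - of_nat k) * hahn_norm l (Suc k))
    = (2 * (of_nat k + 1)) * ((2 * of_nat k + 1) * (of_nat l + of_nat k + 2) * hahn_norm l k)"
    by (simp add: algebra_simps)
  moreover have "2 * (of_nat k + 1) \<noteq> (0::complex)"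
    by (rule no_zero_divisors[OF _ of_nat_plus_1_nonzero(1)]) simp
  ultimately show ?thesis using mult_left_cancel by blast
qed

section \<open>The commuting operators in the spherical picture\<close>

lemma poly_pointwise_eqI: "(\<And>z. poly p z = poly q z) \<Longrightarrow> p = (q :: complex poly)"
  by (metis poly_eq_poly_eq_iff ext)

lemma gegen_ODE:
  assumes "j \<le> n"
  shows "(1 - z\<^sup>2) * poly (pderiv (pderiv (gegen n j))) z - (2 * of_nat j + 3) * z * poly (pderiv (gegen n j)) z
    = - ((of_nat n - of_nat j) * (of_nat n + of_nat j + 2)) * poly (gegen n j) z"
proof (cases "j = n")
  case True
  then show ?thesis by (simp add: gegen_self)
next
  case False
  with assms have "j < n" by simp
  define c where "c = (of_nat n - of_nat j) * (of_nat n + of_nat j + 2) / (2 * of_nat j + 3 :: complex)"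
  have d: "pderiv (gegen n j) = smult c (gegen n (Suc j))"
    unfolding c_def by (rule pderiv_gegen[OF assms])
  have nz: "2 * of_nat j + 3 \<noteq> (0::complex)" by (rule of_nat_plus_numeral_nonzero)
  have "(1 - z\<^sup>2) * poly (pderiv (pderiv (gegen n j))) z - (2 * of_nat j + 3) * z * poly (pderiv (gegen n j)) z
    = c * ((1 - z\<^sup>2) * poly (pderiv (gegen n (Suc j))) z - (2 * of_nat j + 3) * z * poly (gegen n (Suc j)) z)"
    unfolding d by (simp add: pderiv_smult algebra_simps)
  also have "\<dots> = c * (- (2 * of_nat j + 3) * poly (gegen n j) z)"
    unfolding gegen_lower[OF \<open>j < n\<close>] ..
  also have "\<dots> = - (c * (2 * of_nat j + 3)) * poly (gegen n j) z" by (simp add: algebra_simps)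
  also have "c * (2 * of_nat j + 3) = (of_nat n - of_nat j) * (of_nat n + of_nat j + 2)"
    using nz by (simp add: c_def)
  finally show ?thesis .
qed

text \<open>
  The entry in row \<open>j\<close> and column \<open>k\<close> of \<open>P\<^sub>w\<close> as a polynomial.
\<close>

definition spherical :: "nat \<Rightarrow> nat \<Rightarrow> nat \<Rightarrow> nat \<Rightarrow> complex poly" where
  "spherical l w j k = smult (acoef l w k j) (gegen (w + k) j)"

lemma spherical_eq_0: "k \<le> l \<Longrightarrow> l < j \<or> w + k < j \<Longrightarrow> spherical l w j k = 0"
  by (simp add: spherical_def acoef_eq_0)

text \<open>
  The operators \<open>D\<close> and \<open>E\<close> after conjugation by \<open>\<Psi>\<close>, acting on one column. \<open>Dbar\<close> does not couple the rows;
  \<open>Ebar\<close> couples neighbouring rows by the ladder operators of the Gegenbauer polynomials.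
  In \<open>Ebar\<close> the index \<open>j - 1\<close> for \<open>j = 0\<close> is harmless because \<open>raise_coeff l 0 = 0\<close>.
\<close>

definition Dbar :: "(nat \<Rightarrow> complex poly) \<Rightarrow> nat \<Rightarrow> complex poly" where
  "Dbar f j = [:1, 0, - 1:] * pderiv (pderiv (f j)) - smult (2 * of_nat j + 3) ([:0, 1:] * pderiv (f j))
     - smult (of_nat j * (of_nat j + 2)) (f j)"

definition raise_coeff :: "nat \<Rightarrow> nat \<Rightarrow> complex" where
  "raise_coeff l j = \<i> * (of_nat j * (of_nat l - of_nat j + 1)) / (2 * (2 * of_nat j - 1))"

definition lower_coeff :: "nat \<Rightarrow> nat \<Rightarrow> complex" where
  "lower_coeff l j = \<i> * ((of_nat j + 1) * (of_nat l + of_nat j + 2)) / (2 * (2 * of_nat j + 3))"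

definition Ebar :: "nat \<Rightarrow> (nat \<Rightarrow> complex poly) \<Rightarrow> nat \<Rightarrow> complex poly" where
  "Ebar l f j = smult (raise_coeff l j) (pderiv (f (j - 1)))
     + smult (lower_coeff l j) ([:1, 0, - 1:] * pderiv (f (Suc j)) - smult (2 * of_nat j + 3) ([:0, 1:] * f (Suc j)))
     - smult (of_nat j * (of_nat j + 1) / 2) (f j)"

lemma poly_Dbar: "poly (Dbar f j) z = (1 - z\<^sup>2) * poly (pderiv (pderiv (f j))) z
    - (2 * of_nat j + 3) * (z * poly (pderiv (f j)) z) - of_nat j * (of_nat j + 2) * poly (f j) z"
  by (simp add: Dbar_def power2_eq_square algebra_simps)

lemma poly_Ebar: "poly (Ebar l f j) z = raise_coeff l j * poly (pderiv (f (j - 1))) z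
    + lower_coeff l j * ((1 - z\<^sup>2) * poly (pderiv (f (Suc j))) z - (2 * of_nat j + 3) * (z * poly (f (Suc j)) z))
    - of_nat j * (of_nat j + 1) / 2 * poly (f j) z"
  by (simp add: Ebar_def power2_eq_square algebra_simps)

lemma Dbar_spherical:
  assumes "k \<le> l"
  shows "Dbar (\<lambda>j. spherical l w j k) j = smult (lambda w k) (spherical l w j k)"
proof (cases "j \<le> w + k")
  case True
  show ?thesis
  proof (rule poly_pointwise_eqI)
    fix z
    let ?n = "of_nat (w + k) :: complex" and ?j = "of_nat j :: complex" and ?G = "gegen (w + k) j"
    have "poly (Dbar (\<lambda>j. spherical l w j k) j) z = acoef l w k j *
      ((1 - z\<^sup>2) * poly (pderiv (pderiv ?G)) z - (2 * ?j + 3) * z * poly (pderiv ?G) z - ?j * (?j + 2) * poly ?G z)"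
      by (simp add: poly_Dbar spherical_def pderiv_smult algebra_simps del: of_nat_add)
    also have "\<dots> = acoef l w k j * (- (?n * (?n + 2)) * poly ?G z)"
      unfolding gegen_ODE[OF True] by (simp add: algebra_simps del: of_nat_add)
    also have "\<dots> = poly (smult (lambda w k) (spherical l w j k)) z"
      by (simp add: spherical_def lambda_def algebra_simps)
    finally show "poly (Dbar (\<lambda>j. spherical l w j k) j) z = poly (smult (lambda w k) (spherical l w j k)) z" .
  qed
next
  case False
  then show ?thesis using assms by (simp add: Dbar_def spherical_eq_0)
qed

text \<open>
  After the ladder relations all three rows contribute the same Gegenbauer polynomial, and what remains is
  the recursion of \<open>acoef\<close>. At the last row \<open>j = w + k\<close> and beyond it, the vanishing of \<open>acoef\<close> is used.
\<close>

lemma Ebar_spherical: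
  assumes "k \<le> l"
  shows "Ebar l (\<lambda>j. spherical l w j k) j = smult (mu l w k) (spherical l w j k)"
proof (cases "j \<le> w + k")
  case True
  let ?N = "of_nat (w + k) :: complex" and ?J = "of_nat j :: complex" and ?L = "of_nat l :: complex"
  let ?a = "acoef l w k" and ?n = "w + k"
  have nz: "2 * ?J + 3 \<noteq> 0" by (rule of_nat_plus_numeral_nonzero)
  show ?thesis
  proof (rule poly_pointwise_eqI)
    fix z
    let ?G = "poly (gegen ?n j) z"
    have down: "raise_coeff l j * poly (pderiv (spherical l w (j - 1) k)) z =
      \<i> * (?J * (?L - ?J + 1) * (of_nat w + of_nat k - ?J + 1) * (of_nat w + of_nat k + ?J + 1)) / (2 * (2 * ?J - 1) * (2 * ?J + 1))
        * (if j = 0 then 0 else ?a (j - 1)) * ?G"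
    proof (cases j)
      case 0
      then show ?thesis by (simp add: raise_coeff_def)
    next
      case (Suc i)
      then have "i \<le> ?n" using True by simp
      define I where "I = (of_nat i :: complex)"
      have e: "of_nat (Suc i) = I + 1" "?L - (I + 1) + 1 = ?L - I" "of_nat w + of_nat k - (I + 1) + 1 = ?N - I"
        "of_nat w + of_nat k + (I + 1) + 1 = ?N + I + 2" "2 * (I + 1) - 1 = 2 * I + 1" "2 * (I + 1) + 1 = 2 * I + 3"
        by (simp_all add: I_def)
      have 1: "poly (pderiv (spherical l w i k)) z = ?a i * ((?N - I) * (?N + I + 2) / (2 * I + 3)) * poly (gegen ?n (Suc i)) z"
        unfolding spherical_def pderiv_smult pderiv_gegen[OF \<open>i \<le> ?n\<close>] I_def by simp
      have "\<i> * (b * c) / (2 * d) * (a * (m * n / r) * g) = \<i> * (b * c * m * n) / (2 * d * r) * a * g"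
        for a b c d m n r g :: complex by simp
      then show ?thesis unfolding Suc raise_coeff_def diff_Suc_1 1 e by simp
    qed
    have up: "lower_coeff l j * ((1 - z\<^sup>2) * poly (pderiv (spherical l w (Suc j) k)) z - (2 * ?J + 3) * (z * poly (spherical l w (Suc j) k) z))
       = - \<i> * ((?J + 1) * (?L + ?J + 2)) / 2 * ?a (j + 1) * ?G"
    proof (cases "j < ?n")
      case True
      have "(1 - z\<^sup>2) * poly (pderiv (spherical l w (Suc j) k)) z - (2 * ?J + 3) * (z * poly (spherical l w (Suc j) k) z)
         = ?a (Suc j) * ((1 - z\<^sup>2) * poly (pderiv (gegen ?n (Suc j))) z - (2 * ?J + 3) * z * poly (gegen ?n (Suc j)) z)"
        by (simp add: spherical_def pderiv_smult algebra_simps)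
      also have "\<dots> = ?a (Suc j) * (- (2 * ?J + 3) * ?G)" unfolding gegen_lower[OF True] ..
      finally have *: "(1 - z\<^sup>2) * poly (pderiv (spherical l w (Suc j) k)) z - (2 * ?J + 3) * (z * poly (spherical l w (Suc j) k) z)
         = ?a (Suc j) * (- (2 * ?J + 3) * ?G)" .
      have "\<i> * x / (2 * d) * (a * (- d * g)) = - \<i> * x / 2 * a * g" if "d \<noteq> 0" for x d a g :: complex
        using that by simp
      from this[OF nz] show ?thesis unfolding * lower_coeff_def by simp
    next
      case False
      with assms have "?a (Suc j) = 0" by (intro acoef_eq_0) auto
      then show ?thesis by (simp add: spherical_def)
    qed
    show "poly (Ebar l (\<lambda>j. spherical l w j k) j) z = poly (smult (mu l w k) (spherical l w j k)) z"
    proof -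
      have R: "x * g + - \<i> * s / 2 * t * g - y * (b * g) = (x - y * b - \<i> * s / 2 * t) * g" for x g s t y b :: complex
        by (simp add: algebra_simps)
      show ?thesis
        unfolding poly_Ebar down up spherical_def[of l w j k] poly_smult R acoef_recursion by simp
    qed
  qed
next
  case False
  then have 1: "spherical l w j k = 0" "spherical l w (Suc j) k = 0"
    using assms by (auto intro: spherical_eq_0)
  have "pderiv (spherical l w (j - 1) k) = 0"
  proof (cases "j = Suc (w + k)")
    case True
    then show ?thesis by (simp add: spherical_def gegen_self pderiv_smult)
  next
    case False
    with \<open>\<not> j \<le> w + k\<close> have "w + k < j - 1" by simp
    then show ?thesis using assms by (simp add: spherical_eq_0)
  qed
  with 1 show ?thesis by (simp add: Ebar_def)
qed

abbreviation psi :: "nat \<Rightarrow> nat \<Rightarrow> nat \<Rightarrow> complex poly" where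
  "psi l \<equiv> spherical l 0"

lemma psi_above_diagonal: "k < j \<Longrightarrow> psi l j k = 0"
  by (simp add: spherical_def acoef_0_eq_0)

lemma psi_diagonal: "psi l j j = [:acoef l 0 j j:]"
  by (simp add: spherical_def gegen_self flip: pCons_one)

text \<open>
  This identity conjugates the first order part of \<open>D\<close>. It is the relation that lowers the degree of a Gegenbauer polynomial,
  since \<open>(k - j) a\<^sub>j\<close> in column \<open>k\<close> is \<open>k a\<^sub>j\<close> in column \<open>k - 1\<close>.
\<close>

lemma psi_derivative:
  "(1 - z\<^sup>2) * poly (pderiv (psi l j k)) z + (of_nat k - of_nat j) * z * poly (psi l j k) z
     = of_nat k * poly (psi l j (k - 1)) z"
proof (cases "j \<le> k")
  case True
  have "(1 - z\<^sup>2) * poly (pderiv (psi l j k)) z + (of_nat k - of_nat j) * z * poly (psi l j k) z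
     = acoef l 0 k j * ((1 - z\<^sup>2) * poly (pderiv (gegen k j)) z + (of_nat k - of_nat j) * z * poly (gegen k j) z)"
    by (simp add: spherical_def pderiv_smult algebra_simps)
  also have "\<dots> = (of_nat k - of_nat j) * acoef l 0 k j * poly (gegen (k - 1) j) z"
    unfolding gegen_degree_down[OF True] by simp
  also have "\<dots> = of_nat k * poly (psi l j (k - 1)) z"
  proof (cases k)
    case 0
    then show ?thesis using True by simp
  next
    case (Suc i)
    then show ?thesis using acoef_0_Suc_column[of i j l] by (simp add: spherical_def add.commute)
  qed
  finally show ?thesis .
next
  case False
  then show ?thesis by (simp add: psi_above_diagonal)
qed

lemma psi_pderiv:
  assumes "j \<le> k"
  shows "poly (pderiv (psi l j k)) z
     = \<i> * (2 * of_nat j + 1) * (of_nat k + of_nat j + 2) / (2 * of_nat j + 3) * poly (psi l (Suc j) k) z"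
proof -
  have "(of_nat k - of_nat j) * acoef l 0 k j = \<i> * (2 * of_nat j + 1) * acoef l 0 k (Suc j)"
    unfolding acoef_0_Suc using of_nat_plus_1_nonzero(2)[of j] by simp
  moreover have "poly (pderiv (psi l j k)) z = (of_nat k - of_nat j) * acoef l 0 k j
      * ((of_nat k + of_nat j + 2) / (2 * of_nat j + 3)) * poly (gegen k (Suc j)) z"
    using pderiv_gegen[OF assms] by (simp add: spherical_def pderiv_smult)
  ultimately show ?thesis by (simp add: spherical_def)
qed

lemma psi_lower:
  assumes "i < k"
  shows "(1 - z\<^sup>2) * poly (pderiv (psi l (Suc i) k)) z - (2 * of_nat i + 3) * (z * poly (psi l (Suc i) k) z)
     = \<i> * (2 * of_nat i + 3) * (of_nat k - of_nat i) / (2 * of_nat i + 1) * poly (psi l i k) z"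
proof -
  have "(1 - z\<^sup>2) * poly (pderiv (psi l (Suc i) k)) z - (2 * of_nat i + 3) * (z * poly (psi l (Suc i) k) z)
     = acoef l 0 k (Suc i) * ((1 - z\<^sup>2) * poly (pderiv (gegen k (Suc i))) z - (2 * of_nat i + 3) * z * poly (gegen k (Suc i)) z)"
    by (simp add: spherical_def pderiv_smult algebra_simps)
  also have "\<dots> = acoef l 0 k (Suc i) * (- (2 * of_nat i + 3) * poly (gegen k i) z)"
    unfolding gegen_lower[OF assms] ..
  also have "\<dots> = \<i> * (2 * of_nat i + 3) * (of_nat k - of_nat i) / (2 * of_nat i + 1) * poly (psi l i k) z"
  proof -
    have "- \<i> * c / p * a * (- d * g) = \<i> * d * c / p * (a * g)" for c p a d g :: complex by simp
    then show ?thesis unfolding acoef_0_Suc spherical_def poly_smult add_0 .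
  qed
  finally show ?thesis .
qed

lemma psi_next_column:
  assumes "j \<le> k"
  shows "(of_nat k + 1 - of_nat j) * ((of_nat k + of_nat j + 2) * poly (psi l j (Suc k)) z)
     = (of_nat k + 1) * ((of_nat k + of_nat j + 2) * (z * poly (psi l j k) z) - (1 - z\<^sup>2) * poly (pderiv (psi l j k)) z)"
proof -
  have "(of_nat k + of_nat j + 2) * (z * poly (psi l j k) z) - (1 - z\<^sup>2) * poly (pderiv (psi l j k)) z
    = - acoef l 0 k j * ((1 - z\<^sup>2) * poly (pderiv (gegen k j)) z - (of_nat k + of_nat j + 2) * z * poly (gegen k j) z)"
    by (simp add: spherical_def pderiv_smult algebra_simps)
  also have "\<dots> = acoef l 0 k j * ((of_nat k + of_nat j + 2) * poly (gegen (Suc k) j) z)"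
    unfolding gegen_degree_up[OF assms] by (simp add: algebra_simps)
  finally have 1: "(of_nat k + of_nat j + 2) * (z * poly (psi l j k) z) - (1 - z\<^sup>2) * poly (pderiv (psi l j k)) z
    = acoef l 0 k j * ((of_nat k + of_nat j + 2) * poly (gegen (Suc k) j) z)" .
  have "(of_nat k + 1 - of_nat j) * ((of_nat k + of_nat j + 2) * poly (psi l j (Suc k)) z)
     = (of_nat k + 1 - of_nat j) * acoef l 0 (Suc k) j * ((of_nat k + of_nat j + 2) * poly (gegen (Suc k) j) z)"
    by (simp add: spherical_def)
  then show ?thesis unfolding 1 acoef_0_Suc_column by simp
qed

text \<open>
  This identity conjugates the first order part of \<open>E\<close>. For \<open>j \<le> k\<close> the ladder relations express all five
  entries by \<open>v = u \<Psi>\<^sub>j\<^sub>k\<close> and \<open>d = (1 - u\<^sup>2) \<Psi>\<^sub>j\<^sub>k'\<close>, and one compares the coefficients of \<open>v\<close> and \<open>d\<close>.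
  For \<open>j = k + 1\<close> two diagonal entries of \<open>\<Psi>\<close> are left, and for larger \<open>j\<close> nothing.
\<close>

lemma psi_E_symbol:
  "raise_coeff l j * poly (psi l (j - 1) k) z + lower_coeff l j * ((1 - z\<^sup>2) * poly (psi l (Suc j) k) z)
    = (of_nat l / 2 - of_nat k) * (z * poly (psi l j k) z) + of_nat k / 2 * poly (psi l j (k - 1)) z
      - (of_nat l - of_nat k) / 2 * poly (psi l j (Suc k)) z"
proof (cases "j \<le> k")
  case True
  let ?J = "of_nat j :: complex" and ?K = "of_nat k :: complex" and ?L = "of_nat l :: complex"
  define v where "v = z * poly (psi l j k) z"
  define d where "d = (1 - z\<^sup>2) * poly (pderiv (psi l j k)) z"
  define \<alpha> where "\<alpha> = 2 * ?J + 1"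
  define \<beta> where "\<beta> = ?K + 1 - ?J"
  define \<gamma> where "\<gamma> = ?K + ?J + 2"
  have "of_nat (k - j) + 1 \<noteq> (0::complex)" by (rule of_nat_plus_1_nonzero)
  then have nz: "\<alpha> \<noteq> 0" "\<beta> \<noteq> 0" "\<gamma> \<noteq> 0"
    using True of_nat_plus_1_nonzero(2)[of j] of_nat_plus_numeral_nonzero(3)[where i = k and j = j and v = "num.Bit0 num.One"]
    by (auto simp: \<alpha>_def \<beta>_def \<gamma>_def of_nat_diff algebra_simps)
  have 1: "raise_coeff l j * poly (psi l (j - 1) k) z = ?J * (?L - ?J + 1) / (2 * \<alpha> * \<beta>) * (d - \<alpha> * v)"
  proof (cases j)
    case 0
    then show ?thesis by (simp add: raise_coeff_def)
  next
    case (Suc i)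
    define P where "P = poly (psi l i k) z"
    define \<delta> where "\<delta> = 2 * of_nat i + (1 :: complex)"
    have \<delta>: "\<delta> \<noteq> 0" unfolding \<delta>_def by (rule of_nat_plus_1_nonzero)
    have a: "2 * of_nat i + 3 = \<alpha>" "?K - of_nat i = \<beta>" by (simp_all add: \<alpha>_def \<beta>_def Suc)
    have "i < k" using True Suc by simp
    from psi_lower[OF this, of z l] have "d - \<alpha> * v = \<i> * \<alpha> * \<beta> / \<delta> * P"
      unfolding a d_def v_def Suc P_def \<delta>_def .
    moreover have "raise_coeff l j = \<i> * (?J * (?L - ?J + 1)) / (2 * \<delta>)"
      by (simp add: raise_coeff_def Suc \<delta>_def)
    moreover have "\<i> * x / (2 * \<delta>) * P = x / (2 * \<alpha> * \<beta>) * (\<i> * \<alpha> * \<beta> / \<delta> * P)" for x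
      using nz \<delta> by simp
    ultimately show ?thesis by (simp add: Suc P_def)
  qed
  have 2: "lower_coeff l j * ((1 - z\<^sup>2) * poly (psi l (Suc j) k) z) = (?J + 1) * (?L + ?J + 2) / (2 * \<alpha> * \<gamma>) * d"
  proof -
    define \<delta> where "\<delta> = 2 * ?J + 3"
    have \<delta>: "\<delta> \<noteq> 0" unfolding \<delta>_def by (rule of_nat_plus_numeral_nonzero)
    have d: "d = \<i> * \<alpha> * \<gamma> / \<delta> * ((1 - z\<^sup>2) * poly (psi l (Suc j) k) z)"
      unfolding d_def psi_pderiv[OF True] \<alpha>_def \<gamma>_def \<delta>_def by simp
    have "\<i> * x / (2 * \<delta>) * y = x / (2 * \<alpha> * \<gamma>) * (\<i> * \<alpha> * \<gamma> / \<delta> * y)" for x y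
      using nz \<delta> by simp
    then show ?thesis unfolding lower_coeff_def d \<delta>_def[symmetric] .
  qed
  have 3: "poly (psi l j (Suc k)) z = (?K + 1) / \<beta> * (v - d / \<gamma>)"
  proof -
    have "\<beta> * (\<gamma> * poly (psi l j (Suc k)) z) = (?K + 1) * (\<gamma> * v - d)"
      using psi_next_column[OF True, of l z] unfolding \<beta>_def \<gamma>_def v_def d_def .
    then have "poly (psi l j (Suc k)) z = (?K + 1) * (\<gamma> * v - d) / (\<beta> * \<gamma>)"
      using nz by (simp add: field_simps)
    then show ?thesis using nz by (simp add: field_simps)
  qed
  have 4: "?K * poly (psi l j (k - 1)) z = d + (?K - ?J) * v"
    using psi_derivative[of z l j k] by (simp add: d_def v_def algebra_simps)
  have cv: "- (?J * (?L - ?J + 1)) / (2 * \<beta>) = (?L / 2 - ?K) + (?K - ?J) / 2 - (?L - ?K) * (?K + 1) / (2 * \<beta>)"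
  proof -
    have R: "- x / (2 * \<beta>) = y / 2 - u / (2 * \<beta>)" if "- x = \<beta> * y - u" for x y u
      unfolding that using nz by (simp add: diff_divide_distrib)
    have e: "(?L / 2 - ?K) + (?K - ?J) / 2 = (?L - ?K - ?J) / 2" by (simp add: field_simps)
    show ?thesis unfolding e by (rule R) (simp add: \<beta>_def algebra_simps)
  qed
  have cd: "?J * (?L - ?J + 1) / (2 * \<alpha> * \<beta>) + (?J + 1) * (?L + ?J + 2) / (2 * \<alpha> * \<gamma>)
      = 1 / 2 + (?L - ?K) * (?K + 1) / (2 * \<beta> * \<gamma>)"
  proof -
    have R: "x / (2 * \<alpha> * \<beta>) + y / (2 * \<alpha> * \<gamma>) = 1 / 2 + u / (2 * \<beta> * \<gamma>)" if "x * \<gamma> + y * \<beta> = \<alpha> * \<beta> * \<gamma> + \<alpha> * u" for x y u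
    proof -
      have "x / (2 * \<alpha> * \<beta>) + y / (2 * \<alpha> * \<gamma>) = (x * \<gamma> + y * \<beta>) / (2 * \<alpha> * \<beta> * \<gamma>)"
        using nz by (simp add: add_divide_distrib)
      also have "\<dots> = 1 / 2 + u / (2 * \<beta> * \<gamma>)"
        unfolding that using nz by (simp add: add_divide_distrib)
      finally show ?thesis .
    qed
    show ?thesis by (rule R) (simp add: \<alpha>_def \<beta>_def \<gamma>_def algebra_simps)
  qed
  have "raise_coeff l j * poly (psi l (j - 1) k) z + lower_coeff l j * ((1 - z\<^sup>2) * poly (psi l (Suc j) k) z)
     = (?J * (?L - ?J + 1) / (2 * \<alpha> * \<beta>) + (?J + 1) * (?L + ?J + 2) / (2 * \<alpha> * \<gamma>)) * d
       + (- (?J * (?L - ?J + 1)) / (2 * \<beta>)) * v"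
  proof -
    have "x / (2 * \<alpha> * \<beta>) * (d - \<alpha> * v) + y * d = (x / (2 * \<alpha> * \<beta>) + y) * d + - x / (2 * \<beta>) * v" for x y
      using nz by (simp add: field_simps)
    then show ?thesis unfolding 1 2 .
  qed
  also have "\<dots> = (?L / 2 - ?K) * v + (d + (?K - ?J) * v) / 2 - (?L - ?K) / 2 * ((?K + 1) / \<beta> * (v - d / \<gamma>))"
  proof -
    have "(1 / 2 + x * y / (2 * \<beta> * \<gamma>)) * d + (a + b / 2 - x * y / (2 * \<beta>)) * v
       = a * v + (d + b * v) / 2 - x / 2 * (y / \<beta> * (v - d / \<gamma>))" for a b x y
      using nz by (simp add: field_simps)
    then show ?thesis unfolding cd cv .
  qed
  also have "(d + (?K - ?J) * v) / 2 = ?K / 2 * poly (psi l j (k - 1)) z"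
    unfolding 4[symmetric] by simp
  finally show ?thesis unfolding 3 v_def .
next
  case False
  show ?thesis
  proof (cases "j = Suc k")
    case True
    have "acoef l 0 (Suc k) (Suc k) = - \<i> / (2 * of_nat k + 1) * ((of_nat k + 1) * acoef l 0 k k)"
      using acoef_0_Suc_column[of k k l] by (simp add: acoef_0_Suc)
    moreover have "raise_coeff l (Suc k) = \<i> * ((of_nat k + 1) * (of_nat l - of_nat k)) / (2 * (2 * of_nat k + 1))"
      by (simp add: raise_coeff_def add.commute)
    moreover have "\<i> * (x * y) / (2 * p) * a = - (y / 2 * (- \<i> / p * (x * a)))" for x y p a :: complex
      by simp
    ultimately show ?thesis
      by (simp add: True psi_above_diagonal psi_diagonal)
  next
    case False
    with \<open>\<not> j \<le> k\<close> show ?thesis by (simp add: psi_above_diagonal)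
  qed
qed

section \<open>Conjugation by Psi\<close>

text \<open>
  One column of the product \<open>\<Psi> F\<close>, and the operators \<open>D\<close> and \<open>E\<close> on one column of \<open>F\<close>. The guards cut the
  off-diagonal terms at the border of the matrix, so that only entries with index at most \<open>l\<close> matter.
\<close>

definition psi_apply :: "nat \<Rightarrow> (nat \<Rightarrow> complex poly) \<Rightarrow> nat \<Rightarrow> complex poly" where
  "psi_apply l f j = (\<Sum>m\<le>l. psi l j m * f m)"

definition Dtil :: "nat \<Rightarrow> (nat \<Rightarrow> complex poly) \<Rightarrow> nat \<Rightarrow> complex poly" where
  "Dtil l f j = [:1, 0, - 1:] * pderiv (pderiv (f j)) - smult (2 * of_nat j + 3) ([:0, 1:] * pderiv (f j))
     + (if j < l then smult (2 * (of_nat j + 1)) (pderiv (f (Suc j))) else 0)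
     - smult (of_nat j * (of_nat j + 2)) (f j)"

definition Etil :: "nat \<Rightarrow> (nat \<Rightarrow> complex poly) \<Rightarrow> nat \<Rightarrow> complex poly" where
  "Etil l f j = smult (of_nat l / 2 - of_nat j) ([:0, 1:] * pderiv (f j))
     + (if j < l then smult ((of_nat j + 1) / 2) (pderiv (f (Suc j))) else 0)
     - (case j of 0 \<Rightarrow> 0 | Suc i \<Rightarrow> smult ((of_nat l - of_nat i) / 2) (pderiv (f i)))
     - smult (of_nat j * (of_nat l / 2 + 1)) (f j)"

lemma sum_shift_guarded:
  fixes F :: "nat \<Rightarrow> 'a :: comm_monoid_add"
  shows "(\<Sum>m\<le>l. if m < l then F m else 0) = (\<Sum>m\<le>l. case m of 0 \<Rightarrow> 0 | Suc i \<Rightarrow> F i)"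
proof (cases l)
  case (Suc i)
  have "(\<Sum>m\<le>Suc i. if m < Suc i then F m else 0) = (\<Sum>m\<le>i. F m)" by simp
  also have "\<dots> = (\<Sum>m\<le>Suc i. case m of 0 \<Rightarrow> 0 | Suc i \<Rightarrow> F i)"
    by (subst sum.atMost_Suc_shift) simp
  finally show ?thesis unfolding Suc .
qed simp

lemma psi_Dbar:
  assumes "m \<le> l"
  shows "(1 - z\<^sup>2) * poly (pderiv (pderiv (psi l j m))) z - (2 * of_nat j + 3) * (z * poly (pderiv (psi l j m)) z)
     - of_nat j * (of_nat j + 2) * poly (psi l j m) z = - (of_nat m * (of_nat m + 2)) * poly (psi l j m) z"
  using arg_cong[OF Dbar_spherical[OF assms, of 0 j], of "\<lambda>p. poly p z"]
  unfolding poly_Dbar by (simp add: lambda_def algebra_simps)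

text \<open>
  By the product rule, \<open>D\<close> applied to \<open>\<Psi> F\<close> splits into terms with \<open>F\<close>, \<open>F'\<close> and \<open>F''\<close>. The first match because
  the columns of \<open>\<Psi>\<close> are eigenvectors, the second by \<open>psi_derivative\<close>, the last trivially.
\<close>

lemma Dbar_psi_apply: "Dbar (psi_apply l f) j = psi_apply l (Dtil l f) j"
proof (rule poly_pointwise_eqI)
  fix z
  let ?p = "\<lambda>m. poly (psi l j m) z" and ?p' = "\<lambda>m. poly (pderiv (psi l j m)) z" and ?p'' = "\<lambda>m. poly (pderiv (pderiv (psi l j m))) z"
  let ?f = "\<lambda>m. poly (f m) z" and ?f' = "\<lambda>m. poly (pderiv (f m)) z" and ?f'' = "\<lambda>m. poly (pderiv (pderiv (f m))) z"
  let ?w = "1 - z\<^sup>2"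
  have "poly (Dbar (psi_apply l f) j) z = (\<Sum>m\<le>l. ?w * (?p'' m * ?f m + 2 * (?p' m * ?f' m) + ?p m * ?f'' m)
      - (2 * of_nat j + 3) * (z * (?p' m * ?f m + ?p m * ?f' m)) - of_nat j * (of_nat j + 2) * (?p m * ?f m))"
    unfolding poly_Dbar psi_apply_def
    by (simp add: pderiv_sum pderiv_mult pderiv_add poly_sum sum_distrib_left sum_subtractf algebra_simps)
  also have "\<dots> = (\<Sum>m\<le>l. ?p m * (?w * ?f'' m - (2 * of_nat m + 3) * (z * ?f' m) - of_nat m * (of_nat m + 2) * ?f m)
      + (case m of 0 \<Rightarrow> 0 | Suc i \<Rightarrow> ?p i * (2 * (of_nat i + 1) * ?f' (Suc i))))"
  proof (rule sum.cong[OF refl])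
    fix m assume "m \<in> {..l}"
    then have D: "?w * ?p'' m - (2 * of_nat j + 3) * (z * ?p' m) - of_nat j * (of_nat j + 2) * ?p m = - (of_nat m * (of_nat m + 2)) * ?p m"
      by (intro psi_Dbar) simp
    have A: "?w * ?p' m + (of_nat m - of_nat j) * z * ?p m = of_nat m * ?p (m - 1)" by (rule psi_derivative)
    have c: "(case m of 0 \<Rightarrow> 0 | Suc i \<Rightarrow> ?p i * (2 * (of_nat i + 1) * ?f' (Suc i))) = 2 * (of_nat m * ?p (m - 1)) * ?f' m"
      by (cases m) (simp_all add: algebra_simps)
    have "?w * (?p'' m * ?f m + 2 * (?p' m * ?f' m) + ?p m * ?f'' m)
      - (2 * of_nat j + 3) * (z * (?p' m * ?f m + ?p m * ?f' m)) - of_nat j * (of_nat j + 2) * (?p m * ?f m)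
      = (?w * ?p'' m - (2 * of_nat j + 3) * (z * ?p' m) - of_nat j * (of_nat j + 2) * ?p m) * ?f m
        + 2 * (?w * ?p' m + (of_nat m - of_nat j) * z * ?p m) * ?f' m
        + ?p m * (?w * ?f'' m - (2 * of_nat m + 3) * (z * ?f' m))"
      by (simp add: algebra_simps)
    also have "\<dots> = ?p m * (?w * ?f'' m - (2 * of_nat m + 3) * (z * ?f' m) - of_nat m * (of_nat m + 2) * ?f m)
      + (case m of 0 \<Rightarrow> 0 | Suc i \<Rightarrow> ?p i * (2 * (of_nat i + 1) * ?f' (Suc i)))"
      unfolding D A c by (simp add: algebra_simps)
    finally show "?w * (?p'' m * ?f m + 2 * (?p' m * ?f' m) + ?p m * ?f'' m)
      - (2 * of_nat j + 3) * (z * (?p' m * ?f m + ?p m * ?f' m)) - of_nat j * (of_nat j + 2) * (?p m * ?f m) = \<dots>" .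
  qed
  also have "\<dots> = (\<Sum>m\<le>l. ?p m * (?w * ?f'' m - (2 * of_nat m + 3) * (z * ?f' m) - of_nat m * (of_nat m + 2) * ?f m)
      + (if m < l then ?p m * (2 * (of_nat m + 1) * ?f' (Suc m)) else 0))"
    unfolding sum.distrib sum_shift_guarded ..
  also have "\<dots> = poly (psi_apply l (Dtil l f) j) z"
    unfolding psi_apply_def poly_sum
    by (rule sum.cong) (simp_all add: Dtil_def algebra_simps power2_eq_square)
  finally show "poly (Dbar (psi_apply l f) j) z = poly (psi_apply l (Dtil l f) j) z" .
qed

lemma psi_Ebar:
  assumes "m \<le> l"
  shows "raise_coeff l j * poly (pderiv (psi l (j - 1) m)) z
    + lower_coeff l j * ((1 - z\<^sup>2) * poly (pderiv (psi l (Suc j) m)) z - (2 * of_nat j + 3) * (z * poly (psi l (Suc j) m) z))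
    - of_nat j * (of_nat j + 1) / 2 * poly (psi l j m) z = - (of_nat m * (of_nat l / 2 + 1)) * poly (psi l j m) z"
  using arg_cong[OF Ebar_spherical[OF assms, of 0 j], of "\<lambda>p. poly p z"]
  unfolding poly_Ebar by (simp add: mu_def)

lemma Ebar_psi_apply: "Ebar l (psi_apply l f) j = psi_apply l (Etil l f) j"
proof (rule poly_pointwise_eqI)
  fix z
  let ?p = "\<lambda>j m. poly (psi l j m) z" and ?p' = "\<lambda>j m. poly (pderiv (psi l j m)) z"
  let ?f = "\<lambda>m. poly (f m) z" and ?f' = "\<lambda>m. poly (pderiv (f m)) z"
  let ?w = "1 - z\<^sup>2"
  have "poly (Ebar l (psi_apply l f) j) z = (\<Sum>m\<le>l. raise_coeff l j * (?p' (j - 1) m * ?f m + ?p (j - 1) m * ?f' m)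
      + lower_coeff l j * (?w * (?p' (Suc j) m * ?f m + ?p (Suc j) m * ?f' m) - (2 * of_nat j + 3) * (z * (?p (Suc j) m * ?f m)))
      - of_nat j * (of_nat j + 1) / 2 * (?p j m * ?f m))"
    unfolding poly_Ebar psi_apply_def
    by (simp add: pderiv_sum pderiv_mult pderiv_add poly_sum sum_distrib_left sum_subtractf sum.distrib algebra_simps)
  also have "\<dots> = (\<Sum>m\<le>l. ?p j m * ((of_nat l / 2 - of_nat m) * (z * ?f' m) - of_nat m * (of_nat l / 2 + 1) * ?f m)
      + (case m of 0 \<Rightarrow> 0 | Suc i \<Rightarrow> ?p j i * ((of_nat i + 1) / 2 * ?f' (Suc i)))
      - (if m < l then ?p j (Suc m) * ((of_nat l - of_nat m) / 2 * ?f' m) else 0))"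
  proof (rule sum.cong[OF refl])
    fix m assume m: "m \<in> {..l}"
    then have E: "raise_coeff l j * ?p' (j - 1) m + lower_coeff l j * (?w * ?p' (Suc j) m - (2 * of_nat j + 3) * (z * ?p (Suc j) m))
      - of_nat j * (of_nat j + 1) / 2 * ?p j m = - (of_nat m * (of_nat l / 2 + 1)) * ?p j m"
      by (intro psi_Ebar) simp
    have B: "raise_coeff l j * ?p (j - 1) m + lower_coeff l j * (?w * ?p (Suc j) m)
      = (of_nat l / 2 - of_nat m) * (z * ?p j m) + of_nat m / 2 * ?p j (m - 1) - (of_nat l - of_nat m) / 2 * ?p j (Suc m)"
      by (rule psi_E_symbol)
    have c: "(case m of 0 \<Rightarrow> 0 | Suc i \<Rightarrow> ?p j i * ((of_nat i + 1) / 2 * ?f' (Suc i))) = of_nat m / 2 * ?p j (m - 1) * ?f' m"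
      by (cases m) (simp_all add: algebra_simps)
    have d: "(if m < l then ?p j (Suc m) * ((of_nat l - of_nat m) / 2 * ?f' m) else 0) = (of_nat l - of_nat m) / 2 * ?p j (Suc m) * ?f' m"
      using m by (cases "m = l") simp_all
    have "raise_coeff l j * (?p' (j - 1) m * ?f m + ?p (j - 1) m * ?f' m)
      + lower_coeff l j * (?w * (?p' (Suc j) m * ?f m + ?p (Suc j) m * ?f' m) - (2 * of_nat j + 3) * (z * (?p (Suc j) m * ?f m)))
      - of_nat j * (of_nat j + 1) / 2 * (?p j m * ?f m)
      = (raise_coeff l j * ?p' (j - 1) m + lower_coeff l j * (?w * ?p' (Suc j) m - (2 * of_nat j + 3) * (z * ?p (Suc j) m))
        - of_nat j * (of_nat j + 1) / 2 * ?p j m) * ?f m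
        + (raise_coeff l j * ?p (j - 1) m + lower_coeff l j * (?w * ?p (Suc j) m)) * ?f' m"
      by (simp add: algebra_simps)
    also have "\<dots> = ?p j m * ((of_nat l / 2 - of_nat m) * (z * ?f' m) - of_nat m * (of_nat l / 2 + 1) * ?f m)
      + (case m of 0 \<Rightarrow> 0 | Suc i \<Rightarrow> ?p j i * ((of_nat i + 1) / 2 * ?f' (Suc i)))
      - (if m < l then ?p j (Suc m) * ((of_nat l - of_nat m) / 2 * ?f' m) else 0)"
      unfolding E B c d by (simp add: algebra_simps)
    finally show "raise_coeff l j * (?p' (j - 1) m * ?f m + ?p (j - 1) m * ?f' m)
      + lower_coeff l j * (?w * (?p' (Suc j) m * ?f m + ?p (Suc j) m * ?f' m) - (2 * of_nat j + 3) * (z * (?p (Suc j) m * ?f m)))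
      - of_nat j * (of_nat j + 1) / 2 * (?p j m * ?f m) = \<dots>" .
  qed
  also have "\<dots> = (\<Sum>m\<le>l. ?p j m * ((of_nat l / 2 - of_nat m) * (z * ?f' m) - of_nat m * (of_nat l / 2 + 1) * ?f m)
      + (if m < l then ?p j m * ((of_nat m + 1) / 2 * ?f' (Suc m)) else 0)
      - (case m of 0 \<Rightarrow> 0 | Suc i \<Rightarrow> ?p j (Suc i) * ((of_nat l - of_nat i) / 2 * ?f' i)))"
    unfolding sum.distrib sum_subtractf sum_shift_guarded ..
  also have "\<dots> = poly (psi_apply l (Etil l f) j) z"
    unfolding psi_apply_def poly_sum
  proof (rule sum.cong[OF refl])
    fix m
    show "?p j m * ((of_nat l / 2 - of_nat m) * (z * ?f' m) - of_nat m * (of_nat l / 2 + 1) * ?f m)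
      + (if m < l then ?p j m * ((of_nat m + 1) / 2 * ?f' (Suc m)) else 0)
      - (case m of 0 \<Rightarrow> 0 | Suc i \<Rightarrow> ?p j (Suc i) * ((of_nat l - of_nat i) / 2 * ?f' i)) = poly (psi l j m * Etil l f m) z"
      by (cases m) (simp_all add: Etil_def right_diff_distrib distrib_left)
  qed
  finally show "poly (Ebar l (psi_apply l f) j) z = poly (psi_apply l (Etil l f) j) z" .
qed

section \<open>Symmetry in the spherical picture\<close>

definition cnj_poly :: "complex poly \<Rightarrow> complex poly" where
  "cnj_poly p = map_poly cnj p"

lemma coeff_cnj_poly [simp]: "coeff (cnj_poly p) n = cnj (coeff p n)"
  by (simp add: cnj_poly_def coeff_map_poly)

lemma cnj_poly_simps [simp]:
  "cnj_poly (p + q) = cnj_poly p + cnj_poly q"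
  "cnj_poly (p - q) = cnj_poly p - cnj_poly q"
  "cnj_poly (- p) = - cnj_poly p"
  "cnj_poly 0 = 0"
  "cnj_poly (smult c p) = smult (cnj c) (cnj_poly p)"
  "cnj_poly (p * q) = cnj_poly p * cnj_poly q"
  "cnj_poly (pderiv p) = pderiv (cnj_poly p)"
  "cnj_poly (pCons c p) = pCons (cnj c) (cnj_poly p)"
  by (rule poly_eqI; simp add: coeff_mult coeff_pderiv coeff_pCons split: nat.split)+

lemma poly_cnj_poly: "poly (cnj_poly p) (of_real u) = cnj (poly p (of_real u))"
  by (induction p) simp_all

lemma cheb_int_0 [simp]: "cheb_int 0 = 0"
  using cheb_int_smult[of 0 0] by simp

lemma cheb_int_diff: "cheb_int (p - q) = cheb_int p - cheb_int q"
  using cheb_int_add[of "p - q" q] by simp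

lemma cheb_int_weighted_derivative:
  "cheb_int ([:1, 0, - 1:] ^ m * ([:1, 0, - 1:] * pderiv p - smult (2 * of_nat m + 3) ([:0, 1:] * p))) = 0"
proof -
  let ?w = "[:1, 0, - 1:] :: complex poly"
  have "?w * pderiv (?w ^ m) = - smult (2 * of_nat m) ([:0, 1:] * ?w ^ m)"
  proof (cases m)
    case (Suc i)
    have "pderiv ?w = smult (- 2) [:0, 1:]" by (simp add: pderiv_pCons)
    then show ?thesis unfolding Suc pderiv_power_Suc
      by (intro poly_pointwise_eqI) (simp add: algebra_simps)
  qed simp
  then have w: "?w * pderiv (?w ^ m) * p = - smult (2 * of_nat m) ([:0, 1:] * ?w ^ m) * p" by simp
  have "?w * pderiv (?w ^ m * p) - [:0, 3:] * (?w ^ m * p) = ?w ^ m * (?w * pderiv p) + ?w * pderiv (?w ^ m) * p - [:0, 3:] * (?w ^ m * p)"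
    unfolding pderiv_mult by (simp only: algebra_simps)
  also have "\<dots> = ?w ^ m * (?w * pderiv p - smult (2 * of_nat m + 3) ([:0, 1:] * p))"
    unfolding w by (rule poly_pointwise_eqI) (simp add: algebra_simps)
  finally have "?w ^ m * (?w * pderiv p - smult (2 * of_nat m + 3) ([:0, 1:] * p)) = ?w * pderiv (?w ^ m * p) - [:0, 3:] * (?w ^ m * p)" ..
  then show ?thesis using cheb_int_total_derivative[of "?w ^ m * p"] by simp
qed

text \<open>
  The inner product of two columns in the spherical picture, without the factor \<open>2 / \<pi>\<close>. Conjugation acts on the
  coefficients, which agrees with complex conjugation of the values because the variable is real.
\<close>

definition bar_form :: "nat \<Rightarrow> (nat \<Rightarrow> complex poly) \<Rightarrow> (nat \<Rightarrow> complex poly) \<Rightarrow> complex" where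
  "bar_form l f g = (\<Sum>j\<le>l. hahn_norm l j * cheb_int ([:1, 0, - 1:] ^ j * (cnj_poly (f j) * g j)))"

lemma bar_form_smult_left: "bar_form l (\<lambda>j. smult c (f j)) g = cnj c * bar_form l f g"
  by (simp add: bar_form_def cheb_int_smult sum_distrib_left mult_ac)

lemma bar_form_smult_right: "bar_form l f (\<lambda>j. smult c (g j)) = c * bar_form l f g"
  by (simp add: bar_form_def cheb_int_smult sum_distrib_left mult_ac)

text \<open>
  In each row the difference of the two sides is the integral of a total derivative.
\<close>

lemma Dbar_symmetric: "bar_form l (Dbar f) g = bar_form l f (Dbar g)"
  unfolding bar_form_def
proof (rule sum.cong[OF refl])
  fix j
  let ?w = "[:1, 0, - 1:] :: complex poly" and ?F = "cnj_poly (f j)" and ?G = "g j"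
  have F: "cnj_poly (Dbar f j) = ?w * pderiv (pderiv ?F) - smult (2 * of_nat j + 3) ([:0, 1:] * pderiv ?F) - smult (of_nat j * (of_nat j + 2)) ?F"
    by (simp add: Dbar_def)
  \<comment> \<open>The Wronskian of the two polynomials.\<close>
  let ?p = "pderiv ?F * ?G - ?F * pderiv ?G"
  have "?w ^ j * (cnj_poly (Dbar f j) * ?G) - ?w ^ j * (?F * Dbar g j)
     = ?w ^ j * (?w * pderiv ?p - smult (2 * of_nat j + 3) ([:0, 1:] * ?p))"
    unfolding F unfolding Dbar_def
    by (rule poly_pointwise_eqI) (simp add: pderiv_mult pderiv_diff algebra_simps)
  then have "cheb_int (?w ^ j * (cnj_poly (Dbar f j) * ?G)) - cheb_int (?w ^ j * (?F * Dbar g j)) = 0"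
    unfolding cheb_int_diff[symmetric] by (simp only: cheb_int_weighted_derivative)
  then show "hahn_norm l j * cheb_int (?w ^ j * (cnj_poly (Dbar f j) * ?G)) = hahn_norm l j * cheb_int (?w ^ j * (?F * Dbar g j))"
    by simp
qed

text \<open>
  The compatibility between the norms of the discrete Chebyshev polynomials and the coefficients of \<open>E\<close>
  which makes \<open>E\<close> symmetric.
\<close>

lemma raise_coeff_hahn_norm:
  assumes "j < l"
  shows "hahn_norm l (Suc j) * raise_coeff l (Suc j) = hahn_norm l j * lower_coeff l j"
proof -
  let ?J = "of_nat j :: complex" and ?L = "of_nat l :: complex"
  have nz: "2 * ?J + 1 \<noteq> 0" "2 * ?J + 3 \<noteq> 0"
    by (rule of_nat_plus_1_nonzero of_nat_plus_numeral_nonzero)+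
  have p: "raise_coeff l (Suc j) = \<i> * ((?J + 1) * (?L - ?J)) / (2 * (2 * ?J + 1))"
    by (simp add: raise_coeff_def algebra_simps)
  have "h' * (\<i> * (x * a) / (2 * c)) = h * (\<i> * (x * b) / (2 * d))"
    if "d * a * h' = c * b * h" "c \<noteq> 0" "d \<noteq> 0" for h h' x a b c d :: complex
  proof -
    have "h' * (\<i> * (x * a) / (2 * c)) = \<i> * x * (d * a * h') / (2 * c * d)" using that by (simp add: field_simps)
    also have "\<dots> = h * (\<i> * (x * b) / (2 * d))" unfolding that(1) using that by (simp add: field_simps)
    finally show ?thesis .
  qed
  from this[OF hahn_norm_Suc nz, of l "?J + 1"] assms show ?thesis
    unfolding p lower_coeff_def by (simp add: add_ac)
qed

text \<open>
  The two coefficients are imaginary, so the diagonal part cancels and the others change sign under conjugation.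
  The raising term of row \<open>j + 1\<close> and the lowering term of row \<open>j\<close> then carry the same factor and add
  up to a total derivative: \<open>P j + Q j = 0\<close> in the proof. The hypothesis removes the lowering term of row \<open>l\<close>.
\<close>

lemma Ebar_symmetric:
  assumes "f (Suc l) = 0" "g (Suc l) = 0"
  shows "bar_form l (Ebar l f) g = bar_form l f (Ebar l g)"
proof -
  let ?w = "[:1, 0, - 1:] :: complex poly" and ?F = "\<lambda>j. cnj_poly (f j)" and ?u = "[:0, 1:] :: complex poly"
  define P where "P j = cheb_int (?w ^ Suc j * (pderiv (?F j) * g (Suc j) + ?F (Suc j) * pderiv (g j)))" for j
  define Q where "Q j = cheb_int (?w ^ j * ((?w * pderiv (?F (Suc j)) - smult (2 * of_nat j + 3) (?u * ?F (Suc j))) * g j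
     + ?F j * (?w * pderiv (g (Suc j)) - smult (2 * of_nat j + 3) (?u * g (Suc j)))))" for j
  have PQ: "P j + Q j = 0" for j
  proof -
    let ?p = "?F j * g (Suc j) + ?F (Suc j) * g j"
    have "?w ^ Suc j * (pderiv (?F j) * g (Suc j) + ?F (Suc j) * pderiv (g j)) + ?w ^ j * ((?w * pderiv (?F (Suc j)) - smult (2 * of_nat j + 3) (?u * ?F (Suc j))) * g j
     + ?F j * (?w * pderiv (g (Suc j)) - smult (2 * of_nat j + 3) (?u * g (Suc j))))
     = ?w ^ j * (?w * pderiv ?p - smult (2 * of_nat j + 3) (?u * ?p))"
      by (rule poly_pointwise_eqI) (simp add: pderiv_mult pderiv_add algebra_simps)
    then show ?thesis unfolding P_def Q_def cheb_int_add[symmetric] by (simp only: cheb_int_weighted_derivative)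
  qed
  have Ql: "Q l = 0" by (simp add: Q_def assms)
  have cp: "cnj (raise_coeff l j) = - raise_coeff l j" and cq: "cnj (lower_coeff l j) = - lower_coeff l j" for j
    by (simp_all add: raise_coeff_def lower_coeff_def)
  have "bar_form l f (Ebar l g) - bar_form l (Ebar l f) g
    = (\<Sum>j\<le>l. (case j of 0 \<Rightarrow> 0 | Suc i \<Rightarrow> hahn_norm l (Suc i) * raise_coeff l (Suc i) * P i) + hahn_norm l j * lower_coeff l j * Q j)"
    unfolding bar_form_def sum_subtractf[symmetric]
  proof (rule sum.cong[OF refl])
    fix j
    have F: "cnj_poly (Ebar l f j) = smult (- raise_coeff l j) (pderiv (?F (j - 1)))
      + smult (- lower_coeff l j) (?w * pderiv (?F (Suc j)) - smult (2 * of_nat j + 3) (?u * ?F (Suc j)))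
      - smult (of_nat j * (of_nat j + 1) / 2) (?F j)"
      unfolding Ebar_def cnj_poly_simps cp cq by simp
    have "?w ^ j * (?F j * Ebar l g j) - ?w ^ j * (cnj_poly (Ebar l f j) * g j)
      = smult (raise_coeff l j) (?w ^ j * (pderiv (?F (j - 1)) * g j + ?F j * pderiv (g (j - 1))))
        + smult (lower_coeff l j) (?w ^ j * ((?w * pderiv (?F (Suc j)) - smult (2 * of_nat j + 3) (?u * ?F (Suc j))) * g j
     + ?F j * (?w * pderiv (g (Suc j)) - smult (2 * of_nat j + 3) (?u * g (Suc j)))))"
      unfolding F unfolding Ebar_def by (rule poly_pointwise_eqI) (simp add: algebra_simps)
    then have e: "cheb_int (?w ^ j * (?F j * Ebar l g j)) - cheb_int (?w ^ j * (cnj_poly (Ebar l f j) * g j))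
      = raise_coeff l j * cheb_int (?w ^ j * (pderiv (?F (j - 1)) * g j + ?F j * pderiv (g (j - 1)))) + lower_coeff l j * Q j"
      unfolding cheb_int_diff[symmetric] Q_def by (simp only: cheb_int_add cheb_int_smult)
    have "raise_coeff l j * cheb_int (?w ^ j * (pderiv (?F (j - 1)) * g j + ?F j * pderiv (g (j - 1))))
      = (case j of 0 \<Rightarrow> 0 | Suc i \<Rightarrow> raise_coeff l (Suc i) * P i)"
      by (cases j) (simp_all add: P_def raise_coeff_def del: power_Suc)
    with e have "hahn_norm l j * cheb_int (?w ^ j * (?F j * Ebar l g j)) - hahn_norm l j * cheb_int (?w ^ j * (cnj_poly (Ebar l f j) * g j))
      = hahn_norm l j * ((case j of 0 \<Rightarrow> 0 | Suc i \<Rightarrow> raise_coeff l (Suc i) * P i) + lower_coeff l j * Q j)"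
      by (simp only: right_diff_distrib[symmetric])
    also have "\<dots> = (case j of 0 \<Rightarrow> 0 | Suc i \<Rightarrow> hahn_norm l (Suc i) * raise_coeff l (Suc i) * P i) + hahn_norm l j * lower_coeff l j * Q j"
      by (cases j) (simp_all add: algebra_simps)
    finally show "hahn_norm l j * cheb_int (?w ^ j * (?F j * Ebar l g j)) - hahn_norm l j * cheb_int (?w ^ j * (cnj_poly (Ebar l f j) * g j)) = \<dots>" .
  qed
  also have "\<dots> = (\<Sum>j\<le>l. if j < l then hahn_norm l (Suc j) * raise_coeff l (Suc j) * P j else 0) + (\<Sum>j\<le>l. hahn_norm l j * lower_coeff l j * Q j)"
    unfolding sum.distrib sum_shift_guarded ..
  also have "\<dots> = (\<Sum>j\<le>l. hahn_norm l j * lower_coeff l j * (if j < l then P j + Q j else 0))"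
    unfolding sum.distrib[symmetric]
  proof (rule sum.cong[OF refl])
    fix j assume "j \<in> {..l}"
    then show "(if j < l then hahn_norm l (Suc j) * raise_coeff l (Suc j) * P j else 0) + hahn_norm l j * lower_coeff l j * Q j
      = hahn_norm l j * lower_coeff l j * (if j < l then P j + Q j else 0)"
      using Ql by (cases "j = l") (simp_all add: raise_coeff_hahn_norm algebra_simps)
  qed
  also have "\<dots> = 0" by (simp add: PQ)
  finally show ?thesis by simp
qed

section \<open>Joint eigenvectors: degree and orthogonality\<close>

text \<open>
  For fixed \<open>n = w + k\<close> the quadratic of \<open>mu_eq\<close> takes equal values only at points with sum \<open>n + l + 1\<close>, which is out
  of range.
\<close>

lemma mu_inj:
  assumes "j \<le> l" "k \<le> l" "w + k = v + j" "mu l v j = mu l w k"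
  shows "j = k"
proof (rule ccontr)
  assume "j \<noteq> k"
  let ?J = "of_nat j :: complex" and ?K = "of_nat k :: complex" and ?N = "of_nat (w + k) :: complex" and ?L = "of_nat l :: complex"
  have "?J * (?J - ?N - ?L - 1) = ?K * (?K - ?N - ?L - 1)"
    using assms(4) unfolding mu_eq assms(3)[symmetric] by simp
  then have "(?J - ?K) * (?J + ?K - ?N - ?L - 1) = 0" by (simp add: algebra_simps)
  then have "?J = ?K \<or> ?J + ?K - ?N - ?L - 1 = 0" by (simp only: mult_eq_0_iff right_minus_eq)
  with \<open>j \<noteq> k\<close> have "?J + ?K = ?N + ?L + 1" by (simp add: algebra_simps)
  then have "of_nat (j + k) = (of_nat (w + k + l + 1) :: complex)" by simp
  then have "j + k = w + k + l + 1" by (simp only: of_nat_eq_iff)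
  then show False using assms(1) by simp
qed

lemma lambda_inj: "lambda w k = lambda v j \<Longrightarrow> w + k = v + j"
proof -
  assume "lambda w k = lambda v j"
  then have "(w + k) * (w + k + 2) = (v + j) * (v + j + 2)"
    unfolding lambda_def by (simp only: neg_equal_iff_equal of_nat_eq_iff)
  moreover have "a * (a + 2) < b * (b + 2)" if "a < b" for a b :: nat
    using that by (intro mult_strict_mono) auto
  ultimately show ?thesis by (metis linorder_neqE_nat order_less_irrefl)
qed

lemma coeff_weight_mult: "coeff ([:1, 0, - 1:] * p) n = coeff p n - (case n of Suc (Suc m) \<Rightarrow> coeff p m | _ \<Rightarrow> (0::complex))"
  by (auto simp: coeff_pCons split: nat.splits)

text \<open>
  Let \<open>d\<close> be the highest degree that occurs in a joint eigenvector \<open>f\<close>. On the coefficients of degree \<open>d\<close> both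
  operators act diagonally, with the eigenvalues \<open>\<lambda>\<^sub>d(j)\<close> and \<open>\<mu>\<^sub>d(j)\<close> in row \<open>j\<close>. As the pair determines
  \<open>(d, j)\<close>, the only nonzero coefficient of degree \<open>d\<close> is in row \<open>k\<close>, and \<open>d = w\<close>.
\<close>

lemma eigenvector_degree:
  assumes k: "k \<le> l"
    and D: "\<And>j. j \<le> l \<Longrightarrow> Dtil l f j = smult (lambda w k) (f j)"
    and E: "\<And>j. j \<le> l \<Longrightarrow> Etil l f j = smult (mu l w k) (f j)"
    and nz: "\<exists>j\<le>l. f j \<noteq> 0"
  shows "\<And>j d. j \<le> l \<Longrightarrow> w < d \<Longrightarrow> coeff (f j) d = 0"
    and "coeff (f k) w \<noteq> 0"
    and "\<And>j. j \<le> l \<Longrightarrow> j \<noteq> k \<Longrightarrow> coeff (f j) w = 0"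
proof -
  have top: "d = w \<and> j = k" if j: "j \<le> l" and c: "coeff (f j) d \<noteq> 0" and above: "\<And>i e. i \<le> l \<Longrightarrow> d < e \<Longrightarrow> coeff (f i) e = 0" for j d
  proof -
    let ?c = "coeff (f j) d" and ?J = "of_nat j :: complex" and ?d = "of_nat d :: complex"
    have u: "coeff ([:0, 1:] * pderiv p) d = of_nat d * coeff p d" for p :: "complex poly"
      by (cases d) (simp_all add: coeff_pCons coeff_pderiv)
    have w: "coeff ([:1, 0, - 1:] * pderiv (pderiv (f j))) d = - (?d * (?d - 1)) * ?c"
      unfolding coeff_weight_mult using above[OF j, of "Suc (Suc d)"]
      by (auto simp: coeff_pderiv algebra_simps split: nat.splits)
    have "coeff (Dtil l f j) d = - (?d * (?d - 1)) * ?c - (2 * ?J + 3) * (?d * ?c) - ?J * (?J + 2) * ?c"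
      unfolding Dtil_def using above[of "Suc j" "Suc d"]
      by (simp add: u w coeff_pderiv del: mult_pCons_left mult_pCons_right)
    also have "\<dots> = lambda d j * ?c"
      by (simp add: lambda_def algebra_simps)
    finally have "lambda d j * ?c = lambda w k * ?c"
      using D[OF j] by (metis coeff_smult)
    then have n: "w + k = d + j" using c lambda_inj[of w k d j] by simp
    have "coeff (Etil l f j) d = (of_nat l / 2 - ?J) * (?d * ?c) - ?J * (of_nat l / 2 + 1) * ?c"
      unfolding Etil_def using above[of "Suc j" "Suc d"] above[of "j - 1" "Suc d"] j
      by (cases j) (simp_all add: u coeff_pderiv del: mult_pCons_left mult_pCons_right)
    also have "\<dots> = mu l d j * ?c" by (simp add: mu_def algebra_simps)
    finally have "mu l d j * ?c = mu l w k * ?c" using E[OF j] by (metis coeff_smult)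
    then have "mu l d j = mu l w k" using c by simp
    from mu_inj[OF j k n this] n show ?thesis by simp
  qed
  define S where "S = {d. \<exists>j\<le>l. coeff (f j) d \<noteq> 0}"
  have "S \<subseteq> (\<Union>j\<le>l. {d. d \<le> degree (f j)})" by (auto simp: S_def dest: le_degree)
  then have fin: "finite S" by (rule finite_subset) simp
  have ne: "S \<noteq> {}" using nz by (auto simp: S_def poly_eq_iff)
  define N where "N = Max S"
  have "N \<in> S" unfolding N_def using fin ne by (rule Max_in)
  then obtain j where j: "j \<le> l" "coeff (f j) N \<noteq> 0" by (auto simp: S_def)
  have above: "coeff (f i) e = 0" if "i \<le> l" "N < e" for i e
    using Max_ge[OF fin, of e] that unfolding N_def[symmetric] by (auto simp: S_def)
  from top[OF j above] have N: "N = w" "j = k" by auto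
  show "\<And>j d. j \<le> l \<Longrightarrow> w < d \<Longrightarrow> coeff (f j) d = 0" using above unfolding N .
  show "coeff (f k) w \<noteq> 0" using j unfolding N by simp
  show "coeff (f j) w = 0" if "j \<le> l" "j \<noteq> k" for j
    using top[OF that(1), of w] above that(2) unfolding N by blast
qed

lemma spherical_orthogonal:
  assumes "k \<le> l" "k' \<le> l" "(w, k) \<noteq> (w', k')"
  shows "bar_form l (\<lambda>j. spherical l w j k) (\<lambda>j. spherical l w' j k') = 0"
proof -
  let ?f = "\<lambda>j. spherical l w j k" and ?g = "\<lambda>j. spherical l w' j k'"
  have D: "Dbar ?f = (\<lambda>j. smult (lambda w k) (?f j))" "Dbar ?g = (\<lambda>j. smult (lambda w' k') (?g j))"
    and E: "Ebar l ?f = (\<lambda>j. smult (mu l w k) (?f j))" "Ebar l ?g = (\<lambda>j. smult (mu l w' k') (?g j))"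
    using assms by (simp_all add: fun_eq_iff Dbar_spherical Ebar_spherical)
  have "cnj (lambda w k) * bar_form l ?f ?g = lambda w' k' * bar_form l ?f ?g"
    using Dbar_symmetric[of l ?f ?g]
    by (simp only: D bar_form_smult_left bar_form_smult_right)
  moreover have "cnj (lambda w k) = lambda w k" by (simp add: lambda_def)
  ultimately have 1: "lambda w k = lambda w' k' \<or> bar_form l ?f ?g = 0"
    by auto
  have "cnj (mu l w k) * bar_form l ?f ?g = mu l w' k' * bar_form l ?f ?g"
    using Ebar_symmetric[of ?f l ?g] assms
    by (simp add: E bar_form_smult_left bar_form_smult_right spherical_eq_0)
  moreover have "cnj (mu l w k) = mu l w k" by (simp add: mu_def)
  ultimately have 2: "mu l w k = mu l w' k' \<or> bar_form l ?f ?g = 0"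
    by auto
  show ?thesis
  proof (rule ccontr)
    assume "bar_form l ?f ?g \<noteq> 0"
    with 1 2 have "lambda w k = lambda w' k'" "mu l w k = mu l w' k'" by auto
    then have "w + k = w' + k'" "k = k'"
      using lambda_inj[of w k w' k'] mu_inj[of k l k' w' w] assms by auto
    with assms(3) show False by simp
  qed
qed

lemma psi_apply_inj:
  assumes "\<And>j. j \<le> l \<Longrightarrow> psi_apply l f j = psi_apply l g j" "j \<le> l"
  shows "f j = g j"
  using assms(2)
proof (induction "l - j" arbitrary: j rule: less_induct)
  case less
  let ?h = "\<lambda>m. f m - g m"
  have "0 = (\<Sum>m\<le>l. psi l j m * ?h m)"
    using assms(1)[OF less.prems] by (simp add: psi_apply_def sum_subtractf right_diff_distrib)
  also have "\<dots> = (\<Sum>m\<in>{j}. psi l j m * ?h m)"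
  proof (rule sum.mono_neutral_right)
    show "\<forall>i\<in>{..l} - {j}. psi l j i * ?h i = 0"
    proof
      fix i assume i: "i \<in> {..l} - {j}"
      show "psi l j i * ?h i = 0"
        using i less.hyps[of i] by (cases "i < j") (auto simp: psi_above_diagonal)
    qed
  qed (use less.prems in auto)
  finally show ?case
    using acoef_0_neq_0[of j j l] by (simp add: psi_diagonal)
qed

text \<open>
  Back substitution: \<open>\<Psi>\<close> is upper triangular and its diagonal entries are nonzero constants. The induction solves
  the last \<open>d\<close> equations.
\<close>

lemma psi_apply_surj: "\<exists>f. \<forall>j\<le>l. psi_apply l f j = g j"
proof -
  have "\<exists>f. \<forall>j\<le>l. l < j + d \<longrightarrow> psi_apply l f j = g j" for d
  proof (induction d)
    case 0
    then show ?case by auto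
  next
    case (Suc d)
    then obtain f where f: "\<And>j. j \<le> l \<Longrightarrow> l < j + d \<Longrightarrow> psi_apply l f j = g j" by blast
    show ?case
    proof (cases "d \<le> l")
      case False
      then show ?thesis using f by (intro exI[of _ f]) auto
    next
      case True
      define i where "i = l - d"
      let ?h = "smult (1 / acoef l 0 i i) (g i - psi_apply l f i)"
      have upd: "psi_apply l (f(i := f i + ?h)) j = psi_apply l f j + psi l j i * ?h" for j
      proof -
        have "psi_apply l (f(i := f i + ?h)) j = (\<Sum>m\<le>l. psi l j m * f m + (if m = i then psi l j i * ?h else 0))"
          unfolding psi_apply_def by (rule sum.cong) (simp_all add: algebra_simps)
        also have "\<dots> = psi_apply l f j + psi l j i * ?h"
          unfolding psi_apply_def sum.distrib by (simp add: i_def)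
        finally show ?thesis .
      qed
      have "psi_apply l (f(i := f i + ?h)) j = g j" if j: "j \<le> l" "l < j + Suc d" for j
      proof (cases "j = i")
        case True
        then show ?thesis unfolding upd using acoef_0_neq_0[of i i l] by (simp add: psi_diagonal)
      next
        case False
        with j True have "i < j" "l < j + d" by (auto simp: i_def)
        then show ?thesis unfolding upd using f[OF j(1)] by (simp add: psi_above_diagonal)
      qed
      then show ?thesis by blast
    qed
  qed
  from this[of "Suc l"] show ?thesis by simp
qed

section \<open>Matrices with polynomial entries\<close>

text \<open>
  The bridge between matrix valued functions and families of polynomials. The operators of the
  theorem are computed on the latter, column by column.
\<close>

definition poly_mat :: "nat \<Rightarrow> (nat \<Rightarrow> nat \<Rightarrow> complex poly) \<Rightarrow> real \<Rightarrow> complex mat" where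
  "poly_mat l f u = mat (l + 1) (l + 1) (\<lambda>(j, k). poly (f j k) (of_real u))"

lemma poly_mat_carrier [simp]: "poly_mat l f u \<in> carrier_mat (l + 1) (l + 1)"
  by (simp add: poly_mat_def)

lemma poly_mat_carrier_Suc [simp]: "poly_mat l f u \<in> carrier_mat (Suc l) (Suc l)"
  by (simp add: poly_mat_def)

lemma poly_mat_index: "j \<le> l \<Longrightarrow> k \<le> l \<Longrightarrow> poly_mat l f u $$ (j, k) = poly (f j k) (of_real u)"
  by (simp add: poly_mat_def)

lemma poly_mat_cong: "(\<And>j k. j \<le> l \<Longrightarrow> k \<le> l \<Longrightarrow> f j k = g j k) \<Longrightarrow> poly_mat l f = poly_mat l g"
  unfolding poly_mat_def by (intro ext cong_mat) simp_all

lemma index_mult_sum: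
  assumes "A \<in> carrier_mat (l + 1) (l + 1)" "B \<in> carrier_mat (l + 1) (l + 1)" "j \<le> l" "k \<le> l"
  shows "(A * B) $$ (j, k) = (\<Sum>m\<le>l. A $$ (j, m) * B $$ (m, k))"
proof -
  have "(A * B) $$ (j, k) = (\<Sum>m = 0..<l + 1. A $$ (j, m) * B $$ (m, k))"
    using assms by (simp add: scalar_prod_def)
  also have "{0..<l + 1} = {..l}" by auto
  finally show ?thesis .
qed

lemma index_mat_adjoint:
  assumes "A \<in> carrier_mat (l + 1) (l + 1)" "j \<le> l" "k \<le> l"
  shows "mat_adjoint A $$ (j, k) = cnj (A $$ (k, j))"
proof -
  have d: "dim_row A = l + 1" "dim_col A = l + 1" using assms(1) by simp_all
  then show ?thesis using assms(2,3)
    by (simp add: mat_adjoint_def mat_of_rows_index conjugate_complex_def)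
qed

lemma mat_adjoint_carrier: "A \<in> carrier_mat (l + 1) (l + 1) \<Longrightarrow> mat_adjoint A \<in> carrier_mat (l + 1) (l + 1)"
  unfolding mat_adjoint_def by auto

lemma mat_eqI_le:
  assumes "A \<in> carrier_mat (l + 1) (l + 1)" "B \<in> carrier_mat (l + 1) (l + 1)"
    "\<And>j k. j \<le> l \<Longrightarrow> k \<le> l \<Longrightarrow> A $$ (j, k) = B $$ (j, k)"
  shows "A = B"
proof (rule eq_matI)
  fix j k assume "j < dim_row B" "k < dim_col B"
  then show "A $$ (j, k) = B $$ (j, k)" using assms(2) by (intro assms(3)) simp_all
qed (use assms(1,2) in simp_all)

lemma matrix_polynomial_poly_mat:
  assumes "matrix_polynomial l F"
  obtains f where "F = poly_mat l f"
proof -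
  obtain d A where F: "\<And>u. F u = mat (l + 1) (l + 1) (\<lambda>(j, k). \<Sum>n\<le>d. of_real u ^ n * A n $$ (j, k))"
    using assms unfolding matrix_polynomial_def matrix_polynomial_with_coeffs_def by blast
  have "F = poly_mat l (\<lambda>j k. \<Sum>n\<le>d. monom (A n $$ (j, k)) n)"
    by (intro ext) (simp add: F poly_mat_def poly_sum poly_monom mult.commute)
  then show ?thesis by (rule that)
qed

lemma Pw_poly_mat: "Pw l w = poly_mat l (spherical l w)"
proof (intro ext mat_eqI_le)
  fix u j k assume jk: "j \<le> l" "k \<le> l"
  show "Pw l w u $$ (j, k) = poly_mat l (spherical l w) u $$ (j, k)"
  proof (cases "j \<le> w + k")
    case True
    have "of_nat j - of_nat w - of_nat k = (of_nat j - of_nat (w + k) :: complex)"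
      "of_nat w + of_nat k + of_nat j + 2 = (of_nat (w + k) + of_nat j + 2 :: complex)"
      by simp_all
    with jk show ?thesis
      by (simp only: poly_mat_index Pw_def index_mat split_conv hypergeometric_gegen[OF True] spherical_def poly_smult)
  next
    case False
    then have "acoef l w k j = 0" using jk by (intro acoef_eq_0) auto
    then show ?thesis using jk by (simp add: poly_mat_index Pw_def spherical_def)
  qed
qed (simp_all add: Pw_def)

lemma mat_deriv_poly_mat: "mat_deriv l (poly_mat l f) = poly_mat l (\<lambda>j k. pderiv (f j k))"
proof (intro ext mat_eqI_le)
  fix u j k assume jk: "j \<le> l" "k \<le> l"
  have "mat_deriv l (poly_mat l f) u $$ (j, k) = vector_derivative (\<lambda>t. poly (f j k) (of_real t)) (at u)"
    using jk by (simp add: mat_deriv_def poly_mat_index)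
  also have "\<dots> = poly (pderiv (f j k)) (of_real u)"
    by (rule vector_derivative_at[OF poly_of_real_has_vector_derivative])
  finally show "mat_deriv l (poly_mat l f) u $$ (j, k) = poly_mat l (\<lambda>j k. pderiv (f j k)) u $$ (j, k)"
    using jk by (simp add: poly_mat_index)
qed (simp_all add: mat_deriv_def)

lemma Psi_mult_poly_mat: "Psi l u * poly_mat l f u = poly_mat l (\<lambda>j k. psi_apply l (\<lambda>m. f m k) j) u"
  unfolding Psi_def Pw_poly_mat
proof (rule mat_eqI_le)
  fix j k assume "j \<le> l" "k \<le> l"
  then show "(poly_mat l (spherical l 0) u * poly_mat l f u) $$ (j, k) = poly_mat l (\<lambda>j k. psi_apply l (\<lambda>m. f m k) j) u $$ (j, k)"
    by (simp add: index_mult_sum[OF poly_mat_carrier poly_mat_carrier] poly_mat_index psi_apply_def poly_sum)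
qed (rule mult_carrier_mat[OF poly_mat_carrier poly_mat_carrier], rule poly_mat_carrier)

lemma diagonal_carrier: "diagonal l d \<in> carrier_mat (l + 1) (l + 1)"
  by (simp add: diagonal_def)

lemma index_diagonal_mult:
  assumes "A \<in> carrier_mat (l + 1) (l + 1)" "j \<le> l" "k \<le> l"
  shows "(diagonal l d * A) $$ (j, k) = d j * A $$ (j, k)" "(A * diagonal l d) $$ (j, k) = A $$ (j, k) * d k"
proof -
  have "(diagonal l d * A) $$ (j, k) = (\<Sum>m\<le>l. (if m = j then d j * A $$ (j, k) else 0))"
    unfolding index_mult_sum[OF diagonal_carrier assms(1) assms(2,3)]
    using assms by (intro sum.cong) (auto simp: diagonal_def)
  then show "(diagonal l d * A) $$ (j, k) = d j * A $$ (j, k)" using assms by simp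
  have "(A * diagonal l d) $$ (j, k) = (\<Sum>m\<le>l. (if m = k then A $$ (j, k) * d k else 0))"
    unfolding index_mult_sum[OF assms(1) diagonal_carrier assms(2,3)]
    using assms by (intro sum.cong) (auto simp: diagonal_def)
  then show "(A * diagonal l d) $$ (j, k) = A $$ (j, k) * d k" using assms by simp
qed

lemma index_add3:
  assumes "A \<in> carrier_mat (l + 1) (l + 1)" "B \<in> carrier_mat (l + 1) (l + 1)" "C \<in> carrier_mat (l + 1) (l + 1)" "j \<le> l" "k \<le> l"
  shows "(A + B + C) $$ (j, k) = A $$ (j, k) + B $$ (j, k) + C $$ (j, k)"
  using assms by simp

lemma index_add2:
  assumes "A \<in> carrier_mat (l + 1) (l + 1)" "B \<in> carrier_mat (l + 1) (l + 1)" "j \<le> l" "k \<le> l"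
  shows "(A + B) $$ (j, k) = A $$ (j, k) + B $$ (j, k)"
  using assms by simp

lemma Dop_poly_mat: "Dop l (poly_mat l f) = poly_mat l (\<lambda>j k. Dtil l (\<lambda>m. f m k) j)"
proof (intro ext mat_eqI_le)
  fix u j k assume jk: "j \<le> l" "k \<le> l"
  let ?u = "complex_of_real u"
  let ?C = "- (?u \<cdot>\<^sub>m Cmat l) + S1 l"
  have C: "?C \<in> carrier_mat (l + 1) (l + 1)" by (simp add: Cmat_def S1_def diagonal_def)
  have "(?C * poly_mat l (\<lambda>j k. pderiv (f j k)) u) $$ (j, k)
     = (\<Sum>m\<le>l. (if m = j then - ?u * (2 * of_nat j + 3) * poly (pderiv (f j k)) ?u else 0)
        + (if m = Suc j then 2 * (of_nat j + 1) * poly (pderiv (f (Suc j) k)) ?u else 0))"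
    unfolding index_mult_sum[OF C poly_mat_carrier jk]
    using jk by (intro sum.cong) (auto simp: Cmat_def S1_def diagonal_def poly_mat_index)
  also have "\<dots> = - ?u * (2 * of_nat j + 3) * poly (pderiv (f j k)) ?u
      + (if j < l then 2 * (of_nat j + 1) * poly (pderiv (f (Suc j) k)) ?u else 0)"
    using jk by (simp add: sum.distrib)
  finally have 1: "(?C * poly_mat l (\<lambda>j k. pderiv (f j k)) u) $$ (j, k) = - ?u * (2 * of_nat j + 3) * poly (pderiv (f j k)) ?u
      + (if j < l then 2 * (of_nat j + 1) * poly (pderiv (f (Suc j) k)) ?u else 0)" .
  have 2: "(Lambda l 0 * poly_mat l f u) $$ (j, k) = - (of_nat j * (of_nat j + 2)) * poly (f j k) ?u"
    unfolding Lambda_def index_diagonal_mult(1)[OF poly_mat_carrier jk] using jk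
    by (simp add: poly_mat_index lambda_def algebra_simps)
  have 3: "(of_real (1 - u\<^sup>2) \<cdot>\<^sub>m poly_mat l (\<lambda>j k. pderiv (pderiv (f j k))) u) $$ (j, k)
    = (1 - ?u\<^sup>2) * poly (pderiv (pderiv (f j k))) ?u"
    using jk by (simp add: poly_mat_def)
  have c1: "of_real (1 - u\<^sup>2) \<cdot>\<^sub>m poly_mat l (\<lambda>j k. pderiv (pderiv (f j k))) u \<in> carrier_mat (l + 1) (l + 1)"
    by simp
  have c2: "?C * poly_mat l (\<lambda>j k. pderiv (f j k)) u \<in> carrier_mat (l + 1) (l + 1)"
    by (rule mult_carrier_mat[OF C poly_mat_carrier])
  have c3: "Lambda l 0 * poly_mat l f u \<in> carrier_mat (l + 1) (l + 1)"
    unfolding Lambda_def by (rule mult_carrier_mat[OF diagonal_carrier poly_mat_carrier])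
  have "Dop l (poly_mat l f) u $$ (j, k) = (1 - ?u\<^sup>2) * poly (pderiv (pderiv (f j k))) ?u
      + (- ?u * (2 * of_nat j + 3) * poly (pderiv (f j k)) ?u
      + (if j < l then 2 * (of_nat j + 1) * poly (pderiv (f (Suc j) k)) ?u else 0))
      + - (of_nat j * (of_nat j + 2)) * poly (f j k) ?u"
    unfolding Dop_def mat_deriv_poly_mat
    using index_add3[OF c1 c2 c3 jk] unfolding 1 2 3 by (rule trans) (rule refl)
  also have "\<dots> = poly (Dtil l (\<lambda>m. f m k) j) ?u"
    by (simp add: Dtil_def power2_eq_square algebra_simps)
  finally show "Dop l (poly_mat l f) u $$ (j, k) = poly_mat l (\<lambda>j k. Dtil l (\<lambda>m. f m k) j) u $$ (j, k)"
    unfolding poly_mat_index[OF jk] .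
qed (unfold Dop_def Lambda_def mat_deriv_poly_mat, intro add_carrier_mat mult_carrier_mat[OF diagonal_carrier poly_mat_carrier], rule poly_mat_carrier)

lemma Eop_poly_mat: "Eop l (poly_mat l f) = poly_mat l (\<lambda>j k. Etil l (\<lambda>m. f m k) j)"
proof (intro ext mat_eqI_le)
  fix u j k assume jk: "j \<le> l" "k \<le> l"
  let ?u = "complex_of_real u"
  let ?R = "?u \<cdot>\<^sub>m R2 l + R1 l"
  have R: "?R \<in> carrier_mat (l + 1) (l + 1)" by (simp add: R1_def R2_def diagonal_def)
  let ?e = "\<lambda>m. poly (pderiv (f m k)) ?u"
  have "(?R * poly_mat l (\<lambda>j k. pderiv (f j k)) u) $$ (j, k)
     = (\<Sum>m\<le>l. (if m = j then ?u * (of_nat l / 2 - of_nat j) * ?e j else 0)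
        + (if m = Suc j then (of_nat j + 1) / 2 * ?e (Suc j) else 0)
        - (if Suc m = j then (of_nat l - of_nat m) / 2 * ?e m else 0))"
    unfolding index_mult_sum[OF R poly_mat_carrier jk]
    using jk by (intro sum.cong) (auto simp: R1_def R2_def diagonal_def poly_mat_index)
  also have "\<dots> = ?u * (of_nat l / 2 - of_nat j) * ?e j + (if j < l then (of_nat j + 1) / 2 * ?e (Suc j) else 0)
      - (case j of 0 \<Rightarrow> 0 | Suc i \<Rightarrow> (of_nat l - of_nat i) / 2 * ?e i)"
    using jk by (cases j) (simp_all add: sum.distrib sum_subtractf)
  finally have 1: "(?R * poly_mat l (\<lambda>j k. pderiv (f j k)) u) $$ (j, k) = ?u * (of_nat l / 2 - of_nat j) * ?e j
      + (if j < l then (of_nat j + 1) / 2 * ?e (Suc j) else 0)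
      - (case j of 0 \<Rightarrow> 0 | Suc i \<Rightarrow> (of_nat l - of_nat i) / 2 * ?e i)" .
  have 2: "(M l 0 * poly_mat l f u) $$ (j, k) = - (of_nat j * (of_nat l / 2 + 1)) * poly (f j k) ?u"
    unfolding M_def index_diagonal_mult(1)[OF poly_mat_carrier jk] using jk
    by (simp add: poly_mat_index mu_def)
  have c2: "?R * poly_mat l (\<lambda>j k. pderiv (f j k)) u \<in> carrier_mat (l + 1) (l + 1)"
    by (rule mult_carrier_mat[OF R poly_mat_carrier])
  have c3: "M l 0 * poly_mat l f u \<in> carrier_mat (l + 1) (l + 1)"
    unfolding M_def by (rule mult_carrier_mat[OF diagonal_carrier poly_mat_carrier])
  have "Eop l (poly_mat l f) u $$ (j, k) = (?u * (of_nat l / 2 - of_nat j) * ?e j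
      + (if j < l then (of_nat j + 1) / 2 * ?e (Suc j) else 0)
      - (case j of 0 \<Rightarrow> 0 | Suc i \<Rightarrow> (of_nat l - of_nat i) / 2 * ?e i))
      + - (of_nat j * (of_nat l / 2 + 1)) * poly (f j k) ?u"
    unfolding Eop_def mat_deriv_poly_mat
    using index_add2[OF c2 c3 jk] unfolding 1 2 by (rule trans) (rule refl)
  also have "\<dots> = poly (Etil l (\<lambda>m. f m k) j) ?u"
    by (cases j) (simp_all add: Etil_def algebra_simps)
  finally show "Eop l (poly_mat l f) u $$ (j, k) = poly_mat l (\<lambda>j k. Etil l (\<lambda>m. f m k) j) u $$ (j, k)"
    unfolding poly_mat_index[OF jk] .
qed (unfold Eop_def M_def mat_deriv_poly_mat, intro add_carrier_mat mult_carrier_mat[OF diagonal_carrier poly_mat_carrier], rule poly_mat_carrier)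

section \<open>The weight matrix and the orthogonal polynomials\<close>

lemma mat_adjoint_mult:
  fixes A B :: "complex mat"
  assumes A: "A \<in> carrier_mat (l + 1) (l + 1)" and B: "B \<in> carrier_mat (l + 1) (l + 1)"
  shows "mat_adjoint (A * B) = mat_adjoint B * mat_adjoint A"
proof (rule mat_eqI_le)
  note AB = mult_carrier_mat[OF A B]
  note A' = mat_adjoint_carrier[OF A] and B' = mat_adjoint_carrier[OF B]
  show "mat_adjoint (A * B) \<in> carrier_mat (l + 1) (l + 1)" by (rule mat_adjoint_carrier[OF AB])
  show "mat_adjoint B * mat_adjoint A \<in> carrier_mat (l + 1) (l + 1)" by (rule mult_carrier_mat[OF B' A'])
  fix j k assume jk: "j \<le> l" "k \<le> l"
  show "mat_adjoint (A * B) $$ (j, k) = (mat_adjoint B * mat_adjoint A) $$ (j, k)"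
    unfolding index_mat_adjoint[OF AB jk] index_mult_sum[OF A B jk(2,1)] index_mult_sum[OF B' A' jk] cnj_sum
    using jk by (intro sum.cong) (simp_all add: index_mat_adjoint[OF A] index_mat_adjoint[OF B])
qed

lemma Umat_gram: "mat_adjoint (Umat l) * Umat l = diagonal l (hahn_norm l)"
proof (rule mat_eqI_le)
  have U: "Umat l \<in> carrier_mat (l + 1) (l + 1)" by (simp add: Umat_def)
  note U' = mat_adjoint_carrier[OF U]
  show "mat_adjoint (Umat l) * Umat l \<in> carrier_mat (l + 1) (l + 1)" by (rule mult_carrier_mat[OF U' U])
  show "diagonal l (hahn_norm l) \<in> carrier_mat (l + 1) (l + 1)" by (rule diagonal_carrier)
  fix j k assume jk: "j \<le> l" "k \<le> l"
  have real: "cnj (hahn l i x) = hahn l i x" for i x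
    by (simp add: hahn_def legendre_coeff_def)
  have "(mat_adjoint (Umat l) * Umat l) $$ (j, k) = (\<Sum>x\<le>l. hahn l j x * hahn l k x)"
    unfolding index_mult_sum[OF U' U jk]
    using jk by (intro sum.cong) (simp_all add: index_mat_adjoint[OF U] Umat_hahn real)
  also have "\<dots> = (if j = k then hahn_norm l j else 0)"
    using hahn_orthogonal[OF jk] by (simp add: hahn_norm_def power2_eq_square)
  finally show "(mat_adjoint (Umat l) * Umat l) $$ (j, k) = diagonal l (hahn_norm l) $$ (j, k)"
    using jk by (simp add: diagonal_def)
qed

lemma mult_diagonal_diagonal: "diagonal l a * diagonal l b = diagonal l (\<lambda>j. a j * b j)"
proof (rule mat_eqI_le)
  fix j k assume jk: "j \<le> l" "k \<le> l"
  show "(diagonal l a * diagonal l b) $$ (j, k) = diagonal l (\<lambda>j. a j * b j) $$ (j, k)"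
    unfolding index_diagonal_mult(1)[OF diagonal_carrier jk] using jk by (simp add: diagonal_def)
qed (rule mult_carrier_mat diagonal_carrier)+

lemma Tmat_sandwich:
  assumes "u\<^sup>2 \<le> 1"
  shows "mat_adjoint (Tmat l u) * (diagonal l d * Tmat l u) = diagonal l (\<lambda>j. d j * of_real (1 - u\<^sup>2) ^ j)"
proof -
  have T: "Tmat l u = diagonal l (\<lambda>j. of_real (sqrt (1 - u\<^sup>2) ^ j))"
    unfolding Tmat_def diagonal_def ..
  have T': "mat_adjoint (Tmat l u) = diagonal l (\<lambda>j. of_real (sqrt (1 - u\<^sup>2) ^ j))"
    unfolding T
  proof (rule mat_eqI_le)
    fix j k assume jk: "j \<le> l" "k \<le> l"
    show "mat_adjoint (diagonal l (\<lambda>j. complex_of_real (sqrt (1 - u\<^sup>2) ^ j))) $$ (j, k) = diagonal l (\<lambda>j. of_real (sqrt (1 - u\<^sup>2) ^ j)) $$ (j, k)"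
      unfolding index_mat_adjoint[OF diagonal_carrier jk] using jk by (simp add: diagonal_def)
  qed (rule mat_adjoint_carrier diagonal_carrier)+
  have sq: "of_real (sqrt (1 - u\<^sup>2) ^ j) * (d j * of_real (sqrt (1 - u\<^sup>2) ^ j)) = d j * (of_real (1 - u\<^sup>2) ^ j :: complex)" for j
  proof -
    have "sqrt (1 - u\<^sup>2) ^ j * sqrt (1 - u\<^sup>2) ^ j = (1 - u\<^sup>2) ^ j"
      using assms by (simp flip: power_mult_distrib)
    then have "complex_of_real (sqrt (1 - u\<^sup>2) ^ j) * of_real (sqrt (1 - u\<^sup>2) ^ j) = of_real (1 - u\<^sup>2) ^ j"
      by (metis of_real_mult of_real_power)
    then show ?thesis by (metis mult.assoc mult.commute)
  qed
  show ?thesis unfolding T' unfolding T mult_diagonal_diagonal sq ..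
qed

lemma weight_assoc:
  assumes "P \<in> carrier_mat n n" "A \<in> carrier_mat n n" "B \<in> carrier_mat n n" "C \<in> carrier_mat n n"
    "D \<in> carrier_mat n n" "E \<in> carrier_mat n n" "F \<in> carrier_mat n n" "Q \<in> carrier_mat n n"
  shows "P * (c \<cdot>\<^sub>m (A * B * C * D * E * F)) * Q = (c :: complex) \<cdot>\<^sub>m ((P * A) * ((B * ((C * D) * E)) * (F * Q)))"
proof -
  note assoc = assoc_mult_mat[of _ n n _ n _ n]
  let ?X = "A * B * C * D * E * F"
  have X: "?X \<in> carrier_mat n n" using assms by (intro mult_carrier_mat)
  have "P * (c \<cdot>\<^sub>m ?X) * Q = (c \<cdot>\<^sub>m (P * ?X)) * Q"
    unfolding mult_smult_distrib[OF assms(1) X] ..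
  also have "\<dots> = c \<cdot>\<^sub>m (P * ?X * Q)"
    by (rule mult_smult_assoc_mat[OF mult_carrier_mat[OF assms(1) X] assms(8)])
  also have "P * (A * B * C * D * E * F) * Q = (P * A) * ((B * ((C * D) * E)) * (F * Q))"
    using assms by (simp add: assoc)
  finally show ?thesis .
qed

text \<open>
  The weight is regrouped around \<open>\<Psi> P\<close> and \<open>\<Psi> Q\<close>. Inside, \<open>U\<^sup>* U\<close> and therefore \<open>T\<^sup>* U\<^sup>* U T\<close> are diagonal.
  The restriction on \<open>u\<close> makes the square of the square root equal to \<open>1 - u\<^sup>2\<close>.
\<close>

lemma W_integrand:
  assumes u: "u\<^sup>2 \<le> 1" and jk: "j \<le> l" "k \<le> l"
  shows "(mat_adjoint (poly_mat l f u) * Wmat l u * poly_mat l g u) $$ (j, k)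
    = of_real (2 / pi) * (of_real (sqrt (1 - u\<^sup>2)) * poly (\<Sum>m\<le>l. smult (hahn_norm l m)
        ([:1, 0, - 1:] ^ m * (cnj_poly (psi_apply l (\<lambda>i. f i j) m) * psi_apply l (\<lambda>i. g i k) m))) (of_real u))"
proof -
  let ?A = "poly_mat l (\<lambda>j k. psi_apply l (\<lambda>m. f m k) j) u" and ?B = "poly_mat l (\<lambda>j k. psi_apply l (\<lambda>m. g m k) j) u"
  let ?c = "complex_of_real (2 / pi * sqrt (1 - u\<^sup>2))" and ?u = "complex_of_real u"
  have carr: "Psi l u \<in> carrier_mat (l + 1) (l + 1)" "Tmat l u \<in> carrier_mat (l + 1) (l + 1)" "Umat l \<in> carrier_mat (l + 1) (l + 1)"
    by (simp_all add: Psi_def Pw_def Tmat_def Umat_def)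
  note carr' = carr[THEN mat_adjoint_carrier]
  have "mat_adjoint (poly_mat l f u) * Wmat l u * poly_mat l g u
    = ?c \<cdot>\<^sub>m ((mat_adjoint (poly_mat l f u) * mat_adjoint (Psi l u)) *
      ((mat_adjoint (Tmat l u) * ((mat_adjoint (Umat l) * Umat l) * Tmat l u)) * (Psi l u * poly_mat l g u)))"
    unfolding Wmat_def
    by (rule weight_assoc[OF mat_adjoint_carrier[OF poly_mat_carrier] carr'(1,2,3) carr(3,2,1) poly_mat_carrier])
  also have "\<dots> = ?c \<cdot>\<^sub>m (mat_adjoint ?A * (diagonal l (\<lambda>j. hahn_norm l j * of_real (1 - u\<^sup>2) ^ j) * ?B))"
    unfolding Umat_gram Tmat_sandwich[OF u] mat_adjoint_mult[OF carr(1) poly_mat_carrier, symmetric] Psi_mult_poly_mat ..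
  finally have eq: "mat_adjoint (poly_mat l f u) * Wmat l u * poly_mat l g u = ?c \<cdot>\<^sub>m (mat_adjoint ?A * (diagonal l (\<lambda>j. hahn_norm l j * of_real (1 - u\<^sup>2) ^ j) * ?B))" .
  let ?DB = "diagonal l (\<lambda>j. hahn_norm l j * of_real (1 - u\<^sup>2) ^ j) * ?B"
  have DB: "?DB \<in> carrier_mat (l + 1) (l + 1)" by (rule mult_carrier_mat[OF diagonal_carrier poly_mat_carrier])
  have A': "mat_adjoint ?A \<in> carrier_mat (l + 1) (l + 1)" by (rule mat_adjoint_carrier[OF poly_mat_carrier])
  have "(mat_adjoint (poly_mat l f u) * Wmat l u * poly_mat l g u) $$ (j, k) = ?c * ((mat_adjoint ?A * ?DB) $$ (j, k))"
    unfolding eq using jk mult_carrier_mat[OF A' DB] by (intro index_smult_mat(1)) auto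
  also have "(mat_adjoint ?A * ?DB) $$ (j, k) = (\<Sum>m\<le>l. cnj (poly (psi_apply l (\<lambda>i. f i j) m) ?u)
      * (hahn_norm l m * of_real (1 - u\<^sup>2) ^ m * poly (psi_apply l (\<lambda>i. g i k) m) ?u))"
    unfolding index_mult_sum[OF A' DB jk]
  proof (rule sum.cong[OF refl])
    fix m assume "m \<in> {..l}"
    then have m: "m \<le> l" by simp
    show "mat_adjoint ?A $$ (j, m) * ?DB $$ (m, k) = cnj (poly (psi_apply l (\<lambda>i. f i j) m) ?u)
      * (hahn_norm l m * of_real (1 - u\<^sup>2) ^ m * poly (psi_apply l (\<lambda>i. g i k) m) ?u)"
      unfolding index_mat_adjoint[OF poly_mat_carrier jk(1) m] index_diagonal_mult(1)[OF poly_mat_carrier m jk(2)]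
        poly_mat_index[OF m jk(1)] poly_mat_index[OF m jk(2)] ..
  qed
  also have "\<dots> = poly (\<Sum>m\<le>l. smult (hahn_norm l m)
        ([:1, 0, - 1:] ^ m * (cnj_poly (psi_apply l (\<lambda>i. f i j) m) * psi_apply l (\<lambda>i. g i k) m))) ?u"
    unfolding poly_sum by (rule sum.cong) (simp_all add: poly_cnj_poly poly_power power2_eq_square mult_ac)
  finally show ?thesis by simp
qed

lemma W_inner_poly_mat:
  assumes jk: "j \<le> l" "k \<le> l"
  shows "W_inner l (poly_mat l f) (poly_mat l g) $$ (j, k)
    = of_real (2 / pi) * bar_form l (psi_apply l (\<lambda>i. f i j)) (psi_apply l (\<lambda>i. g i k))"
proof -
  let ?p = "\<Sum>m\<le>l. smult (hahn_norm l m)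
        ([:1, 0, - 1:] ^ m * (cnj_poly (psi_apply l (\<lambda>i. f i j) m) * psi_apply l (\<lambda>i. g i k) m))"
  have "W_inner l (poly_mat l f) (poly_mat l g) $$ (j, k)
    = integral {-1..1} (\<lambda>u. (mat_adjoint (poly_mat l f u) * Wmat l u * poly_mat l g u) $$ (j, k))"
    using jk by (simp add: W_inner_def)
  also have "\<dots> = integral {-1..1} (\<lambda>u. of_real (2 / pi) * (of_real (sqrt (1 - u\<^sup>2)) * poly ?p (of_real u)))"
  proof (rule integral_cong)
    fix u :: real assume "u \<in> {-1..1}"
    then have "u\<^sup>2 \<le> 1" by (simp add: abs_square_le_1 abs_le_iff)
    then show "(mat_adjoint (poly_mat l f u) * Wmat l u * poly_mat l g u) $$ (j, k)
      = of_real (2 / pi) * (of_real (sqrt (1 - u\<^sup>2)) * poly ?p (of_real u))"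
      by (rule W_integrand[OF _ jk])
  qed
  also have "\<dots> = of_real (2 / pi) * cheb_int ?p"
    unfolding cheb_int_def by (rule integral_mult_right)
  also have "cheb_int ?p = bar_form l (psi_apply l (\<lambda>i. f i j)) (psi_apply l (\<lambda>i. g i k))"
    by (simp only: bar_form_def cheb_int_sum cheb_int_smult)
  finally show ?thesis .
qed

lemma W_inner_carrier: "W_inner l P Q \<in> carrier_mat (l + 1) (l + 1)"
  by (simp add: W_inner_def)

lemma psi_apply_above: "l < j \<Longrightarrow> psi_apply l f j = 0"
  by (simp add: psi_apply_def psi_above_diagonal)

lemma symmetric_Dop: "symmetric_wrt_W l (Dop l)"
  unfolding symmetric_wrt_W_def
proof (intro allI impI, elim conjE)
  fix P Q assume "matrix_polynomial l P" "matrix_polynomial l Q"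
  then obtain f g where PQ: "P = poly_mat l f" "Q = poly_mat l g" by (metis matrix_polynomial_poly_mat)
  show "W_inner l (Dop l P) Q = W_inner l P (Dop l Q)"
    unfolding PQ Dop_poly_mat
  proof (rule mat_eqI_le[OF W_inner_carrier W_inner_carrier])
    fix j k assume jk: "j \<le> l" "k \<le> l"
    have "psi_apply l (Dtil l h) = Dbar (psi_apply l h)" for h by (rule ext) (rule Dbar_psi_apply[symmetric])
    then show "W_inner l (poly_mat l (\<lambda>j k. Dtil l (\<lambda>m. f m k) j)) (poly_mat l g) $$ (j, k)
      = W_inner l (poly_mat l f) (poly_mat l (\<lambda>j k. Dtil l (\<lambda>m. g m k) j)) $$ (j, k)"
      unfolding W_inner_poly_mat[OF jk] by (simp add: Dbar_symmetric)
  qed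
qed

lemma symmetric_Eop: "symmetric_wrt_W l (Eop l)"
  unfolding symmetric_wrt_W_def
proof (intro allI impI, elim conjE)
  fix P Q assume "matrix_polynomial l P" "matrix_polynomial l Q"
  then obtain f g where PQ: "P = poly_mat l f" "Q = poly_mat l g" by (metis matrix_polynomial_poly_mat)
  show "W_inner l (Eop l P) Q = W_inner l P (Eop l Q)"
    unfolding PQ Eop_poly_mat
  proof (rule mat_eqI_le[OF W_inner_carrier W_inner_carrier])
    fix j k assume jk: "j \<le> l" "k \<le> l"
    have "psi_apply l (Etil l h) = Ebar l (psi_apply l h)" for h by (rule ext) (rule Ebar_psi_apply[symmetric])
    then show "W_inner l (poly_mat l (\<lambda>j k. Etil l (\<lambda>m. f m k) j)) (poly_mat l g) $$ (j, k)
      = W_inner l (poly_mat l f) (poly_mat l (\<lambda>j k. Etil l (\<lambda>m. g m k) j)) $$ (j, k)"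
      unfolding W_inner_poly_mat[OF jk] by (simp add: Ebar_symmetric psi_apply_above)
  qed
qed

text \<open>
  Solving for the unit vectors produces a right inverse of \<open>\<Psi>\<close>, which for square matrices is an inverse.
\<close>

lemma Psi_inverse:
  obtains B where "mat_inverse (Psi l u) = Some B" "B * Psi l u = 1\<^sub>m (l + 1)" "B \<in> carrier_mat (l + 1) (l + 1)"
proof -
  let ?g = "\<lambda>k j. if j = k then 1 else 0 :: complex poly"
  obtain f where f: "\<And>k j. j \<le> l \<Longrightarrow> psi_apply l (f k) j = ?g k j"
    using psi_apply_surj[of l "?g _"] by metis
  let ?R = "poly_mat l (\<lambda>m k. f k m) u"
  have Psi: "Psi l u \<in> carrier_mat (l + 1) (l + 1)" by (simp add: Psi_def Pw_def)
  have "Psi l u * ?R = 1\<^sub>m (l + 1)"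
    unfolding Psi_mult_poly_mat
    by (rule mat_eqI_le[OF poly_mat_carrier]) (simp_all add: poly_mat_index f)
  moreover from mat_mult_left_right_inverse[OF Psi poly_mat_carrier this]
  have "?R * Psi l u = 1\<^sub>m (l + 1)" .
  ultimately have "Psi l u \<in> Units (ring_mat TYPE(complex) (l + 1) ())"
    unfolding Units_def ring_mat_def using Psi poly_mat_carrier by auto
  then have "mat_inverse (Psi l u) \<noteq> None" using mat_inverse(1)[OF Psi, where b = "()"] by blast
  then obtain B where "mat_inverse (Psi l u) = Some B" by blast
  with mat_inverse(2)[OF Psi this] show ?thesis using that by blast
qed

text \<open>
  Solving \<open>\<Psi> F = P\<^sub>w\<close> over polynomials identifies \<open>\<Psi>\<^sup>-\<^sup>1 P\<^sub>w\<close> and shows that it is a matrix polynomial.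
\<close>

lemma Ptilde_poly_mat:
  obtains f where "Ptilde l w = poly_mat l f" "\<And>k. k \<le> l \<Longrightarrow> psi_apply l (\<lambda>m. f m k) = (\<lambda>j. spherical l w j k)"
proof -
  obtain f where f: "\<And>k j. j \<le> l \<Longrightarrow> psi_apply l (f k) j = spherical l w j k"
    using psi_apply_surj[of l "\<lambda>j. spherical l w j _"] by metis
  have "Ptilde l w u = poly_mat l (\<lambda>m k. f k m) u" for u
  proof -
    obtain B where B: "mat_inverse (Psi l u) = Some B" "B * Psi l u = 1\<^sub>m (l + 1)" "B \<in> carrier_mat (l + 1) (l + 1)"
      by (rule Psi_inverse)
    have Psi: "Psi l u \<in> carrier_mat (l + 1) (l + 1)" by (simp add: Psi_def Pw_def)
    have "Pw l w u = Psi l u * poly_mat l (\<lambda>m k. f k m) u"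
      unfolding Psi_mult_poly_mat Pw_poly_mat by (rule fun_cong[OF poly_mat_cong]) (simp add: f)
    then have "Ptilde l w u = B * (Psi l u * poly_mat l (\<lambda>m k. f k m) u)"
      by (simp add: Ptilde_def B(1))
    also have "\<dots> = B * Psi l u * poly_mat l (\<lambda>m k. f k m) u"
      by (rule assoc_mult_mat[OF B(3) Psi poly_mat_carrier, symmetric])
    finally show ?thesis unfolding B(2) by (simp only: left_mult_one_mat[OF poly_mat_carrier])
  qed
  moreover have "psi_apply l (\<lambda>m. f k m) = (\<lambda>j. spherical l w j k)" if "k \<le> l" for k
  proof
    fix j show "psi_apply l (\<lambda>m. f k m) j = spherical l w j k"
      using f[of j k] psi_apply_above[of l j] spherical_eq_0[OF that, of j w] by (cases "j \<le> l") auto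
  qed
  ultimately show ?thesis using that[of "\<lambda>m k. f k m"] by blast
qed

lemma psi_apply_smult: "psi_apply l (\<lambda>m. smult c (f m)) j = smult c (psi_apply l f j)"
  unfolding psi_apply_def by (rule poly_pointwise_eqI) (simp add: poly_sum sum_distrib_left mult_ac)

text \<open>
  The eigenvalue equations pass from the columns of \<open>P\<^sub>w\<close> to those of \<open>\<Psi>\<^sup>-\<^sup>1 P\<^sub>w\<close> because \<open>\<Psi>\<close> is injective.
\<close>

lemma Ptilde_column_eigen:
  assumes k: "k \<le> l" and f: "psi_apply l f = (\<lambda>j. spherical l w j k)" and j: "j \<le> l"
  shows "Dtil l f j = smult (lambda w k) (f j)" "Etil l f j = smult (mu l w k) (f j)"
  by (rule psi_apply_inj[OF _ j];
      simp add: f psi_apply_smult Dbar_spherical[OF k] Ebar_spherical[OF k]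
        flip: Dbar_psi_apply Ebar_psi_apply)+

lemma poly_eq_sum_coeff:
  assumes "\<And>d. w < d \<Longrightarrow> coeff p d = 0"
  shows "poly p (z :: complex) = (\<Sum>n\<le>w. z ^ n * coeff p n)"
proof -
  have "degree p \<le> w" using assms by (intro degree_le) auto
  then have "(\<Sum>n\<le>degree p. coeff p n * z ^ n) = (\<Sum>n\<le>w. coeff p n * z ^ n)"
    by (intro sum.mono_neutral_left) (auto simp: coeff_eq_0)
  then show ?thesis by (simp add: poly_altdef mult.commute)
qed

lemma Ptilde_degree: "degree_nonsingular_lead l w (Ptilde l w)"
proof -
  obtain f where P: "Ptilde l w = poly_mat l f" and f: "\<And>k. k \<le> l \<Longrightarrow> psi_apply l (\<lambda>m. f m k) = (\<lambda>j. spherical l w j k)"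
    by (rule Ptilde_poly_mat) blast
  \<comment> \<open>The top entry of each column of \<open>P\<^sub>w\<close> has the value 1 at \<open>u = 1\<close>.\<close>
  have ne: "\<exists>j\<le>l. f j k \<noteq> 0" if "k \<le> l" for k
  proof (rule ccontr)
    assume "\<not> ?thesis"
    then have "psi_apply l (\<lambda>m. f m k) 0 = 0" by (simp add: psi_apply_def)
    then have "spherical l w 0 k = 0" unfolding f[OF that] .
    then show False using poly_gegen_1[of "w + k" 0] by (simp add: spherical_def)
  qed
  note deg = eigenvector_degree[OF _ Ptilde_column_eigen(1)[OF _ f] Ptilde_column_eigen(2)[OF _ f] ne]
  define A where "A n = mat (l + 1) (l + 1) (\<lambda>(j, k). coeff (f j k) n)" for n
  have "matrix_polynomial_with_coeffs l w A (Ptilde l w)"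
    unfolding matrix_polynomial_with_coeffs_def P poly_mat_def A_def
  proof (intro conjI allI cong_mat refl)
    fix u :: real and j k assume jk: "j < l + 1" "k < l + 1"
    then have "poly (f j k) (of_real u) = (\<Sum>n\<le>w. of_real u ^ n * coeff (f j k) n)"
      by (intro poly_eq_sum_coeff deg(1)) auto
    then show "(case (j, k) of (j, k) \<Rightarrow> poly (f j k) (of_real u)) = (case (j, k) of (j, k) \<Rightarrow>
        \<Sum>n\<le>w. of_real u ^ n * mat (l + 1) (l + 1) (\<lambda>(j, k). coeff (f j k) n) $$ (j, k))"
      using jk by simp
  qed simp
  moreover have "invertible_mat (A w)"
  proof -
    define c where "c k = coeff (f k k) w" for k
    have Aw: "A w = diagonal l c"
      unfolding A_def diagonal_def by (rule cong_mat) (auto simp: c_def intro!: deg(3))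
    have c: "c k \<noteq> 0" if "k \<le> l" for k unfolding c_def by (rule deg(2)) (use that in auto)
    have "diagonal l (\<lambda>j. c j * (1 / c j)) = 1\<^sub>m (l + 1)"
      unfolding diagonal_def one_mat_def by (rule cong_mat) (auto simp: c)
    then have "diagonal l c * diagonal l (\<lambda>j. 1 / c j) = 1\<^sub>m (l + 1)" "diagonal l (\<lambda>j. 1 / c j) * diagonal l c = 1\<^sub>m (l + 1)"
      unfolding mult_diagonal_diagonal by (simp_all add: mult.commute)
    then show ?thesis unfolding invertible_mat_def inverts_mat_def Aw
      by (intro conjI exI[of _ "diagonal l (\<lambda>j. 1 / c j)"]) (simp_all add: diagonal_def)
  qed
  ultimately show ?thesis unfolding degree_nonsingular_lead_def by blast
qed

lemma Ptilde_orthogonal: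
  assumes "w \<noteq> w'"
  shows "W_inner l (Ptilde l w) (Ptilde l w') = 0\<^sub>m (l + 1) (l + 1)"
proof -
  obtain f where P: "Ptilde l w = poly_mat l f" and f: "\<And>k. k \<le> l \<Longrightarrow> psi_apply l (\<lambda>m. f m k) = (\<lambda>j. spherical l w j k)"
    by (rule Ptilde_poly_mat) blast
  obtain g where Q: "Ptilde l w' = poly_mat l g" and g: "\<And>k. k \<le> l \<Longrightarrow> psi_apply l (\<lambda>m. g m k) = (\<lambda>j. spherical l w' j k)"
    by (rule Ptilde_poly_mat) blast
  show ?thesis unfolding P Q
    by (rule mat_eqI_le[OF W_inner_carrier]) (simp_all add: W_inner_poly_mat f g spherical_orthogonal assms)
qed

lemma Ptilde_eigenfunction:
  "Dop l (Ptilde l w) u = Ptilde l w u * Lambda l w" "Eop l (Ptilde l w) u = Ptilde l w u * M l w"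
proof -
  obtain f where P: "Ptilde l w = poly_mat l f" and f: "\<And>k. k \<le> l \<Longrightarrow> psi_apply l (\<lambda>m. f m k) = (\<lambda>j. spherical l w j k)"
    by (rule Ptilde_poly_mat) blast
  note eigen = Ptilde_column_eigen[OF _ f]
  show "Dop l (Ptilde l w) u = Ptilde l w u * Lambda l w"
    unfolding P Dop_poly_mat Lambda_def
  proof (rule mat_eqI_le[OF poly_mat_carrier mult_carrier_mat[OF poly_mat_carrier diagonal_carrier]])
    fix j k assume jk: "j \<le> l" "k \<le> l"
    show "poly_mat l (\<lambda>j k. Dtil l (\<lambda>m. f m k) j) u $$ (j, k) = (poly_mat l f u * diagonal l (lambda w)) $$ (j, k)"
      unfolding index_diagonal_mult(2)[OF poly_mat_carrier jk] poly_mat_index[OF jk] eigen(1)[OF jk(2) jk(2) jk(1)] by simp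
  qed
  show "Eop l (Ptilde l w) u = Ptilde l w u * M l w"
    unfolding P Eop_poly_mat M_def
  proof (rule mat_eqI_le[OF poly_mat_carrier mult_carrier_mat[OF poly_mat_carrier diagonal_carrier]])
    fix j k assume jk: "j \<le> l" "k \<le> l"
    show "poly_mat l (\<lambda>j k. Etil l (\<lambda>m. f m k) j) u $$ (j, k) = (poly_mat l f u * diagonal l (mu l w)) $$ (j, k)"
      unfolding index_diagonal_mult(2)[OF poly_mat_carrier jk] poly_mat_index[OF jk] eigen(2)[OF jk(2) jk(2) jk(1)] by simp
  qed
qed

theorem theorem10p10:
  fixes l :: nat
  assumes "even l"
  shows "(\<forall>w. degree_nonsingular_lead l w (Ptilde l w)) \<and>
    (\<forall>w w'. w \<noteq> w' \<longrightarrow> W_inner l (Ptilde l w) (Ptilde l w') = 0\<^sub>m (l + 1) (l + 1)) \<and>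
    symmetric_wrt_W l (Dop l) \<and>
    symmetric_wrt_W l (Eop l) \<and>
    (\<forall>w u. Dop l (Ptilde l w) u = Ptilde l w u * Lambda l w) \<and>
    (\<forall>w u. Eop l (Ptilde l w) u = Ptilde l w u * M l w)"
  by (intro conjI allI impI Ptilde_degree Ptilde_orthogonal symmetric_Dop symmetric_Eop Ptilde_eigenfunction)

end
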